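(* Let $\mathbf{B}=[-1,1]^n$, $f\in\mathbb{R}[x,y]$, $g_1,\ldots,g_s\in\mathbb{R}[x,y]$, $g_{s+1}(y):=1-\|y\|^2$, $\theta_i(x):=1-x_i^2$ for $i=1,\ldots,n$, and $$\mathbf{K}=\{(x,y)\in\mathbb{R}^n\times\mathbb{R}^m: g_j(x,y)\ge 0,\ j=1,\ldots,s+1;\ \theta_i(x)\ge 0,\ i=1,\ldots,n\}.$$ Assume that $\mathbf{K}$ has nonempty interior and that $\mathbf{K}_x:=\{y\in\mathbb{R}^m:(x,y)\in\mathbf{K}\}\ne\emptyset$ for every $x\in\mathbf{B}$. Let $\overline{J_f}(x):=\max_y\{f(x,y):y\in\mathbf{K}_x\}$ for $x\in\mathbf{B}$. Let $g_0:=1$, $v_j:=\lceil\deg(g_j)/2\rceil$ for $j=0,\ldots,s+1$, and for each integer $k\ge\max_j v_j$ with $2k\ge\deg f$ consider the semidefinite program $$(\mathrm{P}_k)\qquad \rho_k=\inf_{p,\sigma_j,\psi_i}\ \int_{\mathbf{B}}p(x)\,d\lambda(x)$$ subject to $$p(x)-f(x,y)=\sum_{j=0}^{s+1}\sigma_j(x,y)\,g_j(x,y)+\sum_{i=1}^n\psi_i(x,y)\,\theta_i(x),$$ $$p\in\mathbb{R}[x]_{2k};\quad \sigma_j\in\Sigma_{k-v_j}[x,y],\ j=0,\ldots,s+1;\quad \psi_i\in\Sigma_{k-1}[x,y],\ i=1,\ldots,n,$$ and its dual $$(\mathrm{P}_k^* )\qquad \rho_k^*=\sup_{z}\ L_z(f)$$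 subject to $$M_{k-v_j}(g_j\,z)\succeq 0,\ j=0,\ldots,s+1;\quad M_{k-1}(\theta_i\,z)\succeq 0,\ i=1,\ldots,n;\quad L_z(x^\alpha)=\gamma_\alpha,\ \alpha\in\mathbb{N}^n_{2k},$$ where the unknown is a real sequence $z=(z_{\alpha\beta})$, $(\alpha,\beta)\in\mathbb{N}^{n+m}_{2k}$. Then there is no duality gap between $(\mathrm{P}_k)$ and $(\mathrm{P}_k^* )$, i.e. $\rho_k=\rho_k^*$. Moreover $(\mathrm{P}_k)$ has an optimal solution with polynomial part $p_k^*\in\mathbb{R}[x]_{2k}$, $(\mathrm{P}_k^* )$ has an optimal solution $z^*=(z^*_{\alpha\beta})$, $(\alpha,\beta)\in\mathbb{N}^{n+m}_{2k}$, and $$\lim_{k\to\infty}\int_{\mathbf{B}}|p_k^*(x)-\overline{J_f}(x)|\,dx=0.$$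
   Context: $\mathbb{R}[x]_d$ is the space of real polynomials in $x=(x_1,\ldots,x_n)$ of degree at most $d$; $\Sigma_d[x,y]$ is the convex cone of real polynomials in $(x,y)=(x_1,\ldots,x_n,y_1,\ldots,y_m)$ of degree at most $2d$ that are sums of squares of polynomials. $\mathbb{N}^N_d:=\{\alpha\in\mathbb{N}^N:\sum_i\alpha_i\le d\}$. $\lambda$ is the Lebesgue measure on $\mathbf{B}=[-1,1]^n$ scaled to be a probability measure, with moments $\gamma_\alpha=\int_{\mathbf{B}}x^\alpha\,d\lambda(x)$, so that $\gamma_\alpha=0$ if some $\alpha_i$ is odd and $\gamma_\alpha=\prod_{i=1}^n(\alpha_i+1)^{-1}$ otherwise. Given $z=(z_{\alpha\beta})_{(\alpha,\beta)\in\mathbb{N}^{n+m}_{2k}}$, the Riesz functional is the linear functional $L_z$ defined on polynomials $h=\sum_{\alpha,\beta}h_{\alpha\beta}x^\alpha y^\beta$ of degree at most $2k$ by $L_z(h)=\sum_{\alpha,\beta}h_{\alpha\beta}z_{\alpha\beta}$. For a polynomial $g\in\mathbb{R}[x,y]$, the localizing matrix $M_d(g\,z)$ (defined when $2d+\deg g\le 2k$) is the real symmetric matrix with rows and columns indexed by $\mathbb{N}^{n+m}_d$ and with entries $M_d(g\,z)\big((\alpha,\beta),(\alpha',\beta')\big)=L_z\big(g\,x^{\alpha+\alpha'}y^{\beta+\beta'}\big)$; for $g=g_0=1$ it is the moment matrix $M_d(z)$. $A\succeq0$ means that the symmetric matrix $A$ is positive semidefinite. *)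

theory Defs
  imports "HOL-Analysis.Analysis" "HOL-Library.Poly_Mapping"
begin

text \<open>
  The dimensions n and m are the cardinalities of the index types \<open>'n\<close> and \<open>'m\<close>.
  Exponents of monomials are vectors of natural numbers; a polynomial is the finitely supported
  family of its coefficients, and multiplication is the convolution product of
  \<open>HOL-Library.Poly_Mapping\<close>.
\<close>

type_synonym 'n x_poly = "(nat, 'n) vec \<Rightarrow>\<^sub>0 real"
type_synonym ('n, 'm) xy_exp = "(nat, 'n) vec \<times> (nat, 'm) vec"
type_synonym ('n, 'm) xy_poly = "('n, 'm) xy_exp \<Rightarrow>\<^sub>0 real"


subsection \<open>Polynomials\<close>

definition x_exp_deg :: "nat ^ 'n \<Rightarrow> nat" where
  "x_exp_deg \<alpha> = (\<Sum>i\<in>UNIV. \<alpha> $ i)"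

definition xy_exp_deg :: "('n::finite, 'm::finite) xy_exp \<Rightarrow> nat" where
  "xy_exp_deg a = (\<Sum>i\<in>UNIV. fst a $ i) + (\<Sum>j\<in>UNIV. snd a $ j)"

text \<open>Total degrees; the zero polynomial is given degree 0.\<close>

definition x_deg :: "('n::finite) x_poly \<Rightarrow> nat" where
  "x_deg p = Max (insert 0 (x_exp_deg ` Poly_Mapping.keys p))"

definition xy_deg :: "('n::finite, 'm::finite) xy_poly \<Rightarrow> nat" where
  "xy_deg h = Max (insert 0 (xy_exp_deg ` Poly_Mapping.keys h))"

definition x_eval :: "('n::finite) x_poly \<Rightarrow> real ^ 'n \<Rightarrow> real" where
  "x_eval p x = (\<Sum>\<alpha>\<in>Poly_Mapping.keys p. Poly_Mapping.lookup p \<alpha> * (\<Prod>i\<in>UNIV. x $ i ^ (\<alpha> $ i)))"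

definition xy_eval ::
    "('n::finite, 'm::finite) xy_poly \<Rightarrow> real ^ 'n \<Rightarrow> real ^ 'm \<Rightarrow> real" where
  "xy_eval h x y = (\<Sum>a\<in>Poly_Mapping.keys h. Poly_Mapping.lookup h a *
     ((\<Prod>i\<in>UNIV. x $ i ^ (fst a $ i)) * (\<Prod>j\<in>UNIV. y $ j ^ (snd a $ j))))"

definition xy_monom :: "('n::finite, 'm::finite) xy_exp \<Rightarrow> ('n, 'm) xy_poly" where
  "xy_monom a = Poly_Mapping.single a 1"

definition x_to_xy :: "('n::finite) x_poly \<Rightarrow> ('n, 'm::finite) xy_poly" where
  "x_to_xy p = (\<Sum>\<alpha>\<in>Poly_Mapping.keys p. Poly_Mapping.single (\<alpha>, 0) (Poly_Mapping.lookup p \<alpha>))"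

definition var_x :: "'n::finite \<Rightarrow> ('n, 'm::finite) xy_poly" where
  "var_x i = xy_monom (axis i 1, 0)"

definition var_y :: "'m::finite \<Rightarrow> ('n::finite, 'm) xy_poly" where
  "var_y j = xy_monom (0, axis j 1)"

definition sos :: "nat \<Rightarrow> ('n::finite, 'm::finite) xy_poly set" where
  "sos d = {q. xy_deg q \<le> 2 * d \<and> (\<exists>qs. q = (\<Sum>r\<leftarrow>qs. r\<^sup>2))}"


subsection \<open>The parametric problem\<close>

definition box_B :: "(real ^ 'n) set" where
  "box_B = {x. \<forall>i. -1 \<le> x $ i \<and> x $ i \<le> 1}"

definition lam :: "(real ^ 'n) measure" where
  "lam = uniform_measure lborel box_B"

definition gam :: "nat ^ 'n \<Rightarrow> real" where
  "gam \<alpha> = (LINT x|lam. (\<Prod>i\<in>UNIV. x $ i ^ (\<alpha> $ i)))"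

definition theta :: "'n::finite \<Rightarrow> ('n, 'm::finite) xy_poly" where
  "theta i = 1 - (var_x i)\<^sup>2"

definition ball_poly :: "('n::finite, 'm::finite) xy_poly" where
  "ball_poly = 1 - (\<Sum>j\<in>UNIV. (var_y j)\<^sup>2)"

lemma xy_eval_superset:
  assumes "finite A" "Poly_Mapping.keys h \<subseteq> A"
  shows "xy_eval h x y = (\<Sum>a\<in>A. Poly_Mapping.lookup h a *
     ((\<Prod>i\<in>UNIV. x $ i ^ (fst a $ i)) * (\<Prod>j\<in>UNIV. y $ j ^ (snd a $ j))))"
  unfolding xy_eval_def
  by (rule sum.mono_neutral_left) (use assms in \<open>auto simp: in_keys_iff\<close>)

lemma xy_eval_diff: "xy_eval (h - h') x y = xy_eval h x y - xy_eval h' x y"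
proof -
  let ?A = "Poly_Mapping.keys h \<union> Poly_Mapping.keys h'"
  have "Poly_Mapping.keys (h - h') \<subseteq> ?A"
    by (auto simp: in_keys_iff lookup_minus)
  then show ?thesis
    by (subst (1 2 3) xy_eval_superset[where A = ?A])
       (auto simp: lookup_minus left_diff_distrib sum_subtractf)
qed

lemma xy_eval_add: "xy_eval (h + h') x y = xy_eval h x y + xy_eval h' x y"
proof -
  let ?A = "Poly_Mapping.keys h \<union> Poly_Mapping.keys h'"
  have "Poly_Mapping.keys (h + h') \<subseteq> ?A"
    by (rule Poly_Mapping.keys_add)
  then show ?thesis
    by (subst (1 2 3) xy_eval_superset[where A = ?A])
       (auto simp: lookup_add distrib_right sum.distrib)
qed

lemma xy_eval_sum: "xy_eval (\<Sum>i\<in>I. h i) x y = (\<Sum>i\<in>I. xy_eval (h i) x y)"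
proof (induction I rule: infinite_finite_induct)
  case (insert i I)
  then show ?case by (simp add: xy_eval_add)
qed (auto simp: xy_eval_def)

lemma xy_eval_monom:
  "xy_eval (xy_monom a) x y =
     (\<Prod>i\<in>UNIV. x $ i ^ (fst a $ i)) * (\<Prod>j\<in>UNIV. y $ j ^ (snd a $ j))"
  by (simp add: xy_eval_def xy_monom_def)

lemma xy_eval_one: "xy_eval 1 x y = 1"
  by (simp add: xy_eval_def)

lemma xy_monom_power2: "(xy_monom a)\<^sup>2 = xy_monom (a + a)"
  by (simp add: xy_monom_def power2_eq_square mult_single)

lemma prod_axis_power:
  fixes x :: "real ^ 'n"
  shows "(\<Prod>i'\<in>UNIV. x $ i' ^ ((axis i 1 + axis i 1 :: nat ^ 'n) $ i')) = (x $ i)\<^sup>2"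
proof -
  have "(\<Prod>i'\<in>UNIV. x $ i' ^ ((axis i 1 + axis i 1 :: nat ^ 'n) $ i')) =
        (\<Prod>i'\<in>UNIV. if i' = i then (x $ i)\<^sup>2 else 1)"
    by (intro prod.cong) (auto simp: axis_def power2_eq_square)
  then show ?thesis by simp
qed

lemma xy_eval_theta: "xy_eval (theta i) x y = 1 - (x $ i)\<^sup>2"
  unfolding theta_def var_x_def
  by (simp add: xy_eval_diff xy_eval_one xy_monom_power2 xy_eval_monom prod_axis_power
        del: One_nat_def vector_add_component)

lemma xy_eval_ball_poly: "xy_eval ball_poly x y = 1 - (norm y)\<^sup>2"
  unfolding ball_poly_def var_y_def
  by (simp add: xy_eval_diff xy_eval_sum xy_eval_one xy_monom_power2 xy_eval_monom prod_axis_power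
        norm_vec_def L2_set_def sum_nonneg
        del: One_nat_def vector_add_component)

text \<open>
  Only the members \<open>g 1, \<dots>, g s\<close> of the given family matter; it is completed by the constant 1
  at index 0 and by the ball constraint at index \<open>s + 1\<close>.
\<close>

definition gfam ::
    "nat \<Rightarrow> (nat \<Rightarrow> ('n::finite, 'm::finite) xy_poly) \<Rightarrow> nat \<Rightarrow> ('n, 'm) xy_poly" where
  "gfam s g j = (if j = 0 then 1 else if j = s + 1 then ball_poly else g j)"

definition half_deg :: "('n::finite, 'm::finite) xy_poly \<Rightarrow> nat" where
  "half_deg h = nat \<lceil>real (xy_deg h) / 2\<rceil>"

definition setK ::
    "nat \<Rightarrow> (nat \<Rightarrow> ('n::finite, 'm::finite) xy_poly) \<Rightarrow> ((real ^ 'n) \<times> (real ^ 'm)) set" where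
  "setK s g = {(x, y). (\<forall>j\<in>{1..s + 1}. xy_eval (gfam s g j) x y \<ge> 0) \<and>
                       (\<forall>i. xy_eval (theta i) x y \<ge> 0)}"

definition fiberK ::
    "nat \<Rightarrow> (nat \<Rightarrow> ('n::finite, 'm::finite) xy_poly) \<Rightarrow> real ^ 'n \<Rightarrow> (real ^ 'm) set" where
  "fiberK s g x = {y. (x, y) \<in> setK s g}"

text \<open>
  The maximum of f over the fibre: on \<open>box_B\<close> it is attained whenever the fibre is nonempty,
  since the fibre is compact. Where there is no maximum the value is unspecified.
\<close>

definition Jbar ::
    "nat \<Rightarrow> (nat \<Rightarrow> ('n::finite, 'm::finite) xy_poly) \<Rightarrow> ('n, 'm) xy_poly \<Rightarrow> real ^ 'n \<Rightarrow> real" where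
  "Jbar s g f x = (GREATEST v. v \<in> (\<lambda>y. xy_eval f x y) ` fiberK s g x)"


subsection \<open>Riesz functional and localizing matrices\<close>

definition exps :: "nat \<Rightarrow> ('n::finite, 'm::finite) xy_exp set" where
  "exps d = {a. xy_exp_deg a \<le> d}"

definition riesz ::
    "(('n::finite, 'm::finite) xy_exp \<Rightarrow> real) \<Rightarrow> ('n, 'm) xy_poly \<Rightarrow> real" where
  "riesz z h = (\<Sum>a\<in>Poly_Mapping.keys h. Poly_Mapping.lookup h a * z a)"

definition loc_matrix ::
    "('n::finite, 'm::finite) xy_poly \<Rightarrow> (('n, 'm) xy_exp \<Rightarrow> real) \<Rightarrow>
     ('n, 'm) xy_exp \<Rightarrow> ('n, 'm) xy_exp \<Rightarrow> real" where
  "loc_matrix g z a b = riesz z (g * xy_monom (a + b))"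

definition psd_on :: "'i set \<Rightarrow> ('i \<Rightarrow> 'i \<Rightarrow> real) \<Rightarrow> bool" where
  "psd_on I A \<longleftrightarrow> (\<forall>a\<in>I. \<forall>b\<in>I. A a b = A b a) \<and>
                 (\<forall>u. (\<Sum>a\<in>I. \<Sum>b\<in>I. u a * A a b * u b) \<ge> 0)"


subsection \<open>The primal and dual semidefinite programs\<close>

definition admissible ::
    "nat \<Rightarrow> (nat \<Rightarrow> ('n::finite, 'm::finite) xy_poly) \<Rightarrow> ('n, 'm) xy_poly \<Rightarrow> nat \<Rightarrow> bool" where
  "admissible s g f k \<longleftrightarrow> (\<forall>j\<in>{0..s + 1}. half_deg (gfam s g j) \<le> k) \<and> xy_deg f \<le> 2 * k"

definition primal_feasible ::
    "nat \<Rightarrow> (nat \<Rightarrow> ('n::finite, 'm::finite) xy_poly) \<Rightarrow> ('n, 'm) xy_poly \<Rightarrow> nat \<Rightarrow>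
     'n x_poly \<Rightarrow> (nat \<Rightarrow> ('n, 'm) xy_poly) \<Rightarrow> ('n \<Rightarrow> ('n, 'm) xy_poly) \<Rightarrow> bool" where
  "primal_feasible s g f k p \<sigma> \<psi> \<longleftrightarrow>
     x_to_xy p - f = (\<Sum>j=0..s + 1. \<sigma> j * gfam s g j) + (\<Sum>i\<in>UNIV. \<psi> i * theta i) \<and>
     x_deg p \<le> 2 * k \<and>
     (\<forall>j\<in>{0..s + 1}. \<sigma> j \<in> sos (k - half_deg (gfam s g j))) \<and>
     (\<forall>i. \<psi> i \<in> sos (k - 1))"

definition primal_cost :: "('n::finite) x_poly \<Rightarrow> real" where
  "primal_cost p = (LINT x|lam. x_eval p x)"

definition primal_value ::
    "nat \<Rightarrow> (nat \<Rightarrow> ('n::finite, 'm::finite) xy_poly) \<Rightarrow> ('n, 'm) xy_poly \<Rightarrow> nat \<Rightarrow> ereal" where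
  "primal_value s g f k = Inf {ereal (primal_cost p) | p \<sigma> \<psi>. primal_feasible s g f k p \<sigma> \<psi>}"

definition primal_optimal ::
    "nat \<Rightarrow> (nat \<Rightarrow> ('n::finite, 'm::finite) xy_poly) \<Rightarrow> ('n, 'm) xy_poly \<Rightarrow> nat \<Rightarrow>
     'n x_poly \<Rightarrow> (nat \<Rightarrow> ('n, 'm) xy_poly) \<Rightarrow> ('n \<Rightarrow> ('n, 'm) xy_poly) \<Rightarrow> bool" where
  "primal_optimal s g f k p \<sigma> \<psi> \<longleftrightarrow>
     primal_feasible s g f k p \<sigma> \<psi> \<and> ereal (primal_cost p) = primal_value s g f k"

text \<open>
  The unknown is a family indexed by exponents of degree at most \<open>2 * k\<close>, represented as an
  extensional function.
\<close>

definition dual_feasible ::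
    "nat \<Rightarrow> (nat \<Rightarrow> ('n::finite, 'm::finite) xy_poly) \<Rightarrow> nat \<Rightarrow>
     (('n, 'm) xy_exp \<Rightarrow> real) \<Rightarrow> bool" where
  "dual_feasible s g k z \<longleftrightarrow>
     z \<in> exps (2 * k) \<rightarrow>\<^sub>E UNIV \<and>
     (\<forall>j\<in>{0..s + 1}. psd_on (exps (k - half_deg (gfam s g j))) (loc_matrix (gfam s g j) z)) \<and>
     (\<forall>i. psd_on (exps (k - 1)) (loc_matrix (theta i) z)) \<and>
     (\<forall>\<alpha>. x_exp_deg \<alpha> \<le> 2 * k \<longrightarrow> riesz z (xy_monom (\<alpha>, 0)) = gam \<alpha>)"

definition dual_value ::
    "nat \<Rightarrow> (nat \<Rightarrow> ('n::finite, 'm::finite) xy_poly) \<Rightarrow> ('n, 'm) xy_poly \<Rightarrow> nat \<Rightarrow> ereal" where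
  "dual_value s g f k = Sup {ereal (riesz z f) | z. dual_feasible s g k z}"

definition dual_optimal ::
    "nat \<Rightarrow> (nat \<Rightarrow> ('n::finite, 'm::finite) xy_poly) \<Rightarrow> ('n, 'm) xy_poly \<Rightarrow> nat \<Rightarrow>
     (('n, 'm) xy_exp \<Rightarrow> real) \<Rightarrow> bool" where
  "dual_optimal s g f k z \<longleftrightarrow>
     dual_feasible s g k z \<and> ereal (riesz z f) = dual_value s g f k"

end

theory Submission
  imports Defs "HOL-Computational_Algebra.Polynomial"
begin

text \<open>
  Duality without topology: the value of the primal program, as a function of \<open>f\<close>, is sublinear
  because 1 is an order unit of the truncated quadratic module, and a Hahn--Banach functional
  dominated by it and exact at \<open>f\<close> is an optimal dual solution.

  Putinar's Positivstellensatz comes from the same extension theorem: tilting a sublinear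
  functional successively along a countable basis gives an extreme positive functional, and an
  extreme positive functional is multiplicative, hence evaluation at a point of \<open>\<^bold>K\<close>.

  A primal optimum is the limit of a rescaled minimizing sequence; the nonempty interior of
  \<open>\<^bold>K\<close> excludes recession directions.

  For the limit, the upper semicontinuous value function is the decreasing limit of Lipschitz
  majorants. A polynomial slightly above such a majorant is feasible from some relaxation order
  on by Putinar, so the optimal values converge to the mean of the value function; since
  feasible polynomials lie above it, this is convergence in \<open>L\<^sup>1\<close>.
\<close>

section \<open>Positive extension of linear functionals\<close>

text \<open>Neither duality nor the Positivstellensatz uses that a cone is closed. If
  \<open>h\<close> is outside \<open>QMU s g\<close>, the extension \<open>L\<close> is exact at
  \<open>- h\<close>; were \<open>L h\<close> positive, the infimum giving \<open>L (- h)\<close>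
  would supply a constant \<open>c < 0\<close> with \<open>c + h\<close> in the cone, and adding the
  positive constant \<open>- c\<close> would put \<open>h\<close> itself there.

  A quadratic module need not be closed under products, so \<open>(1 - X^2) * m\<close> may lie
  outside it for a member \<open>m\<close>. Multiplicativity of an extreme functional needs only its
  sign there, and that sign follows from the boundedness of its values on monomials.

  The bounds on monomials hold within order \<open>k\<close> for all degrees up to
  \<open>2 * k\<close>; this is why duality is exact at every admissible \<open>k\<close>. Nonempty
  fibres make \<open>mean\<close> nonnegative on the members of the module that depend on x alone,
  which keeps the primal value finite.

  A limit of representations needs a fixed number of squares of fixed degree: leading forms bound
  the degrees, and the Gram matrix bounds the number.\<close>

instantiation poly_mapping :: (type, real_vector) real_vector
begin

lift_definition scaleR_poly_mapping :: "real \<Rightarrow> ('a \<Rightarrow>\<^sub>0 'b) \<Rightarrow> 'a \<Rightarrow>\<^sub>0 'b"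
  is "\<lambda>c f a. c *\<^sub>R f a"
  by (rule finite_subset) (auto)

instance
  by standard (transfer; simp add: fun_eq_iff scaleR_add_left scaleR_add_right)+

end

lemma lookup_scaleR [simp]: "Poly_Mapping.lookup (c *\<^sub>R p) a = c *\<^sub>R Poly_Mapping.lookup p a"
  by transfer simp

section \<open>Sublinear functionals and tilting\<close>

definition sublinear :: "('a::real_vector \<Rightarrow> real) \<Rightarrow> bool" where
  "sublinear P \<longleftrightarrow> (\<forall>x y. P (x + y) \<le> P x + P y) \<and> (\<forall>c x. 0 \<le> c \<longrightarrow> P (c *\<^sub>R x) = c * P x)"

lemma sublinear_add: "sublinear P \<Longrightarrow> P (x + y) \<le> P x + P y"
  and sublinear_scale: "sublinear P \<Longrightarrow> 0 \<le> c \<Longrightarrow> P (c *\<^sub>R x) = c * P x"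
  by (auto simp: sublinear_def)

lemma sublinear_zero: "sublinear P \<Longrightarrow> P 0 = 0"
  using sublinear_scale[of P 0 0] by simp

lemma sublinear_neg: "sublinear P \<Longrightarrow> - P (- x) \<le> P x"
  using sublinear_add[of P x "- x"] sublinear_zero[of P] by simp

text \<open>The scaling inequality for \<open>1 / c\<close> is the reverse of the one for
  \<open>c\<close>.\<close>

lemma sublinearI:
  assumes add: "\<And>x y. P (x + y) \<le> P x + P y" and zero: "P 0 = 0"
    and scale: "\<And>c x. 0 < c \<Longrightarrow> P (c *\<^sub>R x) \<le> c * P x"
  shows "sublinear P"
proof -
  have "P (c *\<^sub>R x) = c * P x" if c: "0 < c" for c x
  proof (rule antisym)
    have "P ((1/c) *\<^sub>R (c *\<^sub>R x)) \<le> (1/c) * P (c *\<^sub>R x)" by (rule scale) (use c in simp)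
    then show "c * P x \<le> P (c *\<^sub>R x)" using c by (simp add: field_simps)
  qed (rule scale[OF c])
  then show ?thesis unfolding sublinear_def using add zero
    by (metis less_eq_real_def mult_zero_left scale_zero_left)
qed

text \<open>The largest sublinear minorant of \<open>P\<close> that is odd at \<open>v\<close> with the value \<open>P v\<close>.\<close>

definition tilt :: "('a::real_vector \<Rightarrow> real) \<Rightarrow> 'a \<Rightarrow> 'a \<Rightarrow> real" where
  "tilt P v h = (INF t\<in>{0..}. P (h + t *\<^sub>R v) - t * P v)"

text \<open>\<open>INF\<close> over the reals is an infimum only for sets bounded below.
  Subadditivity of \<open>P\<close> on \<open>t v = (h + t v) - h\<close> gives the bound
  \<open>- P (- h)\<close>, uniform in \<open>t\<close>.\<close>

lemma tilt_bdd:
  assumes "sublinear P"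
  shows "bdd_below ((\<lambda>t. P (h + t *\<^sub>R v) - t * P v) ` {0..})"
proof (rule bdd_belowI[of _ "- P (- h)"])
  fix r assume "r \<in> (\<lambda>t. P (h + t *\<^sub>R v) - t * P v) ` {0..}"
  then obtain t where t: "t \<ge> 0" "r = P (h + t *\<^sub>R v) - t * P v" by auto
  show "- P (- h) \<le> r"
    using sublinear_add[OF assms, of "h + t *\<^sub>R v" "- h"] sublinear_scale[OF assms, of t v] t by simp
qed

lemma tilt_lower: "sublinear P \<Longrightarrow> 0 \<le> t \<Longrightarrow> tilt P v h \<le> P (h + t *\<^sub>R v) - t * P v"
  unfolding tilt_def by (intro cINF_lower tilt_bdd) auto

lemma tilt_greatest: "(\<And>t. 0 \<le> t \<Longrightarrow> r \<le> P (h + t *\<^sub>R v) - t * P v) \<Longrightarrow> r \<le> tilt P v h"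
  unfolding tilt_def by (intro cINF_greatest) auto

lemma tilt_le: "sublinear P \<Longrightarrow> tilt P v h \<le> P h"
  using tilt_lower[of P 0 v h] by simp

lemma sublinear_tilt:
  assumes P: "sublinear P"
  shows "sublinear (tilt P v)"
proof (rule sublinearI)
  fix x y
  \<comment> \<open>The parameters of the two infima add up; freeing \<open>s\<close> and then
    \<open>t\<close> removes the infima one at a time.\<close>
  have "tilt P v (x + y) - (P (y + t *\<^sub>R v) - t * P v) \<le> P (x + s *\<^sub>R v) - s * P v"
    if "0 \<le> s" "0 \<le> t" for s t
    using tilt_lower[OF P, of "s + t" v "x + y"] that
      sublinear_add[OF P, of "x + s *\<^sub>R v" "y + t *\<^sub>R v"] by (simp add: algebra_simps)
  then have "tilt P v (x + y) - (P (y + t *\<^sub>R v) - t * P v) \<le> tilt P v x" if "0 \<le> t" for t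
    using that by (intro tilt_greatest) auto
  then have "tilt P v (x + y) - tilt P v x \<le> tilt P v y"
    by (intro tilt_greatest) (auto simp: algebra_simps)
  then show "tilt P v (x + y) \<le> tilt P v x + tilt P v y" by simp
next
  show "tilt P v 0 = 0"
  proof (rule antisym)
    show "tilt P v 0 \<le> 0" using tilt_le[OF P, of v 0] sublinear_zero[OF P] by simp
    show "0 \<le> tilt P v 0" by (rule tilt_greatest) (simp add: sublinear_scale[OF P])
  qed
next
  fix c :: real and x assume c: "0 < c"
  have "tilt P v (c *\<^sub>R x) / c \<le> tilt P v x"
  proof (rule tilt_greatest)
    fix t :: real assume t: "0 \<le> t"
    have "tilt P v (c *\<^sub>R x) \<le> P (c *\<^sub>R (x + t *\<^sub>R v)) - (c * t) * P v"
      using tilt_lower[OF P, of "c * t" v "c *\<^sub>R x"] c t by (simp add: scaleR_add_right)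
    also have "\<dots> = c * (P (x + t *\<^sub>R v) - t * P v)"
      using sublinear_scale[OF P, of c] c by (simp add: right_diff_distrib)
    finally show "tilt P v (c *\<^sub>R x) / c \<le> P (x + t *\<^sub>R v) - t * P v"
      using c by (simp add: field_simps)
  qed
  then show "tilt P v (c *\<^sub>R x) \<le> c * tilt P v x" using c by (simp add: field_simps)
qed

text \<open>The parameter \<open>t = 1\<close> reaches \<open>P 0 = 0\<close>. Together with
  \<open>tilt_le\<close> at \<open>v\<close> this forces oddness at \<open>v\<close>.\<close>

lemma tilt_uminus: "sublinear P \<Longrightarrow> tilt P v (- v) \<le> - P v"
  using tilt_lower[of P 1 v "- v"] by (simp add: sublinear_zero)

primrec tilts :: "('a::real_vector \<Rightarrow> real) \<Rightarrow> (nat \<Rightarrow> 'a) \<Rightarrow> nat \<Rightarrow> 'a \<Rightarrow> real" where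
  "tilts P v 0 = P"
| "tilts P v (Suc i) = tilt (tilts P v i) (v i)"

lemma sublinear_tilts: "sublinear P \<Longrightarrow> sublinear (tilts P v i)"
  by (induction i) (auto intro: sublinear_tilt)

lemma tilts_antimono:
  assumes "sublinear P" "i \<le> j"
  shows "tilts P v j h \<le> tilts P v i h"
  using assms(2) by (induction rule: dec_induct) (auto intro: order_trans[OF tilt_le] sublinear_tilts assms(1))

text \<open>A dominated functional that attains \<open>P v\<close> survives the tilt; extremality
  propagates along the sequence of tilts in this way.\<close>

lemma linear_le_tilt:
  assumes "linear N" "\<And>h. N h \<le> P h" "N v = P v"
  shows "N h \<le> tilt P v h"
proof (rule tilt_greatest)
  fix t :: real
  show "N h \<le> P (h + t *\<^sub>R v) - t * P v"
    using assms(2)[of "h + t *\<^sub>R v"] assms(3) by (simp add: linear_add[OF assms(1)] linear_scale[OF assms(1)])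
qed

text \<open>
  Tilting successively along a spanning sequence yields the functional dominated by \<open>P\<close> whose
  sequence of values there is lexicographically maximal; such a functional is an extreme point.
\<close>

lemma hahn_banach_extreme:
  fixes P :: "'a::real_vector \<Rightarrow> real" and v :: "nat \<Rightarrow> 'a"
  assumes P: "sublinear P" and v: "span (range v) = UNIV"
  obtains L where "linear L" "\<And>h. L h \<le> P h" "L (v 0) = P (v 0)"
    "\<And>N N' t h. \<lbrakk>linear N; linear N'; \<And>h. N h \<le> P h; \<And>h. N' h \<le> P h; 0 < t; t < 1;
        \<And>h. L h = t * N h + (1 - t) * N' h\<rbrakk> \<Longrightarrow> N h = L h"
proof -
  define Q where "Q = tilts P v"
  define L where "L h = (INF i. Q i h)" for h
  have sQ: "sublinear (Q i)" for i unfolding Q_def by (rule sublinear_tilts[OF P])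
  have Q_mono: "i \<le> j \<Longrightarrow> Q j h \<le> Q i h" for i j h
    unfolding Q_def by (rule tilts_antimono[OF P])
  have Q0: "Q 0 = P" by (simp add: Q_def)
  have "- P (- h) \<le> Q i h" for i h
    using sublinear_neg[OF sQ, of i h] Q_mono[of 0 i "- h"] by (simp add: Q0)
  then have bdd: "bdd_below (range (\<lambda>i. Q i h))" for h by (intro bdd_belowI[of _ "- P (- h)"]) auto
  have L_le: "L h \<le> Q i h" for h i unfolding L_def by (rule cINF_lower[OF bdd]) simp
  have L_ge: "(\<And>i. r \<le> Q i h) \<Longrightarrow> r \<le> L h" for r h unfolding L_def by (rule cINF_greatest) auto
  have sL: "sublinear L"
  proof (rule sublinearI)
    fix x y
    \<comment> \<open>The tilts decrease, so both arguments can be compared at the common index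
      \<open>max i j\<close>.\<close>
    have "L (x + y) - Q j y \<le> Q i x" for i j
      using L_le[of "x + y" "max i j"] sublinear_add[OF sQ, of "max i j" x y]
        Q_mono[of i "max i j" x] Q_mono[of j "max i j" y] by simp
    then have "L (x + y) - Q j y \<le> L x" for j by (rule L_ge)
    then have "L (x + y) - L x \<le> L y" by (intro L_ge) (simp add: algebra_simps)
    then show "L (x + y) \<le> L x + L y" by simp
  next
    show "L 0 = 0" by (simp add: L_def sublinear_zero[OF sQ])
  next
    fix c :: real and x assume c: "0 < c"
    have "L (c *\<^sub>R x) / c \<le> L x"
    proof (rule L_ge)
      show "L (c *\<^sub>R x) / c \<le> Q i x" for i
        using L_le[of "c *\<^sub>R x" i] sublinear_scale[OF sQ, of c i x] c by (simp add: field_simps)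
    qed
    then show "L (c *\<^sub>R x) \<le> c * L x" using c by (simp add: field_simps)
  qed
  \<comment> \<open>Passing from \<open>Q i\<close> to \<open>Q (Suc i)\<close> tilts at
    \<open>v i\<close>, which settles the value at \<open>- v i\<close>.\<close>
  have Lv_neg: "L (- v i) \<le> - Q i (v i)" for i
    using L_le[of "- v i" "Suc i"] tilt_uminus[OF sQ, of i "v i"] by (simp add: Q_def)
  \<comment> \<open>Only the bound from above needs the spanning sequence; the other one holds for
    every sublinear functional.\<close>
  have odd: "L (- x) = - L x" for x
  proof -
    have "x \<in> span (range v)" using v by simp
    then have "L x + L (- x) \<le> 0"
    proof (induction rule: span_induct_alt)
      case base
      then show ?case using sublinear_zero[OF sL] by simp
    next
      case (step c x y)
      then obtain i where x: "x = v i" by auto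
      have vi: "L (v i) + L (- v i) \<le> 0"
        using Lv_neg[of i] L_le[of "v i" i] by simp
      have "L (c *\<^sub>R v i) + L (- (c *\<^sub>R v i)) \<le> 0"
      proof (cases "c \<ge> 0")
        case True
        then show ?thesis using sublinear_scale[OF sL, of c] vi
          by (metis distrib_left mult_nonneg_nonpos scaleR_minus_right)
      next
        case False
        then have "L (c *\<^sub>R v i) + L (- (c *\<^sub>R v i)) = (- c) * (L (v i) + L (- v i))"
          using sublinear_scale[OF sL, of "- c" "v i"] sublinear_scale[OF sL, of "- c" "- v i"]
          by (simp add: algebra_simps)
        also have "\<dots> \<le> 0" using False vi by (intro mult_nonneg_nonpos) auto
        finally show ?thesis .
      qed
      then show ?case unfolding x
        using sublinear_add[OF sL, of "c *\<^sub>R v i" y] sublinear_add[OF sL, of "- (c *\<^sub>R v i)" "- y"] step(2)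
        by simp
    qed
    then show ?thesis using sublinear_neg[OF sL, of x] by simp
  qed
  have lin: "linear L"
  proof (rule linearI)
    show "L (x + y) = L x + L y" for x y
      using sublinear_add[OF sL, of x y] sublinear_add[OF sL, of "- x" "- y"] odd[of x] odd[of y] odd[of "x + y"]
      by simp
    show "L (c *\<^sub>R x) = c *\<^sub>R L x" for c x
      using sublinear_scale[OF sL, of c x] sublinear_scale[OF sL, of "- c" x] odd[of "c *\<^sub>R x"]
      by (cases "c \<ge> 0") auto
  qed
  have Lv: "L (v i) = Q i (v i)" for i
    using Lv_neg[of i] L_le[of "v i" i] odd[of "v i"] by simp
  show thesis
  proof (rule that[OF lin])
    show "L h \<le> P h" for h using L_le[of h 0] by (simp add: Q0)
    show "L (v 0) = P (v 0)" using Lv[of 0] by (simp add: Q0)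
    fix N N' t h
    assume N: "linear N" "linear N'" "\<And>h. N h \<le> P h" "\<And>h. N' h \<le> P h" and t: "0 < t" "t < (1::real)"
      and eq: "\<And>h. L h = t * N h + (1 - t) * N' h"
    \<comment> \<open>Both functionals are at most \<open>L (v i)\<close> at \<open>v i\<close>, and
      a proper convex combination of them equals it; so both attain it.\<close>
    have main: "N (v i) = L (v i) \<and> N' (v i) = L (v i)"
      if "\<And>h. N h \<le> Q i h" "\<And>h. N' h \<le> Q i h" for i
    proof -
      have "t * (L (v i) - N (v i)) + (1 - t) * (L (v i) - N' (v i)) = 0"
        using eq[of "v i"] by (simp add: algebra_simps)
      moreover have "t * (L (v i) - N (v i)) \<ge> 0" "(1 - t) * (L (v i) - N' (v i)) \<ge> 0"
        using that[of "v i"] Lv[of i] t by auto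
      ultimately show ?thesis using t by (simp add: add_nonneg_eq_0_iff)
    qed
    \<comment> \<open>Attaining \<open>Q i (v i)\<close> passes the domination on to
      \<open>Q (Suc i)\<close>.\<close>
    have le: "(\<forall>h. N h \<le> Q i h) \<and> (\<forall>h. N' h \<le> Q i h)" for i
    proof (induction i)
      case 0
      then show ?case using N by (simp add: Q0)
    next
      case (Suc i)
      then show ?case using main[of i] linear_le_tilt[OF N(1), of "Q i" "v i"]
          linear_le_tilt[OF N(2), of "Q i" "v i"] Lv[of i] by (simp add: Q_def)
    qed
    have "N x = L x" if "x \<in> range v" for x using that main le by auto
    then show "N h = L h"
      using linear_eq_on_span[OF N(1) lin, of "range v"] v by auto
  qed
qed

text \<open>The dominating functional is \<open>P h = Inf {phi p | p in S, p - h in C}\<close>, the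
  value of a linear program in \<open>h\<close>. A linear functional lies below \<open>P\<close>
  exactly if it is nonnegative on \<open>C\<close> and equals \<open>phi\<close> on
  \<open>S\<close>. The entry \<open>v 0\<close> is tilted first, so \<open>L\<close> attains the
  infimum there; the other entries serve extremality.\<close>

lemma riesz_extension:
  fixes C S :: "'a::real_vector set" and v :: "nat \<Rightarrow> 'a" and \<phi> :: "'a \<Rightarrow> real"
  assumes C_add: "\<And>a b. a \<in> C \<Longrightarrow> b \<in> C \<Longrightarrow> a + b \<in> C"
    and C_scale: "\<And>a c. a \<in> C \<Longrightarrow> 0 \<le> c \<Longrightarrow> c *\<^sub>R a \<in> C"
    and S: "subspace S" and \<phi>: "linear \<phi>"
    and pos: "\<And>p. p \<in> S \<Longrightarrow> p \<in> C \<Longrightarrow> 0 \<le> \<phi> p"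
    and cofinal: "\<And>h. \<exists>p\<in>S. p - h \<in> C"
    and v: "span (range v) = UNIV"
  obtains L where "linear L" "\<And>c. c \<in> C \<Longrightarrow> 0 \<le> L c" "\<And>p. p \<in> S \<Longrightarrow> L p = \<phi> p"
    "\<And>e. 0 < e \<Longrightarrow> \<exists>p\<in>S. p - v 0 \<in> C \<and> \<phi> p < L (v 0) + e"
    "\<forall>N N' t. linear N \<and> linear N' \<and> (\<forall>c\<in>C. 0 \<le> N c \<and> 0 \<le> N' c) \<and> (\<forall>p\<in>S. N p = \<phi> p \<and> N' p = \<phi> p) \<and>
        0 < t \<and> t < 1 \<and> (\<forall>h. L h = t * N h + (1 - t) * N' h) \<longrightarrow> N = L"
proof -
  define U where "U h = \<phi> ` {p \<in> S. p - h \<in> C}" for h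
  define P where "P h = Inf (U h)" for h
  have C0: "0 \<in> C"
  proof -
    obtain p where "p - 0 \<in> C" using cofinal by blast
    then show ?thesis using C_scale[of "p - 0" 0] by simp
  qed
  have ne: "U h \<noteq> {}" for h using cofinal unfolding U_def by blast
  have bdd: "bdd_below (U h)" for h
  proof -
    \<comment> \<open>Cofinality for \<open>- h\<close> provides \<open>q\<close> with
      \<open>q + h\<close> in \<open>C\<close>; then \<open>p + q\<close> lies in \<open>S\<close>
      and in \<open>C\<close>, so \<open>- phi q\<close> bounds all candidates from below.\<close>
    obtain q where q: "q \<in> S" "q - (- h) \<in> C" using cofinal by blast
    have "- \<phi> q \<le> \<phi> p" if p: "p \<in> S" "p - h \<in> C" for p
    proof -
      have "p + q \<in> S" using S p q by (simp add: subspace_add)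
      moreover have "p + q \<in> C" using C_add[OF p(2) q(2)] by simp
      ultimately show ?thesis using pos[of "p + q"] by (simp add: linear_add[OF \<phi>])
    qed
    then show ?thesis unfolding U_def by (intro bdd_belowI[of _ "- \<phi> q"]) auto
  qed
  have P_le: "P h \<le> \<phi> p" if "p \<in> S" "p - h \<in> C" for p h
    unfolding P_def by (rule cInf_lower[OF _ bdd]) (use that in \<open>auto simp: U_def\<close>)
  have P_ge: "r \<le> P h" if "\<And>p. p \<in> S \<Longrightarrow> p - h \<in> C \<Longrightarrow> r \<le> \<phi> p" for r h
    unfolding P_def by (rule cInf_greatest[OF ne]) (use that in \<open>auto simp: U_def\<close>)
  have sP: "sublinear P"
  proof (rule sublinearI)
    fix x y
    have "P (x + y) - \<phi> q \<le> \<phi> p" if "p \<in> S" "p - x \<in> C" "q \<in> S" "q - y \<in> C" for p q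
      using P_le[of "p + q" "x + y"] C_add[OF that(2,4)] subspace_add[OF S that(1,3)]
      by (simp add: linear_add[OF \<phi>] algebra_simps)
    then have "P (x + y) - \<phi> q \<le> P x" if "q \<in> S" "q - y \<in> C" for q
      using that by (intro P_ge) auto
    then have "P (x + y) - P x \<le> P y" by (intro P_ge) (auto simp: algebra_simps)
    then show "P (x + y) \<le> P x + P y" by simp
  next
    show "P 0 = 0"
    proof (rule antisym)
      show "P 0 \<le> 0" using P_le[of 0 0] C0 subspace_0[OF S] linear_0[OF \<phi>] by simp
      show "0 \<le> P 0" by (rule P_ge) (use pos in auto)
    qed
  next
    fix c :: real and x assume c: "0 < c"
    have "P (c *\<^sub>R x) / c \<le> P x"
    proof (rule P_ge)
      fix p assume p: "p \<in> S" "p - x \<in> C"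
      have "P (c *\<^sub>R x) \<le> \<phi> (c *\<^sub>R p)"
        using P_le[of "c *\<^sub>R p" "c *\<^sub>R x"] C_scale[OF p(2), of c] c subspace_scale[OF S p(1)]
        by (simp add: scaleR_diff_right)
      then show "P (c *\<^sub>R x) / c \<le> \<phi> p" using c by (simp add: linear_scale[OF \<phi>] field_simps)
    qed
    then show "P (c *\<^sub>R x) \<le> c * P x" using c by (simp add: field_simps)
  qed
  have dominated: "\<And>h. N h \<le> P h"
    if "linear N" "\<And>c. c \<in> C \<Longrightarrow> 0 \<le> N c" "\<And>p. p \<in> S \<Longrightarrow> N p = \<phi> p" for N
  proof (rule P_ge)
    fix h p assume "p \<in> S" "p - h \<in> C"
    then show "N h \<le> \<phi> p" using that(2)[of "p - h"] that(3)[of p] by (simp add: linear_diff[OF that(1)])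
  qed
  obtain L where L: "linear L" "\<And>h. L h \<le> P h" "L (v 0) = P (v 0)"
    and ext: "\<And>N N' t h. \<lbrakk>linear N; linear N'; \<And>h. N h \<le> P h; \<And>h. N' h \<le> P h; 0 < t; t < 1;
        \<And>h. L h = t * N h + (1 - t) * N' h\<rbrakk> \<Longrightarrow> N h = L h"
    using hahn_banach_extreme[OF sP v] by blast
  \<comment> \<open>An element of \<open>S\<close> is its own candidate because 0 is in
    \<open>C\<close>; the same for \<open>- p\<close> yields equality.\<close>
  have LS: "L p \<le> \<phi> p" if "p \<in> S" for p
    using L(2)[of p] P_le[OF that, of p] C0 by simp
  show thesis
  proof (rule that[OF L(1)])
    show "0 \<le> L c" if "c \<in> C" for c
      using L(2)[of "- c"] P_le[of 0 "- c"] that subspace_0[OF S] linear_0[OF \<phi>] linear_neg[OF L(1), of c]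
      by simp
    show "L p = \<phi> p" if "p \<in> S" for p
      using LS[OF that] LS[OF subspace_neg[OF S that]] linear_neg[OF L(1), of p] linear_neg[OF \<phi>, of p] by simp
    show "\<exists>p\<in>S. p - v 0 \<in> C \<and> \<phi> p < L (v 0) + e" if "0 < e" for e
    proof -
      have "Inf (U (v 0)) < L (v 0) + e" using L(3) that by (simp add: P_def)
      then show ?thesis using cInf_less_iff[OF ne bdd] by (auto simp: U_def)
    qed
    show "\<forall>N N' t. linear N \<and> linear N' \<and> (\<forall>c\<in>C. 0 \<le> N c \<and> 0 \<le> N' c) \<and> (\<forall>p\<in>S. N p = \<phi> p \<and> N' p = \<phi> p) \<and>
        0 < t \<and> t < 1 \<and> (\<forall>h. L h = t * N h + (1 - t) * N' h) \<longrightarrow> N = L"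
    proof (intro allI impI HOL.ext, elim conjE)
      fix N N' t h
      assume "linear N" "linear N'" "\<forall>c\<in>C. 0 \<le> N c \<and> 0 \<le> N' c" "\<forall>p\<in>S. N p = \<phi> p \<and> N' p = \<phi> p"
        "0 < t" "t < 1" "\<forall>h. L h = t * N h + (1 - t) * N' h"
      then show "N h = L h" by (intro ext[of N N' t] dominated) auto
    qed
  qed
qed

section \<open>Polynomials in two blocks of variables\<close>

lemma single_0_mult: "Poly_Mapping.single 0 c * p = Poly_Mapping.map ((*) c) p"
  for p :: "'a::monoid_add \<Rightarrow>\<^sub>0 'b::semiring_1"
proof (rule poly_mapping_eqI)
  fix k
  show "Poly_Mapping.lookup (Poly_Mapping.single 0 c * p) k = Poly_Mapping.lookup (Poly_Mapping.map ((*) c) p) k"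
    by (simp add: lookup_mult lookup_single when_mult map.rep_eq) (auto simp: when_def)
qed

instance poly_mapping :: (comm_monoid_add, "{real_algebra_1, comm_ring_1}") real_algebra_1
proof
  have scaleR_eq: "c *\<^sub>R p = Poly_Mapping.single 0 (of_real c) * p" for c and p :: "'a \<Rightarrow>\<^sub>0 'b"
    by (rule poly_mapping_eqI) (auto simp: single_0_mult map.rep_eq when_def scaleR_conv_of_real)
  fix c and p q :: "'a \<Rightarrow>\<^sub>0 'b"
  show "c *\<^sub>R p * q = c *\<^sub>R (p * q)" by (simp add: scaleR_eq mult.assoc)
  show "p * c *\<^sub>R q = c *\<^sub>R (p * q)" by (simp add: scaleR_eq mult.left_commute)
qed

abbreviation mon :: "('n::finite, 'm::finite) xy_exp \<Rightarrow> real ^ 'n \<Rightarrow> real ^ 'm \<Rightarrow> real" where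
  "mon a x y \<equiv> (\<Prod>i\<in>UNIV. x $ i ^ (fst a $ i)) * (\<Prod>j\<in>UNIV. y $ j ^ (snd a $ j))"

lemma mon_add: "mon (a + b) x y = mon a x y * mon b x y"
  by (simp add: power_add prod.distrib)

lemma poly_sum_monoms: "h = (\<Sum>a\<in>Poly_Mapping.keys h. Poly_Mapping.lookup h a *\<^sub>R xy_monom a)"
proof (rule poly_mapping_eqI)
  fix k
  have "(\<Sum>a\<in>Poly_Mapping.keys h. Poly_Mapping.lookup h a * Poly_Mapping.lookup (xy_monom a) k) =
      (\<Sum>a\<in>Poly_Mapping.keys h. if a = k then Poly_Mapping.lookup h a else 0)"
    by (intro sum.cong) (auto simp: xy_monom_def lookup_single when_def)
  then show "Poly_Mapping.lookup h k =
      Poly_Mapping.lookup (\<Sum>a\<in>Poly_Mapping.keys h. Poly_Mapping.lookup h a *\<^sub>R xy_monom a) k"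
    by (simp add: lookup_sum in_keys_iff)
qed

lemma span_monoms: "span (range xy_monom) = UNIV"
proof -
  have "h \<in> span (range xy_monom)" for h :: "('n::finite, 'm::finite) xy_poly"
    by (subst poly_sum_monoms) (intro span_sum span_scale span_base, simp)
  then show ?thesis by auto
qed

text \<open>\<open>from_nat\<close> enumerates the countably many exponents; prepending
  \<open>h\<close> shifts the position of each by one and lets \<open>h\<close> be tilted
  first.\<close>

lemma span_case_nat_monoms: "span (range (case_nat h (\<lambda>n. xy_monom (from_nat n)))) = UNIV"
proof -
  have "xy_monom a \<in> range (case_nat h (\<lambda>n. xy_monom (from_nat n)))" for a
    by (rule range_eqI[of _ _ "Suc (to_nat a)"]) simp
  then have "span (range xy_monom) \<subseteq> span (range (case_nat h (\<lambda>n. xy_monom (from_nat n))))"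
    by (intro span_mono image_subsetI)
  then show ?thesis unfolding span_monoms by (rule top.extremum_uniqueI)
qed

lemma linear_eq_monom: "linear F \<Longrightarrow> linear G \<Longrightarrow> (\<And>a. F (xy_monom a) = G (xy_monom a)) \<Longrightarrow> F h = G h"
  by (rule linear_eq_on_span[of F G "range xy_monom" h]) (auto simp: span_monoms)

lemma monom_0 [simp]: "xy_monom 0 = 1"
  by (simp add: xy_monom_def)

lemma monom_mult: "xy_monom a * xy_monom b = xy_monom (a + b)"
  by (simp add: xy_monom_def mult_single)

lemma linear_xy_eval: "linear (\<lambda>h. xy_eval h x y)"
proof (rule linearI)
  show "xy_eval (c *\<^sub>R h) x y = c *\<^sub>R xy_eval h x y" for c h
    by (subst xy_eval_superset[of "Poly_Mapping.keys h"])
       (auto simp: in_keys_iff xy_eval_def sum_distrib_left mult.assoc)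
qed (rule xy_eval_add)

lemmas xy_eval_scaleR = linear_scale[OF linear_xy_eval, simplified]

lemma xy_eval_0: "xy_eval 0 x y = 0"
  by (simp add: xy_eval_def)

lemma linear_mult_right: "linear (\<lambda>p. p * q)" and linear_mult_left: "linear (\<lambda>p. q * p)"
  for q :: "'a::real_algebra"
  by (auto intro!: linearI simp: distrib_left distrib_right)

lemma xy_eval_mult: "xy_eval (p * q) x y = xy_eval p x y * xy_eval q x y"
proof (rule linear_eq_monom[where F = "\<lambda>p. xy_eval (p * q) x y"])
  show "linear (\<lambda>p. xy_eval (p * q) x y)"
    using linear_compose[OF linear_mult_right linear_xy_eval] by (simp add: o_def)
  show "linear (\<lambda>p. xy_eval p x y * xy_eval q x y)"
    using linear_compose[OF linear_xy_eval linear_mult_right] by (simp add: o_def)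
  fix a
  show "xy_eval (xy_monom a * q) x y = xy_eval (xy_monom a) x y * xy_eval q x y"
  proof (rule linear_eq_monom[where F = "\<lambda>q. xy_eval (xy_monom a * q) x y"])
    show "linear (\<lambda>p. xy_eval (xy_monom a * p) x y)"
      using linear_compose[OF linear_mult_left linear_xy_eval] by (simp add: o_def)
    show "linear (\<lambda>p. xy_eval (xy_monom a) x y * xy_eval p x y)"
      using linear_compose[OF linear_xy_eval linear_mult_left] by (simp add: o_def)
    show "xy_eval (xy_monom a * xy_monom b) x y = xy_eval (xy_monom a) x y * xy_eval (xy_monom b) x y" for b
      by (simp add: monom_mult xy_eval_monom mon_add[simplified])
  qed
qed

lemma xy_eval_power2: "xy_eval (p\<^sup>2) x y = (xy_eval p x y)\<^sup>2"
  by (simp add: power2_eq_square xy_eval_mult)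

lemma xy_eval_sum_squares: "xy_eval (\<Sum>r\<leftarrow>qs. r\<^sup>2) x y = (\<Sum>r\<leftarrow>qs. (xy_eval r x y)\<^sup>2)"
  by (induction qs) (auto simp: xy_eval_add xy_eval_power2 xy_eval_0)

lemma continuous_on_xy_eval [continuous_intros]:
  assumes "continuous_on S F" "continuous_on S G"
  shows "continuous_on S (\<lambda>w. xy_eval h (F w) (G w))"
  unfolding xy_eval_def by (intro continuous_intros assms)

lemma linear_riesz: "linear (riesz z)"
proof -
  have sup: "riesz z h = (\<Sum>a\<in>A. Poly_Mapping.lookup h a * z a)"
    if "finite A" "Poly_Mapping.keys h \<subseteq> A" for A h
    unfolding riesz_def using that by (intro sum.mono_neutral_left) (auto simp: in_keys_iff)
  show ?thesis
  proof (rule linearI)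
    fix c and h h' :: "('a, 'b) xy_poly"
    let ?A = "Poly_Mapping.keys h \<union> Poly_Mapping.keys h'"
    show "riesz z (h + h') = riesz z h + riesz z h'"
      by (subst (1 2 3) sup[of ?A]) (use Poly_Mapping.keys_add[of h h'] in \<open>auto simp: lookup_add distrib_right sum.distrib\<close>)
    show "riesz z (c *\<^sub>R h) = c *\<^sub>R riesz z h"
      by (subst (1 2) sup[of "Poly_Mapping.keys h"])
        (auto simp: in_keys_iff sum_distrib_left mult.assoc)
  qed
qed

lemma riesz_monom [simp]: "riesz z (xy_monom a) = z a"
  by (simp add: riesz_def xy_monom_def)

text \<open>Only the values at exponents of \<open>h\<close> matter, so in bounded degree a
  truncated sequence can stand for a functional on all polynomials.\<close>

lemma riesz_eq_linear:
  assumes "linear L" "\<And>a. a \<in> Poly_Mapping.keys h \<Longrightarrow> z a = L (xy_monom a)"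
  shows "riesz z h = L h"
proof -
  have "L h = L (\<Sum>a\<in>Poly_Mapping.keys h. Poly_Mapping.lookup h a *\<^sub>R xy_monom a)"
    using poly_sum_monoms[of h] by simp
  also have "\<dots> = (\<Sum>a\<in>Poly_Mapping.keys h. Poly_Mapping.lookup h a * L (xy_monom a))"
    by (simp add: linear_sum[OF assms(1)] linear_scale[OF assms(1)])
  also have "\<dots> = riesz z h" unfolding riesz_def using assms(2) by (intro sum.cong) auto
  finally show ?thesis by simp
qed


subsection \<open>Degrees\<close>

lemma xy_exp_deg_add: "xy_exp_deg (a + b) = xy_exp_deg a + xy_exp_deg b"
  by (simp add: xy_exp_deg_def sum.distrib)

lemma xy_exp_deg_0 [simp]: "xy_exp_deg 0 = 0"
  by (simp add: xy_exp_deg_def)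

lemma xy_deg_le_iff: "xy_deg h \<le> d \<longleftrightarrow> Poly_Mapping.keys h \<subseteq> exps d"
  by (auto simp: xy_deg_def exps_def)

lemma xy_deg_keys: "a \<in> Poly_Mapping.keys h \<Longrightarrow> xy_exp_deg a \<le> xy_deg h"
  by (simp add: xy_deg_def)

lemma finite_exps: "finite (exps d :: ('n::finite, 'm::finite) xy_exp set)"
proof -
  let ?V = "\<lambda>f. (\<chi> i. f i) :: nat ^ 'n" and ?W = "\<lambda>f. (\<chi> i. f i) :: nat ^ 'm"
  have "exps d \<subseteq> (?V ` PiE UNIV (\<lambda>_. {..d})) \<times> (?W ` PiE UNIV (\<lambda>_. {..d}))"
  proof
    fix a :: "('n, 'm) xy_exp" assume "a \<in> exps d"
    then have *: "(\<Sum>i\<in>UNIV. fst a $ i) + (\<Sum>j\<in>UNIV. snd a $ j) \<le> d"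
      by (simp add: exps_def xy_exp_deg_def)
    have "fst a $ i \<le> d" for i using * member_le_sum[of i UNIV "\<lambda>i. fst a $ i"] by simp
    moreover have "snd a $ i \<le> d" for i using * member_le_sum[of i UNIV "\<lambda>i. snd a $ i"] by simp
    ultimately have "fst a \<in> ?V ` PiE UNIV (\<lambda>_. {..d})" "snd a \<in> ?W ` PiE UNIV (\<lambda>_. {..d})"
      by (auto intro!: image_eqI[where x = "\<lambda>i. fst a $ i"] image_eqI[where x = "\<lambda>i. snd a $ i"])
    then show "a \<in> (?V ` PiE UNIV (\<lambda>_. {..d})) \<times> (?W ` PiE UNIV (\<lambda>_. {..d}))"
      by (simp add: mem_Times_iff)
  qed
  then show ?thesis by (rule finite_subset) (intro finite_SigmaI finite_imageI finite_PiE; simp)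
qed

lemma xy_deg_0 [simp]: "xy_deg 0 = 0" and xy_deg_1 [simp]: "xy_deg 1 = 0"
  by (simp_all add: xy_deg_def)

lemma xy_deg_monom: "xy_deg (xy_monom a) = xy_exp_deg a"
  by (simp add: xy_deg_def xy_monom_def)

lemma xy_deg_add: "xy_deg p \<le> d \<Longrightarrow> xy_deg q \<le> d \<Longrightarrow> xy_deg (p + q) \<le> d"
  using Poly_Mapping.keys_add[of p q] by (auto simp: xy_deg_le_iff)

lemma xy_deg_diff: "xy_deg p \<le> d \<Longrightarrow> xy_deg q \<le> d \<Longrightarrow> xy_deg (p - q) \<le> d"
  using Poly_Mapping.keys_diff[of p q] by (auto simp: xy_deg_le_iff)

lemma xy_deg_scaleR: "xy_deg p \<le> d \<Longrightarrow> xy_deg (c *\<^sub>R p) \<le> d"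
  by (auto simp: xy_deg_le_iff in_keys_iff)

lemma xy_deg_sum: "(\<And>i. i \<in> I \<Longrightarrow> xy_deg (p i) \<le> d) \<Longrightarrow> xy_deg (\<Sum>i\<in>I. p i) \<le> d"
  by (induction I rule: infinite_finite_induct) (auto intro: xy_deg_add)

lemma xy_deg_mult:
  assumes "xy_deg p \<le> d" "xy_deg q \<le> e"
  shows "xy_deg (p * q) \<le> d + e"
  unfolding xy_deg_le_iff
proof
  fix c assume "c \<in> Poly_Mapping.keys (p * q)"
  then obtain a b where "c = a + b" "a \<in> Poly_Mapping.keys p" "b \<in> Poly_Mapping.keys q"
    using Poly_Mapping.keys_mult[of p q] by blast
  then show "c \<in> exps (d + e)"
    using xy_deg_keys[of a p] xy_deg_keys[of b q] assms by (simp add: exps_def xy_exp_deg_add)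
qed

lemma xy_deg_power2: "xy_deg p \<le> d \<Longrightarrow> xy_deg (p\<^sup>2) \<le> 2 * d"
  using xy_deg_mult[of p d p d] by (simp add: power2_eq_square mult_2)


subsection \<open>Vanishing polynomials\<close>

text \<open>With 2 in a coordinate where the exponents differ and 1 elsewhere, the values are
  distinct powers of 2.\<close>

lemma mon_separates:
  fixes a b :: "('n::finite, 'm::finite) xy_exp"
  assumes "a \<noteq> b"
  obtains x y where "mon a x y \<noteq> mon b x y"
proof -
  have delta: "(\<Prod>i'\<in>UNIV. (\<chi> i'. if i' = i then 2 :: real else 1) $ i' ^ (c $ i')) = 2 ^ (c $ i)"
    for i :: "'k::finite" and c
  proof -
    have "(\<Prod>i'\<in>UNIV. (\<chi> i'. if i' = i then 2 :: real else 1) $ i' ^ (c $ i')) =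
      (\<Prod>i'\<in>UNIV. if i' = i then 2 ^ (c $ i) else 1)" by (intro prod.cong) auto
    then show ?thesis by simp
  qed
  consider i where "fst a $ i \<noteq> fst b $ i" | j where "snd a $ j \<noteq> snd b $ j"
    using assms by (auto simp: prod_eq_iff vec_eq_iff)
  then show thesis
  proof cases
    case (1 i)
    then show thesis
      by (intro that[of "\<chi> i'. if i' = i then 2 else 1" "\<chi> j. 1"]) (unfold delta, simp)
  next
    case (2 j)
    then show thesis
      by (intro that[of "\<chi> i. 1" "\<chi> j'. if j' = j then 2 else 1"]) (unfold delta, simp)
  qed
qed

text \<open>Dedekind's independence of characters.\<close>

lemma mon_independent:
  fixes A :: "('n::finite, 'm::finite) xy_exp set"
  assumes "finite A" "\<And>x y. (\<Sum>a\<in>A. c a * mon a x y) = 0" "a \<in> A"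
  shows "c a = 0"
  using assms
proof (induction A arbitrary: c a)
  case empty
  then show ?case by simp
next
  case (insert b A)
  have *: "c e = 0" if e: "e \<in> A" for e
  proof -
    \<comment> \<open>Scaling the point by \<open>(u, v)\<close> multiplies each monomial by its own
      value there. Subtracting \<open>mon b u v\<close> times the original relation removes
      \<open>b\<close>.\<close>
    obtain u v where uv: "mon e u v \<noteq> mon b u v"
      using mon_separates[of e b] e insert.hyps by metis
    have "(\<Sum>a\<in>A. (c a * (mon a u v - mon b u v)) * mon a x y) = 0" for x y
    proof -
      have m: "mon a (\<chi> i. u $ i * x $ i) (\<chi> j. v $ j * y $ j) = mon a u v * mon a x y" for a
        by (simp add: power_mult_distrib prod.distrib)
      have "(\<Sum>a\<in>A. (c a * (mon a u v - mon b u v)) * mon a x y) =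
        (\<Sum>a\<in>insert b A. (c a * (mon a u v - mon b u v)) * mon a x y)"
        using insert.hyps by simp
      also have "\<dots> = (\<Sum>a\<in>insert b A. c a * (mon a u v * mon a x y)) -
          mon b u v * (\<Sum>a\<in>insert b A. c a * mon a x y)"
        by (simp only: sum_distrib_left sum_subtractf[symmetric]) (intro sum.cong refl, simp add: algebra_simps)
      also have "\<dots> = 0"
        using insert.prems(1)[of x y]
          insert.prems(1)[of "\<chi> i. u $ i * x $ i" "\<chi> j. v $ j * y $ j", unfolded m] by simp
      finally show ?thesis .
    qed
    from insert.IH[OF this e] uv show ?thesis by simp
  qed
  \<comment> \<open>All monomials equal 1 at the point of ones, so the relation leaves only
    \<open>c b\<close>.\<close>
  moreover have "c b = 0"
    using insert.prems(1)[of "\<chi> i. 1" "\<chi> j. 1"] insert.hyps * by simp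
  ultimately show ?case using insert.prems(2) by (cases "a = b") auto
qed

lemma xy_poly_eqI:
  assumes "\<And>x y. xy_eval p x y = xy_eval q x y"
  shows "p = q"
proof -
  have "xy_eval (p - q) x y = 0" for x y using assms by (simp add: xy_eval_diff)
  then have "Poly_Mapping.lookup (p - q) a = 0" if "a \<in> Poly_Mapping.keys (p - q)" for a
    using mon_independent[OF _ _ that, of "Poly_Mapping.lookup (p - q)"] by (simp add: xy_eval_def)
  then have "p - q = 0" by (intro poly_mapping_eqI) (metis in_keys_iff lookup_zero)
  then show ?thesis by simp
qed

section \<open>Restriction of polynomials to lines and rays\<close>

lemma xy_eval_line:
  "\<exists>p :: real poly. \<forall>t. poly p t = xy_eval h (x + t *\<^sub>R u) (y + t *\<^sub>R v)"
  by (rule exI[of _ "\<Sum>a\<in>Poly_Mapping.keys h. smult (Poly_Mapping.lookup h a)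
      ((\<Prod>i\<in>UNIV. [:x $ i, u $ i:] ^ (fst a $ i)) * (\<Prod>j\<in>UNIV. [:y $ j, v $ j:] ^ (snd a $ j)))"])
     (simp add: poly_sum poly_prod xy_eval_def)

text \<open>On the line from a point of \<open>U\<close> through \<open>(x, y)\<close> the
  polynomial is univariate with infinitely many zeros around \<open>t = 0\<close>; so it also
  vanishes at \<open>t = 1\<close>.\<close>

lemma xy_poly_vanish_open:
  assumes U: "open U" "U \<noteq> {}" and z: "\<And>x y. (x, y) \<in> U \<Longrightarrow> xy_eval h x y = 0"
  shows "h = 0"
proof (rule xy_poly_eqI)
  fix x y
  obtain x0 y0 where 0: "(x0, y0) \<in> U" using U by auto
  obtain p where p: "poly p t = xy_eval h (x0 + t *\<^sub>R (x - x0)) (y0 + t *\<^sub>R (y - y0))" for t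
    using xy_eval_line by blast
  let ?g = "\<lambda>t. (x0 + t *\<^sub>R (x - x0), y0 + t *\<^sub>R (y - y0))"
  have "open (?g -` U)"
    by (rule open_vimage[OF U(1)]) (intro continuous_intros)
  moreover have "0 \<in> ?g -` U" using 0 by simp
  ultimately have "infinite (?g -` U)" using finite_imp_not_open by blast
  moreover have "?g -` U \<subseteq> {t. poly p t = 0}" using z by (auto simp: p)
  ultimately have "infinite {t. poly p t = 0}" by (rule infinite_super[rotated])
  then have "p = 0" using poly_roots_finite[of p] by blast
  then show "xy_eval h x y = xy_eval 0 x y" using p[of 1] by (simp add: xy_eval_0)
qed

text \<open>The coefficient of degree \<open>e\<close> is the value at \<open>(x, y)\<close> of the
  homogeneous part of degree \<open>e\<close>, so leading forms become leading coefficients.\<close>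

definition ray_poly :: "('n::finite, 'm::finite) xy_poly \<Rightarrow> real ^ 'n \<Rightarrow> real ^ 'm \<Rightarrow> real poly" where
  "ray_poly h x y = (\<Sum>a\<in>Poly_Mapping.keys h. Polynomial.monom (Poly_Mapping.lookup h a * mon a x y) (xy_exp_deg a))"

lemma poly_ray_poly: "poly (ray_poly h x y) t = xy_eval h (t *\<^sub>R x) (t *\<^sub>R y)"
proof -
  have "mon a (t *\<^sub>R x) (t *\<^sub>R y) = t ^ xy_exp_deg a * mon a x y" for a :: "('a, 'b) xy_exp"
    by (simp add: power_mult_distrib prod.distrib power_sum xy_exp_deg_def power_add)
  then show ?thesis
    by (simp add: ray_poly_def poly_sum poly_monom xy_eval_def mult_ac)
qed

lemma coeff_ray_poly:
  "coeff (ray_poly h x y) e = (\<Sum>a\<in>{a \<in> Poly_Mapping.keys h. xy_exp_deg a = e}. Poly_Mapping.lookup h a * mon a x y)"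
proof -
  have "coeff (ray_poly h x y) e =
      (\<Sum>a\<in>Poly_Mapping.keys h. if xy_exp_deg a = e then Poly_Mapping.lookup h a * mon a x y else 0)"
    by (simp add: ray_poly_def coeff_sum)
  then show ?thesis by (simp add: sum.inter_filter)
qed

lemma degree_ray_poly: "degree (ray_poly h x y) \<le> xy_deg h"
proof (rule degree_le, intro allI impI)
  fix e assume "xy_deg h < e"
  then have "{a \<in> Poly_Mapping.keys h. xy_exp_deg a = e} = {}"
    using xy_deg_keys[of _ h] by fastforce
  then show "coeff (ray_poly h x y) e = 0" by (simp only: coeff_ray_poly sum.empty)
qed

lemma coeff_power2_top: "degree p \<le> D \<Longrightarrow> coeff (p\<^sup>2) (2 * D) = (coeff p D)\<^sup>2" for p :: "real poly"
proof (cases "degree p = D")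
  case True
  then show ?thesis using coeff_mult_degree_sum[of p p] by (simp add: power2_eq_square mult_2)
next
  case False
  assume "degree p \<le> D"
  then have "degree (p\<^sup>2) < 2 * D" using False degree_mult_le[of p p] by (simp add: power2_eq_square)
  then show ?thesis using False \<open>degree p \<le> D\<close> by (simp add: coeff_eq_0)
qed

text \<open>The leading forms of the squares cannot cancel.\<close>

lemma sum_squares_deg:
  assumes deg: "xy_deg (\<Sum>r\<leftarrow>qs. r\<^sup>2) \<le> 2 * d" and r: "r \<in> set qs"
  shows "xy_deg r \<le> d"
proof (rule ccontr)
  assume "\<not> xy_deg r \<le> d"
  define D where "D = Max (xy_deg ` set qs)"
  have D: "xy_deg q \<le> D" if "q \<in> set qs" for q using that by (simp add: D_def)
  have "D > d" using D[OF r] \<open>\<not> xy_deg r \<le> d\<close> by simp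
  have "D \<in> xy_deg ` set qs" unfolding D_def using r by (intro Max_in) auto
  then obtain q where q: "q \<in> set qs" "xy_deg q = D" by auto
  have "D \<in> insert 0 (xy_exp_deg ` Poly_Mapping.keys q)"
    using Max_in[of "insert 0 (xy_exp_deg ` Poly_Mapping.keys q)"] q(2) by (auto simp: xy_deg_def)
  then obtain a where a: "a \<in> Poly_Mapping.keys q" "xy_exp_deg a = D" using \<open>D > d\<close> by auto
  have "(\<Sum>b\<in>{b \<in> Poly_Mapping.keys q. xy_exp_deg b = D}. Poly_Mapping.lookup q b * mon b x y) = 0" for x y
  proof -
    have "poly (ray_poly (\<Sum>r\<leftarrow>qs. r\<^sup>2) x y) = poly (\<Sum>r\<leftarrow>qs. (ray_poly r x y)\<^sup>2)"
      unfolding fun_eq_iff poly_ray_poly xy_eval_sum_squares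
      by (induction qs) (auto simp: poly_ray_poly)
    then have "ray_poly (\<Sum>r\<leftarrow>qs. r\<^sup>2) x y = (\<Sum>r\<leftarrow>qs. (ray_poly r x y)\<^sup>2)"
      by (simp add: poly_eq_poly_eq_iff)
    \<comment> \<open>\<open>D\<close> exceeds \<open>d\<close>, so degree \<open>2 * D\<close> is
      beyond the bound on the sum although a single square reaches it.\<close>
    moreover have "coeff (ray_poly (\<Sum>r\<leftarrow>qs. r\<^sup>2) x y) (2 * D) = 0"
      using degree_ray_poly[of "\<Sum>r\<leftarrow>qs. r\<^sup>2" x y] deg \<open>D > d\<close> by (intro coeff_eq_0) linarith
    moreover have "coeff (\<Sum>r\<leftarrow>qs'. (ray_poly r x y)\<^sup>2) (2 * D) = (\<Sum>r\<leftarrow>qs'. (coeff (ray_poly r x y) D)\<^sup>2)"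
      if "set qs' \<subseteq> set qs" for qs' using that
    proof (induction qs')
      case (Cons r qs')
      then have "degree (ray_poly r x y) \<le> D" using degree_ray_poly[of r x y] D[of r] by simp
      then show ?case using Cons by (simp add: coeff_power2_top)
    qed simp
    ultimately have "(\<Sum>r\<leftarrow>qs. (coeff (ray_poly r x y) D)\<^sup>2) = 0" by simp
    then have "\<forall>r\<in>set qs. (coeff (ray_poly r x y) D)\<^sup>2 = 0"
      by (subst (asm) sum_list_nonneg_eq_0_iff) auto
    then show ?thesis using q(1) by (simp add: coeff_ray_poly[symmetric])
  qed
  from mon_independent[OF _ this, of a] a show False by (simp add: in_keys_iff)
qed

section \<open>Sums of squares\<close>

lemma psd_sum_insert:
  fixes A :: "'i \<Rightarrow> 'i \<Rightarrow> real"
  assumes "finite I" "i \<notin> I" "\<And>a. a \<in> I \<Longrightarrow> A a i = A i a"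
  shows "(\<Sum>a\<in>insert i I. \<Sum>b\<in>insert i I. u a * A a b * u b) =
    u i * u i * A i i + 2 * u i * (\<Sum>a\<in>I. A i a * u a) + (\<Sum>a\<in>I. \<Sum>b\<in>I. u a * A a b * u b)"
proof -
  have "(\<Sum>a\<in>I. u a * A a i * u i) = u i * (\<Sum>a\<in>I. A i a * u a)"
    by (simp add: sum_distrib_left assms(3) mult_ac cong: sum.cong)
  moreover have "(\<Sum>b\<in>I. u i * A i b * u b) = u i * (\<Sum>a\<in>I. A i a * u a)"
    by (simp add: sum_distrib_left mult_ac)
  ultimately show ?thesis using assms(1,2) by (simp add: sum.distrib algebra_simps)
qed

lemma nonneg_affine_imp_0: "(\<And>t::real. 0 \<le> t * b + c) \<Longrightarrow> b = 0"
proof (rule ccontr)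
  assume "\<And>t::real. 0 \<le> t * b + c" and "b \<noteq> 0"
  from this(1)[of "- (c + 1) / b"] this(2) show False by simp
qed

text \<open>Symmetric Gaussian elimination; if the pivot vanishes then so does its row.\<close>

lemma psd_on_decompose:
  fixes A :: "'i \<Rightarrow> 'i \<Rightarrow> real"
  assumes "finite I" "psd_on I A"
  shows "\<exists>U. \<forall>a\<in>I. \<forall>b\<in>I. A a b = (\<Sum>r\<in>I. U r a * U r b)"
  using assms
proof (induction I arbitrary: A)
  case empty
  then show ?case by simp
next
  case (insert i I)
  have sym: "A a b = A b a" if "a \<in> insert i I" "b \<in> insert i I" for a b
    using insert.prems that unfolding psd_on_def by blast
  have nonneg: "0 \<le> u i * u i * A i i + 2 * u i * (\<Sum>a\<in>I. A i a * u a) + (\<Sum>a\<in>I. \<Sum>b\<in>I. u a * A a b * u b)" for u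
    using insert.prems insert.hyps sym unfolding psd_on_def by (subst psd_sum_insert[symmetric]) auto
  have Aii: "0 \<le> A i i"
    using nonneg[of "\<lambda>a. if a = i then 1 else 0"] insert.hyps
    by (auto simp: if_distrib cong: if_cong sum.cong)
  have row: "A i b = 0" if "A i i = 0" "b \<in> I" for b
  proof -
    have "0 \<le> t * (2 * A i b) + A b b" for t
    proof -
      \<comment> \<open>At \<open>t e_i + e_b\<close> the form is affine in \<open>t\<close>,
        because the pivot, the coefficient of \<open>t^2\<close>, is 0.\<close>
      let ?u = "\<lambda>a. if a = i then t else if a = b then 1 else 0"
      have "(\<Sum>a\<in>I. A i a * ?u a) = (\<Sum>a\<in>I. if a = b then A i a else 0)"
        using insert.hyps by (intro sum.cong) auto
      moreover have "(\<Sum>a'\<in>I. \<Sum>b'\<in>I. ?u a' * A a' b' * ?u b') =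
          (\<Sum>a'\<in>I. \<Sum>b'\<in>I. if b' = b then (if a' = b then A b b else 0) else 0)"
        using insert.hyps by (intro sum.cong) auto
      ultimately show ?thesis using nonneg[of ?u] that insert.hyps by simp
    qed
    from nonneg_affine_imp_0[OF this] show ?thesis by simp
  qed
  \<comment> \<open>The pivot row, scaled so that its rank-one matrix matches row \<open>i\<close>.
    For a zero pivot the division gives 0, in agreement with the vanishing row.\<close>
  define w where "w a = A i a / sqrt (A i i)" for a
  have ww: "w a * w b = A i a * A i b / A i i" for a b
    using Aii by (simp add: w_def)
  have "psd_on I (\<lambda>a b. A a b - w a * w b)"
    unfolding psd_on_def
  proof (intro conjI ballI allI)
    show "A a b - w a * w b = A b a - w b * w a" if "a \<in> I" "b \<in> I" for a b
      using sym that by simp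
    fix u :: "'i \<Rightarrow> real"
    let ?S = "\<Sum>a\<in>I. A i a * u a"
    \<comment> \<open>The entry at \<open>i\<close> minimizes the form for the given
      \<open>u\<close>, so the form of the Schur complement at \<open>u\<close> is the form of
      \<open>A\<close> at \<open>?v\<close>.\<close>
    let ?v = "u(i := - ?S / A i i)"
    have cg: "(\<Sum>a\<in>I. A i a * ?v a) = ?S" "(\<Sum>a\<in>I. \<Sum>b\<in>I. ?v a * A a b * ?v b) = (\<Sum>a\<in>I. \<Sum>b\<in>I. u a * A a b * u b)"
      using insert.hyps by (auto intro!: sum.cong)
    have "(\<Sum>a\<in>I. \<Sum>b\<in>I. u a * (w a * w b) * u b) = ?S * ?S / A i i"
      by (simp add: ww sum_product sum_divide_distrib mult_ac)
    then have "(\<Sum>a\<in>I. \<Sum>b\<in>I. u a * (A a b - w a * w b) * u b) =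
        (\<Sum>a\<in>I. \<Sum>b\<in>I. u a * A a b * u b) - ?S * ?S / A i i"
      by (simp add: algebra_simps sum_subtractf)
    also have "\<dots> \<ge> 0"
      using nonneg[of ?v] unfolding cg by (cases "A i i = 0") (auto simp: field_simps)
    finally show "0 \<le> (\<Sum>a\<in>I. \<Sum>b\<in>I. u a * (A a b - w a * w b) * u b)" .
  qed
  from insert.IH[OF this] obtain U where
    U: "\<And>a b. a \<in> I \<Longrightarrow> b \<in> I \<Longrightarrow> A a b - w a * w b = (\<Sum>r\<in>I. U r a * U r b)" by auto
  \<comment> \<open>Factor \<open>i\<close> is the pivot row; the old factors are extended by 0 in
    column \<open>i\<close>.\<close>
  define V where "V r a = (if r = i then w a else if a = i then 0 else U r a)" for r a
  have "A a b = (\<Sum>r\<in>insert i I. V r a * V r b)" if a: "a \<in> insert i I" and b: "b \<in> insert i I" for a b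
  proof -
    have iI: "i \<notin> I" by fact
    have sumV: "(\<Sum>r\<in>insert i I. V r a * V r b) = w a * w b + (\<Sum>r\<in>I. V r a * V r b)"
      using insert.hyps by (simp add: V_def)
    have edge: "A i c = w i * w c" if "c \<in> insert i I" for c
      using row[of c] that by (cases "A i i = 0") (auto simp: ww)
    show ?thesis
    proof (cases "a = i \<or> b = i")
      case True
      then have "(\<Sum>r\<in>I. V r a * V r b) = 0"
        using iI by (intro sum.neutral) (auto simp: V_def)
      then show ?thesis using True edge[of a] edge[of b] a b sym[of a i]
        by (auto simp: sumV mult.commute)
    next
      case False
      then have "a \<in> I" "b \<in> I" using a b by auto
      moreover have "(\<Sum>r\<in>I. V r a * V r b) = (\<Sum>r\<in>I. U r a * U r b)"
        using iI False by (intro sum.cong) (auto simp: V_def)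
      ultimately show ?thesis using U[of a b] sumV by simp
    qed
  qed
  then show ?case by blast
qed

lemma poly_sum_monoms_superset:
  assumes "finite A" "Poly_Mapping.keys h \<subseteq> A"
  shows "h = (\<Sum>a\<in>A. Poly_Mapping.lookup h a *\<^sub>R xy_monom a)"
  by (subst poly_sum_monoms, rule sum.mono_neutral_left) (use assms in \<open>auto simp: in_keys_iff\<close>)

lemma power2_sum_monoms:
  fixes u :: "('n::finite, 'm::finite) xy_exp \<Rightarrow> real"
  shows "(\<Sum>a\<in>A. u a *\<^sub>R xy_monom a)\<^sup>2 = (\<Sum>a\<in>A. \<Sum>b\<in>A. (u a * u b) *\<^sub>R xy_monom (a + b))"
  unfolding power2_eq_square sum_product by (intro sum.cong refl) (simp add: monom_mult mult.commute)

lemma in_sosI: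
  assumes "finite R" "\<And>r. r \<in> R \<Longrightarrow> xy_deg (P r) \<le> d"
  shows "(\<Sum>r\<in>R. (P r)\<^sup>2) \<in> sos d"
proof -
  obtain rs where rs: "set rs = R" "distinct rs" using finite_distinct_list[OF assms(1)] by blast
  have "(\<Sum>r\<in>R. (P r)\<^sup>2) = (\<Sum>r\<leftarrow>map P rs. r\<^sup>2)"
    using rs by (simp add: sum.distinct_set_conv_list[symmetric] o_def)
  moreover have "xy_deg (\<Sum>r\<in>R. (P r)\<^sup>2) \<le> 2 * d"
    using assms(2) by (intro xy_deg_sum xy_deg_power2) auto
  ultimately show ?thesis unfolding sos_def by blast
qed

text \<open>The Gram matrix bounds the number of squares by the number of monomials of degree at most \<open>d\<close>.\<close>

lemma sos_bounded_length:
  fixes q :: "('n::finite, 'm::finite) xy_poly"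
  assumes "q \<in> sos d"
  obtains P where "\<And>r. r \<in> (exps d :: ('n, 'm) xy_exp set) \<Longrightarrow> xy_deg (P r) \<le> d"
    "q = (\<Sum>r\<in>(exps d :: ('n, 'm) xy_exp set). (P r)\<^sup>2)"
proof -
  from assms obtain qs where q: "q = (\<Sum>r\<leftarrow>qs. r\<^sup>2)" and deg: "xy_deg q \<le> 2 * d" by (auto simp: sos_def)
  define N where "N = {0..<length qs}"
  define c where "c i = Poly_Mapping.lookup (qs ! i)" for i
  \<comment> \<open>By \<open>sum_squares_deg\<close> each summand already has degree at most
    \<open>d\<close>, so its coefficients on \<open>exps d\<close> determine it.\<close>
  have exp: "qs ! i = (\<Sum>a\<in>exps d. c i a *\<^sub>R xy_monom a)" if "i \<in> N" for i
    unfolding c_def using sum_squares_deg[of qs d "qs ! i"] deg that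
    by (intro poly_sum_monoms_superset) (auto simp: q N_def finite_exps xy_deg_le_iff)
  have "psd_on (exps d) (\<lambda>a b. \<Sum>i\<in>N. c i a * c i b)"
    unfolding psd_on_def
  proof (intro conjI ballI allI)
    fix u
    have "(\<Sum>a\<in>exps d. \<Sum>b\<in>exps d. u a * (\<Sum>i\<in>N. c i a * c i b) * u b) =
      (\<Sum>a\<in>exps d. \<Sum>b\<in>exps d. \<Sum>i\<in>N. (u a * c i a) * (u b * c i b))"
      by (simp add: sum_distrib_left sum_distrib_right mult_ac)
    also have "\<dots> = (\<Sum>a\<in>exps d. \<Sum>i\<in>N. \<Sum>b\<in>exps d. (u a * c i a) * (u b * c i b))"
      by (intro sum.cong refl sum.swap)
    also have "\<dots> = (\<Sum>i\<in>N. \<Sum>a\<in>exps d. \<Sum>b\<in>exps d. (u a * c i a) * (u b * c i b))"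
      by (rule sum.swap)
    also have "\<dots> = (\<Sum>i\<in>N. (\<Sum>a\<in>exps d. u a * c i a)\<^sup>2)"
      by (simp add: power2_eq_square sum_product)
    finally show "0 \<le> (\<Sum>a\<in>exps d. \<Sum>b\<in>exps d. u a * (\<Sum>i\<in>N. c i a * c i b) * u b)"
      by (simp add: sum_nonneg)
  qed (simp add: mult.commute)
  from psd_on_decompose[OF finite_exps this] obtain U where
    U: "\<forall>a\<in>exps d. \<forall>b\<in>exps d. (\<Sum>i\<in>N. c i a * c i b) = (\<Sum>r\<in>(exps d :: ('n, 'm) xy_exp set). U r a * U r b)" ..
  define P where "P r = (\<Sum>a\<in>exps d. U r a *\<^sub>R xy_monom a)" for r :: "('n, 'm) xy_exp"
  \<comment> \<open>The sum of squares depends on the coefficient vectors only through their Gram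
    matrix, hence the factorization \<open>U\<close> may replace \<open>c\<close>.\<close>
  have gram: "(\<Sum>i\<in>I. (\<Sum>a\<in>exps d. w i a *\<^sub>R xy_monom a)\<^sup>2) =
      (\<Sum>a\<in>exps d. \<Sum>b\<in>exps d. (\<Sum>i\<in>I. w i a * w i b) *\<^sub>R xy_monom (a + b))"
    for I :: "'k set" and w :: "'k \<Rightarrow> ('n, 'm) xy_exp \<Rightarrow> real"
  proof -
    have "(\<Sum>i\<in>I. (\<Sum>a\<in>exps d. w i a *\<^sub>R xy_monom a)\<^sup>2) =
      (\<Sum>i\<in>I. \<Sum>a\<in>exps d. \<Sum>b\<in>exps d. (w i a * w i b) *\<^sub>R xy_monom (a + b))"
      by (simp add: power2_sum_monoms)
    also have "\<dots> = (\<Sum>a\<in>exps d. \<Sum>i\<in>I. \<Sum>b\<in>exps d. (w i a * w i b) *\<^sub>R xy_monom (a + b))"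
      by (rule sum.swap)
    also have "\<dots> = (\<Sum>a\<in>exps d. \<Sum>b\<in>exps d. \<Sum>i\<in>I. (w i a * w i b) *\<^sub>R xy_monom (a + b))"
      by (intro sum.cong refl sum.swap)
    finally show ?thesis by (simp add: scaleR_sum_left)
  qed
  show thesis
  proof (rule that)
    show "xy_deg (P r) \<le> d" for r
      unfolding P_def by (intro xy_deg_sum xy_deg_scaleR) (simp add: xy_deg_monom exps_def)
    have "q = (\<Sum>i\<in>N. (qs ! i)\<^sup>2)"
      by (simp add: q sum_list_sum_nth N_def)
    also have "\<dots> = (\<Sum>i\<in>N. (\<Sum>a\<in>exps d. c i a *\<^sub>R xy_monom a)\<^sup>2)"
      using exp by (intro sum.cong) auto
    also have "\<dots> = (\<Sum>r\<in>exps d. (P r)\<^sup>2)"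
      unfolding P_def gram using U by (intro sum.cong) auto
    finally show "q = (\<Sum>r\<in>exps d. (P r)\<^sup>2)" .
  qed
qed

lemma sos_square: "xy_deg p \<le> d \<Longrightarrow> p\<^sup>2 \<in> sos d"
  using in_sosI[of "{()}" "\<lambda>_. p" d] by simp

lemma sos_0: "0 \<in> sos d"
  using in_sosI[of "{}" "\<lambda>_. 0" d] by simp

lemma sos_add: "p \<in> sos d \<Longrightarrow> q \<in> sos d \<Longrightarrow> p + q \<in> sos d"
proof -
  assume "p \<in> sos d" "q \<in> sos d"
  then obtain ps qs where "p = (\<Sum>r\<leftarrow>ps. r\<^sup>2)" "q = (\<Sum>r\<leftarrow>qs. r\<^sup>2)" "xy_deg p \<le> 2 * d" "xy_deg q \<le> 2 * d"
    by (auto simp: sos_def)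
  then show ?thesis unfolding sos_def by (auto intro!: xy_deg_add exI[of _ "ps @ qs"])
qed

lemma sos_mult_square:
  assumes "p \<in> sos d" "xy_deg h \<le> e"
  shows "h\<^sup>2 * p \<in> sos (d + e)"
proof -
  obtain P where P: "\<And>r. r \<in> (exps d :: ('a, 'b) xy_exp set) \<Longrightarrow> xy_deg (P r) \<le> d"
      "p = (\<Sum>r\<in>(exps d :: ('a, 'b) xy_exp set). (P r)\<^sup>2)"
    using sos_bounded_length[OF assms(1)] by blast
  have "h\<^sup>2 * p = (\<Sum>r\<in>(exps d :: ('a, 'b) xy_exp set). (P r * h)\<^sup>2)"
    by (simp add: P(2) sum_distrib_left power_mult_distrib mult.commute)
  then show ?thesis using P(1) assms(2) by (auto intro!: in_sosI finite_exps xy_deg_mult)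
qed

lemma sos_scale:
  assumes "p \<in> sos d" "0 \<le> c"
  shows "c *\<^sub>R p \<in> sos d"
proof -
  have "(sqrt c *\<^sub>R 1)\<^sup>2 * p \<in> sos (d + 0)"
    by (intro sos_mult_square assms xy_deg_scaleR) simp
  then show ?thesis using assms(2) by (simp add: power2_eq_square)
qed

lemma sos_mono: "d \<le> e \<Longrightarrow> sos d \<subseteq> sos e"
  by (auto simp: sos_def)

lemma sos_deg: "p \<in> sos d \<Longrightarrow> xy_deg p \<le> 2 * d"
  by (simp add: sos_def)

lemma sos_eval_nonneg: "p \<in> sos d \<Longrightarrow> 0 \<le> xy_eval p x y"
  by (auto simp: sos_def xy_eval_sum_squares intro!: sum_list_nonneg)

text \<open>At the coefficient vector of \<open>q\<close> the quadratic form of the matrix is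
  \<open>riesz z (h * q^2)\<close>; in this form it can be compared with the quadratic
  module.\<close>

lemma psd_loc_matrix_iff:
  fixes h :: "('n::finite, 'm::finite) xy_poly"
  shows "psd_on (exps d) (loc_matrix h z) \<longleftrightarrow> (\<forall>q. xy_deg q \<le> d \<longrightarrow> 0 \<le> riesz z (h * q\<^sup>2))"
proof -
  have eq: "(\<Sum>a\<in>exps d. \<Sum>b\<in>exps d. u a * loc_matrix h z a b * u b) =
      riesz z (h * (\<Sum>a\<in>exps d. u a *\<^sub>R xy_monom a)\<^sup>2)" for u
    by (simp add: power2_sum_monoms sum_distrib_left linear_sum[OF linear_riesz]
        linear_scale[OF linear_riesz] loc_matrix_def mult_ac)
  show ?thesis
  proof
    assume psd: "psd_on (exps d) (loc_matrix h z)"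
    show "\<forall>q. xy_deg q \<le> d \<longrightarrow> 0 \<le> riesz z (h * q\<^sup>2)"
    proof (intro allI impI)
      fix q :: "('n, 'm) xy_poly" assume "xy_deg q \<le> d"
      then have "(\<Sum>a\<in>exps d. Poly_Mapping.lookup q a *\<^sub>R xy_monom a) = q"
        by (intro poly_sum_monoms_superset[symmetric]) (auto simp: finite_exps xy_deg_le_iff)
      moreover have "0 \<le> riesz z (h * (\<Sum>a\<in>exps d. Poly_Mapping.lookup q a *\<^sub>R xy_monom a)\<^sup>2)"
        using psd unfolding psd_on_def eq by blast
      ultimately show "0 \<le> riesz z (h * q\<^sup>2)" by simp
    qed
  next
    assume R: "\<forall>q. xy_deg q \<le> d \<longrightarrow> 0 \<le> riesz z (h * q\<^sup>2)"
    show "psd_on (exps d) (loc_matrix h z)"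
      unfolding psd_on_def eq
    proof (intro conjI ballI allI)
      show "loc_matrix h z a b = loc_matrix h z b a" for a b
        by (simp add: loc_matrix_def add.commute)
      fix u :: "('n, 'm) xy_exp \<Rightarrow> real"
      have "xy_deg (\<Sum>a\<in>exps d. u a *\<^sub>R xy_monom a) \<le> d"
        by (intro xy_deg_sum xy_deg_scaleR) (simp add: xy_deg_monom exps_def)
      then show "0 \<le> riesz z (h * (\<Sum>a\<in>exps d. u a *\<^sub>R xy_monom a)\<^sup>2)" using R by blast
    qed
  qed
qed

section \<open>The truncated quadratic module\<close>

lemma half_deg_le_iff: "half_deg h \<le> k \<longleftrightarrow> xy_deg h \<le> 2 * k"
proof -
  have "half_deg h \<le> k \<longleftrightarrow> real (xy_deg h) / 2 \<le> real k"
    by (simp add: half_deg_def nat_le_iff ceiling_le_iff)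
  also have "\<dots> \<longleftrightarrow> real (xy_deg h) \<le> real (2 * k)" by (simp add: mult.commute)
  finally show ?thesis unfolding of_nat_le_iff .
qed

lemma half_deg_eqI: "xy_deg h \<le> 2 \<Longrightarrow> 0 < xy_deg h \<Longrightarrow> half_deg h = 1"
  using half_deg_le_iff[of h 1] half_deg_le_iff[of h 0] by simp

lemma half_deg_1 [simp]: "half_deg 1 = 0"
  by (simp add: half_deg_def)

text \<open>One index for the variables of both blocks, so that arguments about a single variable
  are made once.\<close>

fun unit_exp :: "'n::finite + 'm::finite \<Rightarrow> ('n, 'm) xy_exp" where
  "unit_exp (Inl i) = (axis i 1, 0)"
| "unit_exp (Inr j) = (0, axis j 1)"

abbreviation "coord u \<equiv> xy_monom (unit_exp u)"

lemma var_x_eq: "var_x i = coord (Inl i)" and var_y_eq: "var_y j = coord (Inr j)"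
  by (simp_all add: var_x_def var_y_def)

lemma sum_axis [simp]: "(\<Sum>i'\<in>UNIV. axis i (c::nat) $ i') = c"
  by (simp add: axis_def)

lemma xy_exp_deg_unit [simp]: "xy_exp_deg (unit_exp u) = 1"
  by (cases u) (simp_all add: xy_exp_deg_def)

lemma unit_exp_inj: "unit_exp u + unit_exp u = unit_exp v + unit_exp v \<longleftrightarrow> u = v"
  by (cases u; cases v) (auto simp: vec_eq_iff axis_def)

lemma lookup_coord_sq: "Poly_Mapping.lookup ((coord u)\<^sup>2) (unit_exp v + unit_exp v) = (if u = v then 1 else 0)"
  by (simp add: xy_monom_power2) (simp add: xy_monom_def lookup_single unit_exp_inj when_def)

lemma xy_deg_coord_sq: "xy_deg ((coord u)\<^sup>2) \<le> 2"
  by (simp add: xy_monom_power2 xy_deg_monom xy_exp_deg_add)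

lemma unit_exp_double_nonzero: "unit_exp u + unit_exp u \<noteq> 0"
  using xy_exp_deg_add[of "unit_exp u" "unit_exp u"] by (metis xy_exp_deg_0 xy_exp_deg_unit one_add_one zero_neq_numeral)

lemma xy_deg_pos: "Poly_Mapping.lookup h (unit_exp u + unit_exp u) \<noteq> 0 \<Longrightarrow> 0 < xy_deg h"
  using xy_deg_keys[of "unit_exp u + unit_exp u" h] by (simp add: in_keys_iff xy_exp_deg_add)

lemma half_deg_theta [simp]: "half_deg (theta i) = 1"
proof (rule half_deg_eqI)
  show "xy_deg (theta i :: ('a, 'b) xy_poly) \<le> 2"
    unfolding theta_def var_x_eq by (intro xy_deg_diff xy_deg_coord_sq) simp
  show "0 < xy_deg (theta i :: ('a, 'b) xy_poly)"
    by (rule xy_deg_pos[of _ "Inl i"])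
      (simp add: theta_def var_x_eq lookup_minus lookup_coord_sq lookup_one unit_exp_double_nonzero
        del: unit_exp.simps)
qed

lemma half_deg_ball_poly [simp]: "half_deg ball_poly = 1"
proof (rule half_deg_eqI)
  show "xy_deg (ball_poly :: ('a, 'b) xy_poly) \<le> 2"
    unfolding ball_poly_def var_y_eq by (intro xy_deg_diff xy_deg_sum xy_deg_coord_sq) simp
  show "0 < xy_deg (ball_poly :: ('a, 'b) xy_poly)"
    by (rule xy_deg_pos[of _ "Inr undefined"])
      (simp add: ball_poly_def var_y_eq lookup_minus lookup_sum lookup_coord_sq lookup_one
        unit_exp_double_nonzero del: unit_exp.simps)
qed

text \<open>Both kinds of constraints in one family, so that a certificate is a single sum.\<close>

definition constr :: "nat \<Rightarrow> (nat \<Rightarrow> ('n::finite, 'm::finite) xy_poly) \<Rightarrow> nat + 'n \<Rightarrow> ('n, 'm) xy_poly" where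
  "constr s g c = (case c of Inl j \<Rightarrow> gfam s g j | Inr i \<Rightarrow> theta i)"

definition cidx :: "nat \<Rightarrow> (nat + 'n::finite) set" where
  "cidx s = {0..s + 1} <+> UNIV"

text \<open>Guards against truncated subtraction in \<open>k - half_deg\<close>: otherwise a
  constant multiplier would be allowed although the constraint alone exceeds degree
  \<open>2 * k\<close>.\<close>

definition fits :: "nat \<Rightarrow> (nat \<Rightarrow> ('n::finite, 'm::finite) xy_poly) \<Rightarrow> nat \<Rightarrow> bool" where
  "fits s g k \<longleftrightarrow> (\<forall>c\<in>cidx s. half_deg (constr s g c) \<le> k)"

definition QM :: "nat \<Rightarrow> (nat \<Rightarrow> ('n::finite, 'm::finite) xy_poly) \<Rightarrow> nat \<Rightarrow> ('n, 'm) xy_poly set" where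
  "QM s g k = {\<Sum>c\<in>cidx s. \<sigma> c * constr s g c | \<sigma>. \<forall>c\<in>cidx s. \<sigma> c \<in> sos (k - half_deg (constr s g c))}"

lemma finite_cidx [simp]: "finite (cidx s)"
  by (simp add: cidx_def)

lemma ball_cidx: "(\<forall>c\<in>cidx s. P c) \<longleftrightarrow> (\<forall>j\<in>{0..s + 1}. P (Inl j)) \<and> (\<forall>i. P (Inr i))"
  unfolding cidx_def Plus_def by blast

lemma cidx_one: "Inl 0 \<in> cidx s" "constr s g (Inl 0) = 1"
  and cidx_ball: "Inl (s + 1) \<in> cidx s" "constr s g (Inl (s + 1)) = ball_poly"
  and cidx_theta: "Inr i \<in> cidx s" "constr s g (Inr i) = theta i"
  by (auto simp: cidx_def constr_def gfam_def)

lemma fits_ge_1: "fits s g k \<Longrightarrow> 1 \<le> k"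
  using cidx_ball(1)[of s] unfolding fits_def by (metis cidx_ball(2) half_deg_ball_poly)

lemma fits_mono: "fits s g k \<Longrightarrow> k \<le> k' \<Longrightarrow> fits s g k'"
  unfolding fits_def by (meson order_trans)

text \<open>The ball constraint belongs to \<open>gfam\<close> and has half degree 1, so
  \<open>k\<close> is at least 1 and the constraints \<open>theta i\<close> fit as well.\<close>

lemma admissible_iff: "admissible s g f k \<longleftrightarrow> fits s g k \<and> xy_deg f \<le> 2 * k"
proof -
  have "1 \<le> k" if "\<forall>j\<in>{0..s + 1}. half_deg (gfam s g j) \<le> k"
    using bspec[OF that, of "s + 1"] by (simp add: gfam_def)
  then show ?thesis unfolding admissible_def fits_def ball_cidx by (auto simp: constr_def)
qed

lemma QM_I: "(\<And>c. c \<in> cidx s \<Longrightarrow> \<sigma> c \<in> sos (k - half_deg (constr s g c))) \<Longrightarrow> (\<Sum>c\<in>cidx s. \<sigma> c * constr s g c) \<in> QM s g k"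
  by (auto simp: QM_def)

lemma QM_E:
  assumes "h \<in> QM s g k"
  obtains \<sigma> where "h = (\<Sum>c\<in>cidx s. \<sigma> c * constr s g c)" "\<And>c. c \<in> cidx s \<Longrightarrow> \<sigma> c \<in> sos (k - half_deg (constr s g c))"
  using assms by (auto simp: QM_def)

lemma QM_add:
  assumes "p \<in> QM s g k" "q \<in> QM s g k"
  shows "p + q \<in> QM s g k"
proof -
  from assms obtain \<sigma> \<tau> where
    "p = (\<Sum>c\<in>cidx s. \<sigma> c * constr s g c)" "\<And>c. c \<in> cidx s \<Longrightarrow> \<sigma> c \<in> sos (k - half_deg (constr s g c))"
    "q = (\<Sum>c\<in>cidx s. \<tau> c * constr s g c)" "\<And>c. c \<in> cidx s \<Longrightarrow> \<tau> c \<in> sos (k - half_deg (constr s g c))"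
    by (auto elim!: QM_E)
  then show ?thesis using QM_I[of s "\<lambda>c. \<sigma> c + \<tau> c" k g]
    by (simp add: sos_add sum.distrib distrib_right)
qed

lemma QM_scale:
  assumes "p \<in> QM s g k" "0 \<le> r"
  shows "r *\<^sub>R p \<in> QM s g k"
proof -
  from assms obtain \<sigma> where
    "p = (\<Sum>c\<in>cidx s. \<sigma> c * constr s g c)" "\<And>c. c \<in> cidx s \<Longrightarrow> \<sigma> c \<in> sos (k - half_deg (constr s g c))"
    by (auto elim!: QM_E)
  then show ?thesis using QM_I[of s "\<lambda>c. r *\<^sub>R \<sigma> c" k g] assms(2)
    by (simp add: sos_scale scaleR_sum_right)
qed

lemma QM_mono: "k \<le> k' \<Longrightarrow> QM s g k \<subseteq> QM s g k'"
  unfolding QM_def using sos_mono[OF diff_le_mono] by (smt (verit) Collect_mono subsetD)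

lemma QM_mult_square:
  assumes "fits s g k" "p \<in> QM s g k" "xy_deg q \<le> e"
  shows "q\<^sup>2 * p \<in> QM s g (k + e)"
proof -
  from assms obtain \<sigma> where
    p: "p = (\<Sum>c\<in>cidx s. \<sigma> c * constr s g c)" and \<sigma>: "\<And>c. c \<in> cidx s \<Longrightarrow> \<sigma> c \<in> sos (k - half_deg (constr s g c))"
    by (auto elim!: QM_E)
  have "q\<^sup>2 * \<sigma> c \<in> sos (k + e - half_deg (constr s g c))" if "c \<in> cidx s" for c
    using sos_mult_square[OF \<sigma>[OF that] assms(3)] assms(1) that by (simp add: fits_def)
  from QM_I[of s "\<lambda>c. q\<^sup>2 * \<sigma> c" k g for k, OF this] show ?thesis
    by (simp add: p sum_distrib_left mult.assoc)
qed

lemma QM_gen: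
  assumes "c \<in> cidx s" "\<sigma> \<in> sos (k - half_deg (constr s g c))"
  shows "\<sigma> * constr s g c \<in> QM s g k"
proof -
  have "(\<Sum>c'\<in>cidx s. (if c' = c then \<sigma> else 0) * constr s g c') \<in> QM s g k"
    by (rule QM_I) (use assms sos_0 in auto)
  moreover have "(\<Sum>c'\<in>cidx s. (if c' = c then \<sigma> else 0) * constr s g c') =
      (\<Sum>c'\<in>cidx s. if c' = c then \<sigma> * constr s g c else 0)"
    by (intro sum.cong) auto
  ultimately show ?thesis using assms(1) by simp
qed

lemma QM_sos: "\<sigma> \<in> sos k \<Longrightarrow> \<sigma> \<in> QM s g k"
  using QM_gen[OF cidx_one(1), of \<sigma> k s g] by (simp add: cidx_one)

lemma QM_deg:
  assumes "fits s g k" "h \<in> QM s g k"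
  shows "xy_deg h \<le> 2 * k"
proof -
  from assms(2) obtain \<sigma> where
    h: "h = (\<Sum>c\<in>cidx s. \<sigma> c * constr s g c)" and \<sigma>: "\<And>c. c \<in> cidx s \<Longrightarrow> \<sigma> c \<in> sos (k - half_deg (constr s g c))"
    by (auto elim!: QM_E)
  have "xy_deg (\<sigma> c * constr s g c) \<le> 2 * k" if "c \<in> cidx s" for c
  proof -
    have "half_deg (constr s g c) \<le> k" using assms(1) that by (simp add: fits_def)
    moreover have "xy_deg (constr s g c) \<le> 2 * half_deg (constr s g c)"
      using half_deg_le_iff by blast
    ultimately show ?thesis using xy_deg_mult[OF sos_deg[OF \<sigma>[OF that]], of "constr s g c" "2 * half_deg (constr s g c)"]
      by simp
  qed
  then show ?thesis unfolding h by (intro xy_deg_sum)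
qed

lemma setK_iff: "(x, y) \<in> setK s g \<longleftrightarrow> (\<forall>c\<in>cidx s. 0 \<le> xy_eval (constr s g c) x y)"
proof -
  have "{0..s + 1} = insert 0 {1..s + 1}" by auto
  then show ?thesis
    unfolding setK_def ball_cidx by (simp add: constr_def gfam_def xy_eval_one)
qed

lemma QM_eval_nonneg:
  assumes "h \<in> QM s g k" "(x, y) \<in> setK s g"
  shows "0 \<le> xy_eval h x y"
proof -
  from assms(1) obtain \<sigma> where
    h: "h = (\<Sum>c\<in>cidx s. \<sigma> c * constr s g c)" and \<sigma>: "\<And>c. c \<in> cidx s \<Longrightarrow> \<sigma> c \<in> sos (k - half_deg (constr s g c))"
    by (auto elim!: QM_E)
  show ?thesis unfolding h xy_eval_sum xy_eval_mult
    using assms(2) sos_eval_nonneg[OF \<sigma>] unfolding setK_iff by (intro sum_nonneg mult_nonneg_nonneg) auto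
qed


subsection \<open>The Archimedean property\<close>

lemma exp_pred:
  fixes a :: "('n::finite, 'm::finite) xy_exp"
  assumes "0 < xy_exp_deg a"
  obtains b u where "a = b + unit_exp u"
proof -
  have "(\<exists>i. fst a $ i \<noteq> 0) \<or> (\<exists>j. snd a $ j \<noteq> 0)"
    by (rule ccontr) (use assms in \<open>simp add: xy_exp_deg_def\<close>)
  then consider i where "fst a $ i \<noteq> 0" | j where "snd a $ j \<noteq> 0" by blast
  then show thesis
  proof cases
    case (1 i)
    show thesis
      by (rule that[of "(fst a - axis i 1, snd a)" "Inl i"]) (use 1 in \<open>auto simp: prod_eq_iff vec_eq_iff axis_def\<close>)
  next
    case (2 j)
    show thesis
      by (rule that[of "(fst a, snd a - axis j 1)" "Inr j"]) (use 2 in \<open>auto simp: prod_eq_iff vec_eq_iff axis_def\<close>)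
  qed
qed

lemma exp_induct [case_names zero unit]:
  assumes "P 0" "\<And>a u. P a \<Longrightarrow> P (a + unit_exp u)"
  shows "P (a :: ('n::finite, 'm::finite) xy_exp)"
proof (induction "xy_exp_deg a" arbitrary: a)
  case 0
  then have "a = 0" by (auto simp: xy_exp_deg_def prod_eq_iff vec_eq_iff)
  then show ?case using assms(1) by simp
next
  case (Suc d)
  then obtain b u where "a = b + unit_exp u" using exp_pred[of a] by (metis zero_less_Suc)
  then show ?case using Suc assms(2)[of b u] by (simp add: xy_exp_deg_add)
qed

lemma exp_split:
  assumes "d \<le> xy_exp_deg c"
  shows "\<exists>a b. c = a + b \<and> xy_exp_deg a = d"
  using assms
proof (induction d)
  case 0
  then show ?case by (intro exI[of _ 0] exI[of _ c]) simp
next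
  case (Suc d)
  then obtain a b where ab: "c = a + b" "xy_exp_deg a = d" by auto
  then have "0 < xy_exp_deg b" using Suc.prems by (simp add: xy_exp_deg_add)
  then obtain b' u where "b = b' + unit_exp u" using exp_pred by blast
  then show ?case using ab
    by (intro exI[of _ "a + unit_exp u"] exI[of _ b']) (simp add: xy_exp_deg_add add_ac)
qed

text \<open>For an x variable this is the generator \<open>theta i\<close>. For a y variable,
  \<open>1 - y_j^2\<close> is the ball polynomial plus the squares of the other y variables.\<close>

lemma QM_unit:
  fixes q :: "('n::finite, 'm::finite) xy_poly"
  assumes "1 \<le> k" "xy_deg q \<le> k - 1"
  shows "q\<^sup>2 * (1 - (coord u)\<^sup>2) \<in> QM s g k"
proof (cases u)
  case (Inl i)
  have "q\<^sup>2 * theta i \<in> QM s g k"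
    using QM_gen[OF cidx_theta(1), of "q\<^sup>2" k s g i] sos_square[OF assms(2)]
    by (simp add: cidx_theta(2))
  then show ?thesis by (simp add: Inl theta_def var_x_eq del: unit_exp.simps)
next
  case (Inr j)
  have "q\<^sup>2 * ball_poly \<in> QM s g k"
    using QM_gen[OF cidx_ball(1), of "q\<^sup>2" k s g] sos_square[OF assms(2)] by (simp add: cidx_ball(2)[simplified])
  moreover have "(\<Sum>l\<in>UNIV - {j}. (q * var_y l)\<^sup>2) \<in> sos k"
  proof (intro in_sosI)
    fix l
    have "xy_deg (q * var_y l) \<le> (k - 1) + 1"
      by (intro xy_deg_mult assms(2)) (simp add: var_y_eq xy_deg_monom del: unit_exp.simps)
    then show "xy_deg (q * var_y l) \<le> k" using assms(1) by simp
  qed simp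
  moreover have "q\<^sup>2 * (1 - (coord u)\<^sup>2) = q\<^sup>2 * ball_poly + (\<Sum>l\<in>UNIV - {j}. (q * var_y l)\<^sup>2)"
  proof -
    have "(\<Sum>l\<in>UNIV. (var_y l)\<^sup>2) = (var_y j)\<^sup>2 + (\<Sum>l\<in>UNIV - {j}. (var_y l :: ('n, 'm) xy_poly)\<^sup>2)"
      by (rule sum.remove) auto
    then show ?thesis
      by (simp add: ball_poly_def Inr var_y_eq power_mult_distrib sum_distrib_left[symmetric] algebra_simps
          del: unit_exp.simps)
  qed
  ultimately show ?thesis using QM_add QM_sos by metis
qed

text \<open>The identity \<open>1 - m^2 X^2 = (1 - m^2) + m^2 (1 - X^2)\<close> adds one variable at
  a time. The monomial \<open>m\<close> has degree below \<open>k\<close>, as \<open>QM_unit\<close>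
  requires.\<close>

lemma QM_one_minus_even:
  assumes "xy_exp_deg a \<le> k" "1 \<le> k"
  shows "1 - xy_monom (a + a) \<in> QM s g k"
  using assms(1)
proof (induction a rule: exp_induct)
  case zero
  then show ?case using QM_sos[OF sos_0, of s g k] by simp
next
  case (unit a u)
  have "(xy_monom a)\<^sup>2 * (1 - (coord u)\<^sup>2) \<in> QM s g k"
    using unit.prems assms(2) by (intro QM_unit) (auto simp: xy_deg_monom xy_exp_deg_add)
  moreover have "1 - xy_monom (a + a) \<in> QM s g k"
    using unit by (simp add: xy_exp_deg_add)
  ultimately have "(1 - xy_monom (a + a)) + (xy_monom a)\<^sup>2 * (1 - (coord u)\<^sup>2) \<in> QM s g k"
    by (intro QM_add)
  moreover have "(1 - xy_monom (a + a)) + (xy_monom a)\<^sup>2 * (1 - (coord u)\<^sup>2) =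
      1 - xy_monom ((a + unit_exp u) + (a + unit_exp u))"
    by (simp add: xy_monom_power2 right_diff_distrib monom_mult add_ac)
  ultimately show ?case by simp
qed

text \<open>The exponent splits as \<open>c = a + b\<close> with both degrees at most
  \<open>k\<close>. The square of \<open>m_a + m_b\<close> or of \<open>m_a - m_b\<close>, plus
  \<open>1 - m_a^2\<close> and \<open>1 - m_b^2\<close>, is then twice the polynomial in
  question.\<close>

lemma QM_one_pm:
  assumes "xy_exp_deg c \<le> 2 * k" "1 \<le> k"
  shows "1 + xy_monom c \<in> QM s g k" "1 - xy_monom c \<in> QM s g k"
proof -
  obtain a b where c: "c = a + b" and deg: "xy_exp_deg a \<le> k" "xy_exp_deg b \<le> k"
  proof (cases "k \<le> xy_exp_deg c")
    case True
    from exp_split[OF this] obtain a b where "c = a + b" "xy_exp_deg a = k" by blast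
    then show ?thesis using that[of a b] assms(1) by (simp add: xy_exp_deg_add)
  next
    case False
    then show ?thesis using that[of c 0] by simp
  qed
  have A: "(1 - xy_monom (a + a)) + (1 - xy_monom (b + b)) \<in> QM s g k"
    using deg assms(2) by (intro QM_add QM_one_minus_even)
  have sq: "(xy_monom a + xy_monom b)\<^sup>2 \<in> QM s g k" "(xy_monom a - xy_monom b)\<^sup>2 \<in> QM s g k"
    using deg by (auto intro!: QM_sos sos_square xy_deg_add xy_deg_diff simp: xy_deg_monom)
  have "(xy_monom a + xy_monom b)\<^sup>2 + ((1 - xy_monom (a + a)) + (1 - xy_monom (b + b))) =
      (1 + xy_monom c) + (1 + xy_monom c)"
    "(xy_monom a - xy_monom b)\<^sup>2 + ((1 - xy_monom (a + a)) + (1 - xy_monom (b + b))) =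
      (1 - xy_monom c) + (1 - xy_monom c)"
    by (simp_all add: c power2_eq_square monom_mult[symmetric] algebra_simps)
  then have "(1 + xy_monom c) + (1 + xy_monom c) \<in> QM s g k" "(1 - xy_monom c) + (1 - xy_monom c) \<in> QM s g k"
    using QM_add[OF sq(1) A] QM_add[OF sq(2) A] by metis+
  from QM_scale[OF this(1), of "1/2"] QM_scale[OF this(2), of "1/2"]
  show "1 + xy_monom c \<in> QM s g k" "1 - xy_monom c \<in> QM s g k"
    by (simp_all only: scaleR_half_double)
qed

lemma positive_functional_bound:
  fixes N :: "('n::finite, 'm::finite) xy_poly \<Rightarrow> real"
  assumes "linear N" "\<And>h. h \<in> QM s g k \<Longrightarrow> 0 \<le> N h" "xy_exp_deg c \<le> 2 * k" "1 \<le> k"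
  shows "\<bar>N (xy_monom c)\<bar> \<le> N 1"
  using assms(2)[OF QM_one_pm(1)[OF assms(3,4)]] assms(2)[OF QM_one_pm(2)[OF assms(3,4)]]
  unfolding linear_add[OF assms(1)] linear_diff[OF assms(1)] by linarith

definition norm1 :: "('n::finite, 'm::finite) xy_poly \<Rightarrow> real" where
  "norm1 h = (\<Sum>a\<in>Poly_Mapping.keys h. \<bar>Poly_Mapping.lookup h a\<bar>)"

lemma linear_norm1_bound:
  assumes "linear N" "\<And>a. a \<in> Poly_Mapping.keys h \<Longrightarrow> \<bar>N (xy_monom a)\<bar> \<le> C"
  shows "\<bar>N h\<bar> \<le> C * norm1 h"
proof -
  have "N h = (\<Sum>a\<in>Poly_Mapping.keys h. Poly_Mapping.lookup h a * N (xy_monom a))"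
    using riesz_eq_linear[OF assms(1), of h "\<lambda>a. N (xy_monom a)"] by (simp add: riesz_def)
  also have "\<bar>\<dots>\<bar> \<le> (\<Sum>a\<in>Poly_Mapping.keys h. \<bar>Poly_Mapping.lookup h a * N (xy_monom a)\<bar>)" by (rule sum_abs)
  also have "\<dots> \<le> (\<Sum>a\<in>Poly_Mapping.keys h. \<bar>Poly_Mapping.lookup h a\<bar> * C)"
    using assms(2) by (intro sum_mono) (simp add: abs_mult mult_left_mono)
  finally show ?thesis by (simp add: norm1_def sum_distrib_left mult.commute)
qed

text \<open>The difference is a sum over the terms \<open>r m\<close> of \<open>h\<close> of
  \<open>|r| - r m\<close>, each a nonnegative multiple of \<open>1 - m\<close> or
  \<open>1 + m\<close>.\<close>

lemma QM_order_unit: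
  assumes "xy_deg h \<le> 2 * k" "1 \<le> k"
  shows "norm1 h *\<^sub>R 1 - h \<in> QM s g k"
proof -
  have mono: "\<bar>r\<bar> *\<^sub>R 1 - r *\<^sub>R xy_monom a \<in> QM s g k" if "a \<in> Poly_Mapping.keys h" for a r
  proof -
    have "xy_exp_deg a \<le> 2 * k" using xy_deg_keys[OF that] assms(1) by simp
    note pm = QM_one_pm[OF this assms(2), of s g]
    show ?thesis
      using QM_scale[OF pm(1), of "- r"] QM_scale[OF pm(2), of r]
      by (cases "r \<ge> 0") (auto simp: scaleR_add_right scaleR_diff_right)
  qed
  have "(\<Sum>a\<in>A. \<bar>Poly_Mapping.lookup h a\<bar> *\<^sub>R 1 - Poly_Mapping.lookup h a *\<^sub>R xy_monom a) \<in> QM s g k"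
    if "finite A" "A \<subseteq> Poly_Mapping.keys h" for A
    using that by (induction A) (auto intro: QM_sos sos_0 QM_add mono)
  from this[of "Poly_Mapping.keys h"]
  show ?thesis
    using poly_sum_monoms[of h] by (simp add: norm1_def sum_subtractf scaleR_sum_left)
qed

section \<open>Putinar's Positivstellensatz\<close>

lemma ex_fits: "\<exists>k\<ge>k0. fits s g k"
proof (intro exI conjI)
  show "k0 \<le> k0 + (\<Sum>c\<in>cidx s. half_deg (constr s g c))" by simp
  have "half_deg (constr s g c) \<le> (\<Sum>c\<in>cidx s. half_deg (constr s g c))" if "c \<in> cidx s" for c
    using member_le_sum[OF that, of "\<lambda>c. half_deg (constr s g c)"] by simp
  then show "fits s g (k0 + (\<Sum>c\<in>cidx s. half_deg (constr s g c)))"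
    unfolding fits_def by (auto intro: trans_le_add2)
qed

text \<open>The quadratic module without degree bound; taking only orders that fit lets
  \<open>QM_mult_square\<close> apply to its members.\<close>

definition QMU :: "nat \<Rightarrow> (nat \<Rightarrow> ('n::finite, 'm::finite) xy_poly) \<Rightarrow> ('n, 'm) xy_poly set" where
  "QMU s g = (\<Union>k\<in>{k. fits s g k}. QM s g k)"

lemma QMU_I: "fits s g k \<Longrightarrow> h \<in> QM s g k \<Longrightarrow> h \<in> QMU s g"
  by (auto simp: QMU_def)

lemma QMU_add: "p \<in> QMU s g \<Longrightarrow> q \<in> QMU s g \<Longrightarrow> p + q \<in> QMU s g"
proof -
  assume "p \<in> QMU s g" "q \<in> QMU s g"
  then obtain k l where "fits s g k" "p \<in> QM s g k" "fits s g l" "q \<in> QM s g l" by (auto simp: QMU_def)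
  then have "fits s g (max k l)" "p \<in> QM s g (max k l)" "q \<in> QM s g (max k l)"
    using QM_mono[of k "max k l" s g] QM_mono[of l "max k l" s g] fits_mono[of s g k "max k l"] by auto
  then show ?thesis by (intro QMU_I QM_add)
qed

lemma QMU_scale: "p \<in> QMU s g \<Longrightarrow> 0 \<le> r \<Longrightarrow> r *\<^sub>R p \<in> QMU s g"
  by (auto simp: QMU_def intro: QM_scale)

lemma QMU_mult_square: "p \<in> QMU s g \<Longrightarrow> q\<^sup>2 * p \<in> QMU s g"
proof -
  assume "p \<in> QMU s g"
  then obtain k where "fits s g k" "p \<in> QM s g k" by (auto simp: QMU_def)
  then show ?thesis using QM_mult_square[of s g k p q "xy_deg q"] fits_mono[of s g k "k + xy_deg q"]
    by (auto intro: QMU_I)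
qed

lemma prod_axis_1: "(\<Prod>i'\<in>UNIV. x $ i' ^ (axis i 1 :: nat ^ 'k) $ i') = x $ i"
  for x :: "real ^ 'k"
proof -
  have "(\<Prod>i'\<in>UNIV. x $ i' ^ (axis i 1 :: nat ^ 'k) $ i') = (\<Prod>i'\<in>UNIV. if i' = i then x $ i else 1)"
    by (intro prod.cong) (auto simp: axis_def)
  then show ?thesis by simp
qed

lemma QMU_functional_bound:
  fixes N :: "('n::finite, 'm::finite) xy_poly \<Rightarrow> real"
  assumes "linear N" "\<And>h. h \<in> QMU s g \<Longrightarrow> 0 \<le> N h"
  shows "\<bar>N (xy_monom a)\<bar> \<le> N 1"
proof -
  obtain k where k: "xy_exp_deg a \<le> k" "fits s g k" using ex_fits by blast
  show ?thesis
    by (rule positive_functional_bound[OF assms(1), of s g k])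
      (use k assms(2) QMU_I[OF k(2)] fits_ge_1[OF k(2)] in auto)
qed

text \<open>The increments do not decrease, so a positive first one would force linear
  growth.\<close>

lemma convex_bounded_imp_le:
  fixes b :: "nat \<Rightarrow> real"
  assumes "\<And>j. 0 \<le> b j - 2 * b (Suc j) + b (Suc (Suc j))" "\<And>j. b j \<le> B"
  shows "b 1 \<le> b 0"
proof (rule ccontr)
  assume "\<not> b 1 \<le> b 0"
  then have pos: "0 < b 1 - b 0" by simp
  have inc: "b 1 - b 0 \<le> b (Suc j) - b j" for j
  proof (induction j)
    case (Suc j)
    then show ?case using assms(1)[of j] by simp
  qed simp
  have "b 0 + real j * (b 1 - b 0) \<le> b j" for j
  proof (induction j)
    case (Suc j)
    then show ?case using inc[of j] by (simp add: algebra_simps)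
  qed simp
  moreover obtain j where "B - b 0 < real j * (b 1 - b 0)"
    using pos reals_Archimedean3 by blast
  ultimately show False using assms(2)[of j] by (smt (verit))
qed

lemma coord_power: "\<exists>e. coord u ^ n = xy_monom e"
proof (induction n)
  case 0
  then show ?case by (intro exI[of _ 0]) simp
next
  case (Suc n)
  then show ?case by (metis monom_mult power_Suc)
qed

text \<open>
  The sequence \<open>j \<mapsto> N (X\<^bsup>2j\<^esup> m)\<close> is convex because \<open>(X\<^bsup>j\<^esup> (1 - X\<^sup>2))\<^sup>2 m\<close> lies in the
  quadratic module, and bounded because monomials are; hence it cannot increase.
\<close>

lemma localized_nonneg:
  fixes N :: "('n::finite, 'm::finite) xy_poly \<Rightarrow> real"
  assumes N: "linear N" "\<And>h. h \<in> QMU s g \<Longrightarrow> 0 \<le> N h" and m: "m \<in> QMU s g"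
  shows "0 \<le> N ((1 - (coord u)\<^sup>2) * m)"
proof -
  let ?X = "coord u :: ('n, 'm) xy_poly"
  define b where "b j = N (?X ^ (2 * j) * m)" for j
  have "0 \<le> b j - 2 * b (Suc j) + b (Suc (Suc j))" for j
  proof -
    have even: "?X ^ (2 * j) = ?X ^ j * ?X ^ j" "?X ^ (2 * Suc j) = ?X * ?X * (?X ^ j * ?X ^ j)"
      "?X ^ (2 * Suc (Suc j)) = ?X * ?X * ?X * ?X * (?X ^ j * ?X ^ j)"
      by (simp_all add: mult_2 power_add mult.assoc mult.left_commute)
    have "(?X ^ j * (1 - ?X\<^sup>2))\<^sup>2 * m =
      ?X ^ (2 * j) * m - 2 *\<^sub>R (?X ^ (2 * Suc j) * m) + ?X ^ (2 * Suc (Suc j)) * m"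
      unfolding even by (simp add: power2_eq_square algebra_simps scaleR_2)
    moreover have "0 \<le> N ((?X ^ j * (1 - ?X\<^sup>2))\<^sup>2 * m)"
      by (intro N(2) QMU_mult_square m)
    ultimately show ?thesis
      by (simp only: linear_add[OF N(1)] linear_diff[OF N(1)] linear_scale[OF N(1)] b_def real_scaleR_def)
  qed
  \<comment> \<open>Multiplying by a monomial sends monomials to monomials, so the bound through
    \<open>norm1 m\<close> is the same for every \<open>j\<close>.\<close>
  moreover have "b j \<le> N 1 * norm1 m" for j
  proof -
    obtain e where e: "?X ^ (2 * j) = xy_monom e" using coord_power by blast
    have "linear (\<lambda>q. N (xy_monom e * q))"
      using linear_compose[OF linear_mult_left N(1)] by (simp add: o_def)
    from linear_norm1_bound[OF this, of m "N 1"] show ?thesis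
      using QMU_functional_bound[OF N] by (simp add: b_def e monom_mult abs_le_iff)
  qed
  ultimately have "b 1 \<le> b 0" by (rule convex_bounded_imp_le)
  then show ?thesis by (simp add: b_def left_diff_distrib linear_diff[OF N(1)])
qed

text \<open>
  Splitting \<open>L\<close> into \<open>L (\<cdot> (1 + X)/2)\<close> and \<open>L (\<cdot> (1 - X)/2)\<close>, both positive, extremality makes the
  parts proportional to \<open>L\<close>.
\<close>

lemma extreme_state_multiplicative:
  fixes L :: "('n::finite, 'm::finite) xy_poly \<Rightarrow> real"
  assumes L: "linear L" "\<And>h. h \<in> QMU s g \<Longrightarrow> 0 \<le> L h" "L 1 = 1"
    and ext: "\<And>N N' t. \<lbrakk>linear N; linear N'; \<And>c. c \<in> QMU s g \<Longrightarrow> 0 \<le> N c;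
      \<And>c. c \<in> QMU s g \<Longrightarrow> 0 \<le> N' c; N 1 = 1; N' 1 = 1; 0 < t; t < 1;
      \<And>h. L h = t * N h + (1 - t) * N' h\<rbrakk> \<Longrightarrow> N = L"
  shows "L (coord u * q) = L (coord u) * L q"
proof -
  let ?X = "coord u :: ('n, 'm) xy_poly"
  define P where "P q = (L q + L (?X * q)) / 2" for q
  define M where "M q = (L q - L (?X * q)) / 2" for q
  have lX: "linear (\<lambda>q. L (?X * q))"
    using linear_compose[OF linear_mult_left L(1)] by (simp add: o_def)
  have lP: "linear P" and lM: "linear M" unfolding P_def M_def
    by (auto intro!: linearI simp: linear_add[OF L(1)] linear_add[OF lX] linear_scale[OF L(1)]
        linear_scale[OF lX] algebra_simps add_divide_distrib diff_divide_distrib)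
  have posP: "0 \<le> P m" and posM: "0 \<le> M m" if m: "m \<in> QMU s g" for m
  proof -
    \<comment> \<open>From \<open>2 (1 + X) = (1 + X)^2 + (1 - X^2)\<close> and its analogue for
      \<open>- X\<close>.\<close>
    have "2 *\<^sub>R (m + ?X * m) = (1 + ?X)\<^sup>2 * m + (1 - ?X\<^sup>2) * m"
      "2 *\<^sub>R (m - ?X * m) = (1 - ?X)\<^sup>2 * m + (1 - ?X\<^sup>2) * m"
      by (simp_all add: power2_eq_square algebra_simps scaleR_2)
    then have "L (2 *\<^sub>R (m + ?X * m)) = L ((1 + ?X)\<^sup>2 * m) + L ((1 - ?X\<^sup>2) * m)"
      "L (2 *\<^sub>R (m - ?X * m)) = L ((1 - ?X)\<^sup>2 * m) + L ((1 - ?X\<^sup>2) * m)"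
      by (simp_all only: linear_add[OF L(1)])
    moreover have "0 \<le> L ((1 + ?X)\<^sup>2 * m)" "0 \<le> L ((1 - ?X)\<^sup>2 * m)"
      by (intro L(2) QMU_mult_square m)+
    ultimately show "0 \<le> P m" "0 \<le> M m"
      using localized_nonneg[OF L(1,2) m, of u]
      by (simp_all add: P_def M_def linear_scale[OF L(1)] linear_add[OF L(1)] linear_diff[OF L(1)])
  qed
  \<comment> \<open>A positive functional with mass 0 is 0; this covers \<open>t = 0\<close> and
    \<open>t = 1\<close>, where one part cannot be normalized.\<close>
  have vanish: "N q = 0" if "linear N" "\<And>c. c \<in> QMU s g \<Longrightarrow> 0 \<le> N c" "N 1 = 0"
    for N :: "('n, 'm) xy_poly \<Rightarrow> real"
    using linear_norm1_bound[OF that(1), of q 0] QMU_functional_bound[OF that(1,2)] that(3) by simp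
  define t where "t = P 1"
  have t1: "M 1 = 1 - t" by (simp add: t_def P_def M_def L(3) field_simps)
  have tX: "L ?X = 2 * t - 1" by (simp add: t_def P_def L(3) field_simps)
  have one: "1 \<in> QMU s g"
    using ex_fits[of 0 s g] QM_sos[OF sos_square[of 1]] by (auto intro: QMU_I)
  have "P q = t * L q"
  proof (cases "t = 0 \<or> t = 1")
    case True
    then show ?thesis
    proof
      assume "t = 0"
      then show ?thesis using vanish[OF lP posP] by (simp add: t_def)
    next
      assume "t = 1"
      then have "M q = 0" using vanish[OF lM posM] t1 by simp
      then show ?thesis using \<open>t = 1\<close> by (simp add: P_def M_def)
    qed
  next
    case False
    have t: "0 < t" "t < 1" using posP[OF one] posM[OF one] t1 False by (auto simp: t_def)
    have "(\<lambda>q. (1 / t) * P q) = L"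
    proof (rule ext[of "\<lambda>q. (1 / t) * P q" "\<lambda>q. (1 / (1 - t)) * M q" t])
      show "linear (\<lambda>q. (1 / t) * P q)" "linear (\<lambda>q. (1 / (1 - t)) * M q)"
        using linear_compose[OF lP linear_mult_left] linear_compose[OF lM linear_mult_left]
        by (simp_all only: o_def)
      show "L h = t * (1 / t * P h) + (1 - t) * (1 / (1 - t) * M h)" for h
      proof -
        have "t * (1 / t * P h) = P h" "(1 - t) * (1 / (1 - t) * M h) = M h" using t by simp_all
        moreover have "P h + M h = L h" by (simp add: P_def M_def field_simps)
        ultimately show ?thesis by presburger
      qed
    qed (use t t1 posP posM in \<open>auto simp: t_def\<close>)
    from fun_cong[OF this, of q] show ?thesis using t by (simp add: field_simps)
  qed
  \<comment> \<open>\<open>L (X q) = 2 P q - L q = (2 t - 1) L q\<close>, and \<open>2 t - 1\<close>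
    is \<open>L X\<close>.\<close>
  then show ?thesis by (simp add: P_def tX algebra_simps)
qed

theorem putinar:
  fixes h :: "('n::finite, 'm::finite) xy_poly"
  assumes K: "(x0, y0) \<in> setK s g" and h: "\<And>x y. (x, y) \<in> setK s g \<Longrightarrow> 0 < xy_eval h x y"
  shows "h \<in> QMU s g"
proof (rule ccontr)
  assume hn: "h \<notin> QMU s g"
  \<comment> \<open>Tilting first at \<open>- h\<close> makes \<open>L h\<close> as small as
    possible.\<close>
  define v where "v = case_nat (- h) (\<lambda>n. xy_monom (from_nat n))"
  have span: "span (range v) = UNIV" unfolding v_def by (rule span_case_nat_monoms)
  \<comment> \<open>Prescribing \<open>L\<close> on the constants only normalizes it. Evaluation at
    the given point shows that no negative constant lies in \<open>QMU s g\<close>.\<close>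
  let ?S = "range (\<lambda>c. c *\<^sub>R (1 :: ('n, 'm) xy_poly))"
  let ?\<phi> = "\<lambda>q. xy_eval q x0 y0"
  have pos: "0 \<le> ?\<phi> p" if "p \<in> QMU s g" for p
    using that K QM_eval_nonneg by (auto simp: QMU_def)
  have S: "subspace ?S"
    unfolding subspace_def
    by (auto simp: image_iff scaleR_add_left[symmetric])
  have cof: "\<exists>p\<in>?S. p - q \<in> QMU s g" for q
  proof -
    obtain k where "xy_deg q \<le> k" "fits s g k" using ex_fits by blast
    then have "norm1 q *\<^sub>R 1 - q \<in> QMU s g" using QM_order_unit[of q k s g] fits_ge_1[of s g k] by (auto intro: QMU_I)
    then show ?thesis by blast
  qed
  obtain L where L: "linear L" "\<And>c. c \<in> QMU s g \<Longrightarrow> 0 \<le> L c" "\<And>p. p \<in> ?S \<Longrightarrow> L p = ?\<phi> p"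
    and near: "\<And>e. 0 < e \<Longrightarrow> \<exists>p\<in>?S. p - v 0 \<in> QMU s g \<and> ?\<phi> p < L (v 0) + e"
    and ext: "\<forall>N N' t. linear N \<and> linear N' \<and> (\<forall>c\<in>QMU s g. 0 \<le> N c \<and> 0 \<le> N' c) \<and>
        (\<forall>p\<in>?S. N p = ?\<phi> p \<and> N' p = ?\<phi> p) \<and> 0 < t \<and> t < 1 \<and> (\<forall>h. L h = t * N h + (1 - t) * N' h) \<longrightarrow> N = L"
    using riesz_extension[of "QMU s g" ?S ?\<phi> v, OF QMU_add QMU_scale S linear_xy_eval pos cof span] by blast
  have onS: "N p = ?\<phi> p" if "linear N" "N 1 = 1" "p \<in> ?S" for N p
    using that by (auto simp: linear_scale xy_eval_scaleR xy_eval_one)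
  have L1: "L 1 = 1" using L(3)[OF range_eqI[of 1 _ 1]] by (simp add: xy_eval_one)
  have mult: "L (coord u * q) = L (coord u) * L q" for u q
  proof (rule extreme_state_multiplicative[OF L(1,2) L1])
    fix N N' and t :: real
    assume N: "linear N" "linear N'" "\<And>c. c \<in> QMU s g \<Longrightarrow> 0 \<le> N c" "\<And>c. c \<in> QMU s g \<Longrightarrow> 0 \<le> N' c"
      "N 1 = 1" "N' 1 = 1" "0 < t" "t < 1" "\<And>h. L h = t * N h + (1 - t) * N' h"
    then show "N = L"
      using onS[OF N(1,5)] onS[OF N(2,6)] by (intro ext[rule_format, of N N' t] conjI ballI allI) auto
  qed
  have Lh: "L h \<le> 0"
  proof (rule ccontr)
    assume "\<not> L h \<le> 0"
    then obtain c where c: "c *\<^sub>R 1 + h \<in> QMU s g" "c < - L h + L h"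
      using near[of "L h"] by (auto simp: v_def linear_neg[OF L(1)] xy_eval_scaleR xy_eval_one)
    have "(- c) *\<^sub>R 1 \<in> QMU s g"
      using ex_fits[of 0 s g] QM_sos[OF sos_square[of 1]] c(2) by (auto intro!: QMU_I QMU_scale simp del: scaleR_minus_left)
    from QMU_add[OF c(1) this] hn show False by simp
  qed
  \<comment> \<open>A multiplicative \<open>L\<close> must be evaluation at the point whose
    coordinates are its values at the variables.\<close>
  define x where "x = (\<chi> i. L (coord (Inl i)))"
  define y where "y = (\<chi> j. L (coord (Inr j)))"
  have coord_eval: "xy_eval (coord u) x y = L (coord u)" for u :: "'n + 'm"
    by (cases u) (simp_all add: xy_eval_monom prod_axis_1[simplified], simp_all add: x_def y_def)
  have "L (xy_monom a) = xy_eval (xy_monom a) x y" for a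
  proof (induction a rule: exp_induct)
    case zero
    then show ?case by (simp add: L1 xy_eval_one)
  next
    case (unit a u)
    have "xy_monom (a + unit_exp u) = coord u * xy_monom a" by (simp add: monom_mult add.commute)
    then show ?case by (simp only: mult unit xy_eval_mult coord_eval)
  qed
  then have L_eval: "L q = xy_eval q x y" for q
    using linear_eq_monom[OF L(1) linear_xy_eval] by blast
  have "(x, y) \<in> setK s g"
    unfolding setK_iff
  proof
    fix c :: "nat + 'n" assume c: "c \<in> cidx s"
    obtain k where k: "fits s g k" using ex_fits by blast
    \<comment> \<open>Each constraint is a generator with multiplier \<open>1 = 1^2\<close>, so
      positivity of \<open>L\<close> puts the point in \<open>setK s g\<close>.\<close>
    have "1 * constr s g c \<in> QM s g k"
      using sos_square[of 1] by (intro QM_gen c) simp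
    then show "0 \<le> xy_eval (constr s g c) x y" using L(2)[OF QMU_I[OF k]] L_eval by simp
  qed
  then show False using h[of x y] Lh by (simp add: L_eval)
qed

section \<open>The reference measure and polynomials in \<open>x\<close> alone\<close>

lemma box_B_eq: "box_B = cbox (\<chi> i. -1) (\<chi> i. 1)"
  by (auto simp: box_B_def mem_box_cart)

lemma compact_box_B: "compact box_B"
  by (simp add: box_B_eq)

lemma box_B_sets [measurable, simp]: "box_B \<in> sets borel"
  by (simp add: box_B_eq)

lemma vol_pos: "0 < measure lborel (box_B :: (real ^ 'n) set)"
  unfolding box_B_eq by (subst content_pos_lt_eq) (auto simp: Basis_vec_def inner_axis)

lemma emeasure_box_B: "emeasure lborel (box_B :: (real ^ 'n) set) = ennreal (measure lborel (box_B :: (real ^ 'n) set))"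
  by (rule emeasure_eq_ennreal_measure) (simp add: box_B_eq emeasure_lborel_cbox_eq)

lemma lam_density:
  "(lam :: (real ^ 'n) measure) = density lborel (\<lambda>x. ennreal (indicator box_B x / measure lborel (box_B :: (real ^ 'n) set)))"
  unfolding lam_def uniform_measure_def
  by (intro arg_cong[where f = "density lborel"] ext)
    (auto simp: emeasure_box_B indicator_def divide_ennreal[OF zero_le_one vol_pos] simp flip: ennreal_1)

lemma set_integrable_box_B: "continuous_on box_B h \<Longrightarrow> set_integrable lborel box_B h"
  for h :: "real ^ 'n \<Rightarrow> real"
  unfolding set_integrable_def by (rule borel_integrable_compact[OF compact_box_B])

lemma integral_lam:
  fixes h :: "real ^ 'n \<Rightarrow> real"
  assumes "h \<in> borel_measurable borel"
  shows "(LINT x|lam. h x) = (LINT x:box_B|lborel. h x) / measure lborel (box_B :: (real ^ 'n) set)"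
proof -
  have "(LINT x|lam. h x) = (LINT x|lborel. (indicator box_B x / measure lborel (box_B :: (real ^ 'n) set)) *\<^sub>R h x)"
    unfolding lam_density using assms by (intro integral_density) auto
  also have "\<dots> = (LINT x|lborel. (indicator box_B x *\<^sub>R h x) / measure lborel (box_B :: (real ^ 'n) set))"
    by (intro Bochner_Integration.integral_cong) auto
  finally show ?thesis by (simp add: set_lebesgue_integral_def)
qed

text \<open>Setting y to 0 makes this linear on all polynomials, as \<open>riesz_extension\<close>
  requires; on those in x alone the choice of y has no effect.\<close>

definition mean :: "('n::finite, 'm::finite) xy_poly \<Rightarrow> real" where
  "mean q = (LINT x|lam. xy_eval q x 0)"

lemma continuous_on_xy_eval_fst: "continuous_on S (\<lambda>x. xy_eval q x y)"
  by (intro continuous_intros)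

lemma borel_xy_eval: "(\<lambda>x. xy_eval q x y) \<in> borel_measurable borel"
  by (intro borel_measurable_continuous_onI continuous_on_xy_eval_fst)

lemma mean_eq: "mean q = (LINT x:box_B|lborel. xy_eval q x 0) / measure lborel (box_B :: (real ^ 'n) set)"
  for q :: "('n::finite, 'm::finite) xy_poly"
  unfolding mean_def by (rule integral_lam[OF borel_xy_eval])

lemma linear_mean: "linear mean"
proof (rule linearI)
  fix p q :: "('n::finite, 'm::finite) xy_poly" and c :: real
  note int = set_integrable_box_B[OF continuous_on_xy_eval_fst[of box_B _ 0]]
  show "mean (p + q) = mean p + mean q"
    using set_integral_add(2)[OF int[of p] int[of q]] by (simp add: mean_eq xy_eval_add add_divide_distrib)
  show "mean (c *\<^sub>R p) = c *\<^sub>R mean p"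
    by (simp add: mean_eq xy_eval_scaleR)
qed

lemma gam_eq: "gam \<alpha> = mean (xy_monom (\<alpha>, 0))"
  by (simp add: gam_def mean_def xy_eval_monom)

definition xonly :: "('n::finite, 'm::finite) xy_poly \<Rightarrow> bool" where
  "xonly h \<longleftrightarrow> (\<forall>a\<in>Poly_Mapping.keys h. snd a = 0)"

lemma lookup_x_to_xy: "Poly_Mapping.lookup (x_to_xy p) (a, b) = (if b = 0 then Poly_Mapping.lookup p a else 0)"
proof -
  have "Poly_Mapping.lookup (x_to_xy p) (a, b) =
      (\<Sum>\<alpha>\<in>Poly_Mapping.keys p. if \<alpha> = a then (if b = 0 then Poly_Mapping.lookup p a else 0) else 0)"
    unfolding x_to_xy_def lookup_sum by (intro sum.cong) (auto simp: lookup_single when_def)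
  then show ?thesis by (simp add: in_keys_iff)
qed

lemma keys_x_to_xy: "Poly_Mapping.keys (x_to_xy p) = (\<lambda>\<alpha>. (\<alpha>, 0)) ` Poly_Mapping.keys p"
  by (auto simp: in_keys_iff lookup_x_to_xy image_iff split: if_splits)

lemma xonly_x_to_xy: "xonly (x_to_xy p)"
  by (auto simp: xonly_def keys_x_to_xy)

lemma xonly_imp_x_to_xy:
  assumes "xonly h"
  obtains p where "h = x_to_xy p"
proof
  have fin: "finite {\<alpha>. Poly_Mapping.lookup h (\<alpha>, 0) \<noteq> 0}"
    by (rule finite_subset[OF _ finite_imageI[OF finite_keys[of h], of fst]]) (force simp: in_keys_iff)
  show "h = x_to_xy (Abs_poly_mapping (\<lambda>\<alpha>. Poly_Mapping.lookup h (\<alpha>, 0)))"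
  proof (rule poly_mapping_eqI)
    fix a
    show "Poly_Mapping.lookup h a = Poly_Mapping.lookup (x_to_xy (Abs_poly_mapping (\<lambda>\<alpha>. Poly_Mapping.lookup h (\<alpha>, 0)))) a"
    proof (cases "snd a = 0")
      case True
      then show ?thesis using fin by (cases a) (simp add: lookup_x_to_xy)
    next
      case False
      then have "a \<notin> Poly_Mapping.keys h" using assms by (auto simp: xonly_def)
      then show ?thesis using False by (cases a) (simp add: lookup_x_to_xy in_keys_iff)
    qed
  qed
qed

lemma xy_eval_x_to_xy: "xy_eval (x_to_xy p) x y = x_eval p x"
  by (simp add: xy_eval_def x_eval_def keys_x_to_xy sum.reindex inj_on_def lookup_x_to_xy)

lemma xonly_eval: "xonly h \<Longrightarrow> xy_eval h x y = xy_eval h x y'"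
  unfolding xy_eval_def xonly_def by (intro sum.cong) auto

lemma xy_exp_deg_x: "xy_exp_deg (\<alpha>, 0) = x_exp_deg \<alpha>"
  by (simp add: xy_exp_deg_def x_exp_deg_def)

lemma xy_deg_x_to_xy: "xy_deg (x_to_xy p) = x_deg p"
  by (simp add: xy_deg_def x_deg_def keys_x_to_xy image_image xy_exp_deg_x)

lemma primal_cost_eq: "primal_cost p = mean (x_to_xy p :: ('n::finite, 'm::finite) xy_poly)"
  by (simp add: primal_cost_def mean_def xy_eval_x_to_xy)

lemma xonly_add: "xonly p \<Longrightarrow> xonly q \<Longrightarrow> xonly (p + q)"
  using Poly_Mapping.keys_add[of p q] by (auto simp: xonly_def)

lemma xonly_scaleR: "xonly p \<Longrightarrow> xonly (c *\<^sub>R p)"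
  by (auto simp: xonly_def in_keys_iff)

lemma mean_nonneg:
  assumes "\<And>x. x \<in> box_B \<Longrightarrow> 0 \<le> xy_eval q x 0"
  shows "0 \<le> mean q"
  unfolding mean_eq set_lebesgue_integral_def
  using assms by (intro divide_nonneg_nonneg Bochner_Integration.integral_nonneg) (auto simp: indicator_def)


section \<open>Duality\<close>

text \<open>Turns feasibility into membership in a cone, the form that the extension theorem works
  with.\<close>

lemma primal_feasible_iff:
  "(\<exists>\<sigma> \<psi>. primal_feasible s g f k p \<sigma> \<psi>) \<longleftrightarrow> x_deg p \<le> 2 * k \<and> x_to_xy p - f \<in> QM s g k"
proof -
  have sum: "(\<Sum>c\<in>cidx s. \<tau> c * constr s g c) =
      (\<Sum>j=0..s + 1. \<tau> (Inl j) * gfam s g j) + (\<Sum>i\<in>UNIV. \<tau> (Inr i) * theta i)" for \<tau>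
    unfolding cidx_def by (subst sum.Plus) (auto simp: constr_def)
  show ?thesis
  proof
    assume "\<exists>\<sigma> \<psi>. primal_feasible s g f k p \<sigma> \<psi>"
    then obtain \<sigma> \<psi> where feas: "primal_feasible s g f k p \<sigma> \<psi>" by blast
    let ?\<tau> = "case_sum \<sigma> \<psi>"
    have "\<forall>c\<in>cidx s. ?\<tau> c \<in> sos (k - half_deg (constr s g c))"
      unfolding ball_cidx using feas by (simp add: primal_feasible_def constr_def)
    then have "(\<Sum>c\<in>cidx s. ?\<tau> c * constr s g c) \<in> QM s g k" by (intro QM_I) auto
    then show "x_deg p \<le> 2 * k \<and> x_to_xy p - f \<in> QM s g k"
      using feas unfolding sum by (simp add: primal_feasible_def)
  next
    assume R: "x_deg p \<le> 2 * k \<and> x_to_xy p - f \<in> QM s g k"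
    then obtain \<tau> where \<tau>: "x_to_xy p - f = (\<Sum>c\<in>cidx s. \<tau> c * constr s g c)"
      "\<forall>c\<in>cidx s. \<tau> c \<in> sos (k - half_deg (constr s g c))" by (auto elim!: QM_E)
    then have "primal_feasible s g f k p (\<tau> \<circ> Inl) (\<tau> \<circ> Inr)"
      using R unfolding primal_feasible_def ball_cidx sum by (simp add: constr_def)
    then show "\<exists>\<sigma> \<psi>. primal_feasible s g f k p \<sigma> \<psi>" by blast
  qed
qed

lemma dual_feasible_iff:
  "dual_feasible s g k z \<longleftrightarrow> z \<in> exps (2 * k) \<rightarrow>\<^sub>E UNIV \<and>
    (\<forall>c\<in>cidx s. \<forall>q. xy_deg q \<le> k - half_deg (constr s g c) \<longrightarrow> 0 \<le> riesz z (constr s g c * q\<^sup>2)) \<and>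
    (\<forall>\<alpha>. x_exp_deg \<alpha> \<le> 2 * k \<longrightarrow> z (\<alpha>, 0) = gam \<alpha>)"
  unfolding dual_feasible_def psd_loc_matrix_iff ball_cidx by (simp add: constr_def)

lemma weak_duality:
  fixes f :: "('n::finite, 'm::finite) xy_poly"
  assumes z: "dual_feasible s g k z" and p: "primal_feasible s g f k p \<sigma> \<psi>"
  shows "riesz z f \<le> primal_cost p"
proof -
  have deg: "x_deg p \<le> 2 * k" and "x_to_xy p - f \<in> QM s g k" using primal_feasible_iff p by blast+
  then obtain \<tau> where \<tau>: "x_to_xy p - f = (\<Sum>c\<in>cidx s. \<tau> c * constr s g c)"
    "\<And>c. c \<in> cidx s \<Longrightarrow> \<tau> c \<in> sos (k - half_deg (constr s g c))" by (auto elim!: QM_E)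
  have "0 \<le> riesz z (\<tau> c * constr s g c)" if c: "c \<in> cidx s" for c
  proof -
    \<comment> \<open>Dual feasibility speaks of single squares of bounded degree, so the multiplier
      is split into such squares.\<close>
    obtain P where P: "\<And>r. r \<in> (exps (k - half_deg (constr s g c)) :: ('n, 'm) xy_exp set) \<Longrightarrow> xy_deg (P r) \<le> k - half_deg (constr s g c)"
      "\<tau> c = (\<Sum>r\<in>(exps (k - half_deg (constr s g c)) :: ('n, 'm) xy_exp set). (P r)\<^sup>2)"
      using sos_bounded_length[OF \<tau>(2)[OF c]] by blast
    have "riesz z (\<tau> c * constr s g c) = (\<Sum>r\<in>(exps (k - half_deg (constr s g c)) :: ('n, 'm) xy_exp set). riesz z (constr s g c * (P r)\<^sup>2))"
      by (simp add: P(2) sum_distrib_left linear_sum[OF linear_riesz] mult.commute[of _ "constr s g c"])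
    also have "0 \<le> \<dots>" using z c P(1) unfolding dual_feasible_iff by (intro sum_nonneg) blast
    finally show ?thesis .
  qed
  then have "0 \<le> riesz z (x_to_xy p - f)"
    unfolding \<tau>(1) by (simp add: linear_sum[OF linear_riesz] sum_nonneg)
  \<comment> \<open>The moment conditions up to degree \<open>2 * k\<close> determine
    \<open>riesz z\<close> on \<open>p\<close>.\<close>
  moreover have "riesz z (x_to_xy p) = mean (x_to_xy p :: ('n, 'm) xy_poly)"
  proof (rule riesz_eq_linear[OF linear_mean])
    fix a assume a: "a \<in> Poly_Mapping.keys (x_to_xy p :: ('n, 'm) xy_poly)"
    then obtain \<alpha> where \<alpha>: "a = (\<alpha>, 0)" by (auto simp: keys_x_to_xy)
    have "x_exp_deg \<alpha> \<le> 2 * k"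
      using xy_deg_keys[OF a] deg by (simp add: xy_deg_x_to_xy \<alpha> xy_exp_deg_x)
    then show "z a = mean (xy_monom a)" using z by (simp add: \<alpha> dual_feasible_iff gam_eq)
  qed
  ultimately show ?thesis by (simp add: linear_diff[OF linear_riesz] primal_cost_eq[where 'm = 'm])
qed

text \<open>A projection along which the module of order \<open>k\<close> is pulled back, since the
  extension theorem is applied on the space of all polynomials.\<close>

definition trunc :: "nat \<Rightarrow> ('n::finite, 'm::finite) xy_poly \<Rightarrow> ('n, 'm) xy_poly" where
  "trunc d h = (\<Sum>a\<in>exps d. Poly_Mapping.lookup h a *\<^sub>R xy_monom a)"

lemma linear_trunc: "linear (trunc d)"
  by (rule linearI) (simp_all add: trunc_def lookup_add scaleR_add_left sum.distrib scaleR_sum_right)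

lemma trunc_id: "xy_deg h \<le> d \<Longrightarrow> trunc d h = h"
  unfolding trunc_def by (rule poly_sum_monoms_superset[symmetric]) (auto simp: finite_exps xy_deg_le_iff)

lemma xy_deg_trunc: "xy_deg (trunc d h) \<le> d"
  unfolding trunc_def by (intro xy_deg_sum xy_deg_scaleR) (simp add: xy_deg_monom exps_def)

text \<open>With \<open>C\<close> the pulled back module, \<open>S\<close> the polynomials in x
  alone of degree at most \<open>2 * k\<close> and \<open>phi\<close> the mean, the infimum in
  \<open>riesz_extension\<close> at \<open>f\<close> is the primal value. Exactness at
  \<open>v 0 = f\<close> is the absence of a gap.\<close>

lemma strong_duality:
  fixes f :: "('n::finite, 'm::finite) xy_poly"
  assumes adm: "admissible s g f k" and fib: "\<forall>x\<in>box_B. fiberK s g x \<noteq> {}"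
  obtains z where "dual_feasible s g k z"
    "\<And>e. 0 < e \<Longrightarrow> \<exists>p \<sigma> \<psi>. primal_feasible s g f k p \<sigma> \<psi> \<and> primal_cost p < riesz z f + e"
proof -
  have fits: "fits s g k" and degf: "xy_deg f \<le> 2 * k" using adm by (auto simp: admissible_iff)
  define C where "C = {h. trunc (2 * k) h \<in> QM s g k}"
  define S where "S = {h :: ('n, 'm) xy_poly. xonly h \<and> xy_deg h \<le> 2 * k}"
  define v where "v = case_nat f (\<lambda>n. xy_monom (from_nat n))"
  have span: "span (range v) = UNIV" unfolding v_def by (rule span_case_nat_monoms)
  have C_add: "a + b \<in> C" if "a \<in> C" "b \<in> C" for a b
    using that by (simp add: C_def linear_add[OF linear_trunc] QM_add)
  have C_scale: "c *\<^sub>R a \<in> C" if "a \<in> C" "0 \<le> c" for a c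
    using that by (simp add: C_def linear_scale[OF linear_trunc] QM_scale)
  have C_QM: "h \<in> C \<longleftrightarrow> h \<in> QM s g k" if "xy_deg h \<le> 2 * k" for h
    using that by (simp add: C_def trunc_id)
  have S: "subspace S"
    unfolding subspace_def S_def by (auto intro: xonly_add xy_deg_add xonly_scaleR xy_deg_scaleR) (simp add: xonly_def)
  \<comment> \<open>Each \<open>x\<close> in the box has a point of \<open>setK s g\<close> above
    it, and \<open>p\<close> does not depend on y; so membership in the module makes
    \<open>p\<close> nonnegative on the whole box.\<close>
  have pos: "0 \<le> mean p" if p: "p \<in> S" "p \<in> C" for p
  proof (rule mean_nonneg)
    fix x :: "real ^ 'n" assume "x \<in> box_B"
    then obtain y where "(x, y) \<in> setK s g" using fib by (auto simp: fiberK_def)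
    then have "0 \<le> xy_eval p x y" using QM_eval_nonneg p C_QM[of p] by (auto simp: S_def)
    then show "0 \<le> xy_eval p x 0" using xonly_eval[of p x y 0] p(1) by (simp add: S_def)
  qed
  have cof: "\<exists>p\<in>S. p - h \<in> C" for h
  proof
    let ?p = "norm1 (trunc (2 * k) h) *\<^sub>R (1 :: ('n, 'm) xy_poly)"
    have deg: "xy_deg ?p \<le> 2 * k" by (intro xy_deg_scaleR) simp
    show "?p \<in> S" using deg by (auto simp: S_def xonly_def in_keys_iff lookup_one when_def zero_prod_def split: if_splits)
    show "?p - h \<in> C"
      using QM_order_unit[OF xy_deg_trunc fits_ge_1[OF fits], of h s g]
      by (simp add: C_def linear_diff[OF linear_trunc] trunc_id[OF deg])
  qed
  obtain L where L: "linear L" "\<And>c. c \<in> C \<Longrightarrow> 0 \<le> L c" "\<And>p. p \<in> S \<Longrightarrow> L p = mean p"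
    "\<And>e. 0 < e \<Longrightarrow> \<exists>p\<in>S. p - v 0 \<in> C \<and> mean p < L (v 0) + e"
    by (rule riesz_extension[of C S mean v, OF C_add C_scale S linear_mean pos cof span]) iprover+
  \<comment> \<open>The restriction makes \<open>z\<close> extensional; members of the module of
    order \<open>k\<close> have degree at most \<open>2 * k\<close>, so nothing is lost on
    them.\<close>
  define z where "z = restrict (\<lambda>a. L (xy_monom a)) (exps (2 * k))"
  have z: "riesz z h = L h" if "xy_deg h \<le> 2 * k" for h
    by (rule riesz_eq_linear[OF L(1)]) (use that in \<open>auto simp: z_def xy_deg_le_iff\<close>)
  show thesis
  proof (rule that[of z])
    show "dual_feasible s g k z"
      unfolding dual_feasible_iff
    proof (intro conjI ballI allI impI)
      show "z \<in> exps (2 * k) \<rightarrow>\<^sub>E UNIV" by (simp add: z_def)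
      fix c and q :: "('n, 'm) xy_poly" assume c: "c \<in> cidx s" and q: "xy_deg q \<le> k - half_deg (constr s g c)"
      have "constr s g c * q\<^sup>2 \<in> QM s g k"
        using QM_gen[OF c sos_square[OF q]] by (simp add: mult.commute)
      then show "0 \<le> riesz z (constr s g c * q\<^sup>2)"
        using QM_deg[OF fits] C_QM z L(2) by metis
    next
      fix \<alpha> :: "nat ^ 'n" assume \<alpha>: "x_exp_deg \<alpha> \<le> 2 * k"
      then have "xy_monom (\<alpha>, 0) \<in> S"
        by (auto simp: S_def xonly_def xy_deg_monom xy_exp_deg_x) (simp add: xy_monom_def)
      then show "z (\<alpha>, 0) = gam \<alpha>"
        using \<alpha> L(3) by (simp add: z_def exps_def xy_exp_deg_x gam_eq[where 'b = 'm])
    qed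
    fix e :: real assume "0 < e"
    then obtain q where q: "q \<in> S" "q - f \<in> C" "mean q < L f + e" using L(4)[of e] by (auto simp: v_def)
    obtain p where p: "q = x_to_xy p" using q(1) xonly_imp_x_to_xy by (auto simp: S_def)
    have "x_to_xy p - f \<in> QM s g k"
      using q C_QM[of "q - f"] xy_deg_diff[OF _ degf, of q] by (simp add: p S_def)
    moreover have "x_deg p \<le> 2 * k" using q(1) by (simp add: p S_def xy_deg_x_to_xy)
    ultimately obtain \<sigma> \<psi> where "primal_feasible s g f k p \<sigma> \<psi>" using primal_feasible_iff by blast
    then show "\<exists>p \<sigma> \<psi>. primal_feasible s g f k p \<sigma> \<psi> \<and> primal_cost p < riesz z f + e"
      using q(3) by (auto simp: z[OF degf] p primal_cost_eq[where 'm = 'm])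
  qed
qed

section \<open>Attainment in the primal program\<close>

lemma setK_box:
  assumes "(x, y) \<in> setK s g"
  shows "x \<in> box_B"
proof -
  have "\<bar>x $ i\<bar> \<le> 1" for i
    using assms by (simp add: setK_def xy_eval_theta abs_square_le_1[symmetric])
  then show ?thesis by (simp add: box_B_def abs_le_iff minus_le_iff)
qed

lemma mean_zero:
  fixes q :: "('n::finite, 'm::finite) xy_poly"
  assumes nn: "\<And>x. x \<in> box_B \<Longrightarrow> 0 \<le> xy_eval q x 0" and 0: "mean q = 0" and x: "x \<in> box_B"
  shows "xy_eval q x 0 = 0"
proof -
  let ?h = "\<lambda>x. xy_eval q x 0"
  have cont: "continuous_on box_B ?h" by (rule continuous_on_xy_eval_fst)
  have "(LINT x:box_B|lborel. ?h x) = 0"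
    using 0 vol_pos[where 'n = 'n] by (simp add: mean_eq)
  then have "integral box_B ?h = 0"
    using set_borel_integral_eq_integral(2)[OF set_integrable_box_B[OF cont]] by simp
  moreover have "?h integrable_on box_B"
    using integrable_continuous cont unfolding box_B_eq by blast
  ultimately have "(?h has_integral 0) (cbox (\<chi> i. -1) (\<chi> i. 1))"
    using has_integral_integral unfolding box_B_eq by metis
  moreover have "box (\<chi> i. -1) (\<chi> i. 1 :: real ^ 'n) \<noteq> {}"
    by (auto simp: box_ne_empty Basis_vec_def inner_axis)
  ultimately show ?thesis
    using has_integral_0_cbox_imp_0[of "\<chi> i. -1" "\<chi> i. 1" ?h x] cont nn x
      box_subset_cbox[of "\<chi> i. -1" "\<chi> i. 1 :: real ^ 'n"] unfolding box_B_eq by blast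
qed

section \<open>Coefficientwise limits in bounded degree\<close>

lemma bounded_family_subsequence:
  fixes X :: "nat \<Rightarrow> 'i \<Rightarrow> real"
  assumes "finite I" "\<And>n i. i \<in> I \<Longrightarrow> \<bar>X n i\<bar> \<le> B"
  shows "\<exists>r l. strict_mono (r :: nat \<Rightarrow> nat) \<and> (\<forall>i\<in>I. (\<lambda>n. X (r n) i) \<longlonglongrightarrow> l i)"
  using assms
proof (induction I)
  case empty
  then show ?case by (auto intro: exI[of _ id] strict_mono_id)
next
  case (insert j I)
  then obtain r l where r: "strict_mono (r :: nat \<Rightarrow> nat)" "\<forall>i\<in>I. (\<lambda>n. X (r n) i) \<longlonglongrightarrow> l i" by auto
  have "bounded (range (\<lambda>n. X (r n) j))"
    using insert.prems[of j] by (auto simp: bounded_iff)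
  then obtain m r' where r': "strict_mono r'" "((\<lambda>n. X (r n) j) \<circ> r') \<longlonglongrightarrow> m"
    using bounded_imp_convergent_subsequence by blast
  have "(\<lambda>n. X ((r \<circ> r') n) i) \<longlonglongrightarrow> (l(j := m)) i" if "i \<in> insert j I" for i
  proof (cases "i = j")
    case True
    then show ?thesis using r'(2) by (simp add: o_def)
  next
    case False
    then have "(\<lambda>n. X (r n) i) \<longlonglongrightarrow> l i" using r(2) that by auto
    from LIMSEQ_subseq_LIMSEQ[OF this r'(1)] show ?thesis using False by (simp add: o_def)
  qed
  then show ?case using strict_mono_o[OF r(1) r'(1)] by blast
qed

text \<open>Outside \<open>exps d\<close> every coefficient is 0, so only finitely many real
  sequences have to converge along a common subsequence.\<close>

lemma bounded_polys_subsequence: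
  fixes P :: "nat \<Rightarrow> 'i \<Rightarrow> ('n::finite, 'm::finite) xy_poly"
  assumes "finite I" and deg: "\<And>n i. i \<in> I \<Longrightarrow> xy_deg (P n i) \<le> d"
    and bound: "\<And>n i a. i \<in> I \<Longrightarrow> \<bar>Poly_Mapping.lookup (P n i) a\<bar> \<le> B"
  obtains r Q where "strict_mono (r :: nat \<Rightarrow> nat)" "\<And>i. i \<in> I \<Longrightarrow> xy_deg (Q i) \<le> d"
    "\<And>i a. i \<in> I \<Longrightarrow> (\<lambda>n. Poly_Mapping.lookup (P (r n) i) a) \<longlonglongrightarrow> Poly_Mapping.lookup (Q i) a"
proof -
  have "\<exists>r l. strict_mono (r :: nat \<Rightarrow> nat) \<and>
    (\<forall>i\<in>I \<times> (exps d :: ('n, 'm) xy_exp set). (\<lambda>n. Poly_Mapping.lookup (P (r n) (fst i)) (snd i)) \<longlonglongrightarrow> l i)"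
    by (rule bounded_family_subsequence[of _ "\<lambda>n i. Poly_Mapping.lookup (P n (fst i)) (snd i)"])
      (use assms(1) bound in \<open>auto simp: finite_exps\<close>)
  then obtain r l where r: "strict_mono (r :: nat \<Rightarrow> nat)"
    and l: "\<And>i a. i \<in> I \<Longrightarrow> a \<in> (exps d :: ('n, 'm) xy_exp set) \<Longrightarrow> (\<lambda>n. Poly_Mapping.lookup (P (r n) i) a) \<longlonglongrightarrow> l (i, a)"
    by force
  define Q where "Q i = (\<Sum>a\<in>exps d. l (i, a) *\<^sub>R xy_monom a)" for i
  have "Poly_Mapping.lookup (Q i) a = (if a \<in> exps d then l (i, a) else 0)" for i a
  proof -
    have "Poly_Mapping.lookup (Q i) a = (\<Sum>b\<in>exps d. if b = a then l (i, a) else 0)"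
      unfolding Q_def lookup_sum by (intro sum.cong) (auto simp: xy_monom_def lookup_single when_def)
    then show ?thesis by (simp add: finite_exps)
  qed
  moreover have "Poly_Mapping.lookup (P n i) a = 0" if "i \<in> I" "a \<notin> exps d" for n i a
    using deg[OF that(1), of n] that(2) by (auto simp: xy_deg_le_iff in_keys_iff)
  ultimately have "(\<lambda>n. Poly_Mapping.lookup (P (r n) i) a) \<longlonglongrightarrow> Poly_Mapping.lookup (Q i) a" if "i \<in> I" for i a
    using l that by (cases "a \<in> exps d") auto
  moreover have "xy_deg (Q i) \<le> d" for i
    unfolding Q_def by (intro xy_deg_sum xy_deg_scaleR) (simp add: xy_deg_monom exps_def)
  ultimately show thesis using r that by blast
qed

text \<open>In bounded degree a linear functional is a finite combination of coefficients.\<close>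

lemma linear_tendsto:
  fixes F :: "('n::finite, 'm::finite) xy_poly \<Rightarrow> real"
  assumes "linear F" "\<And>n. xy_deg (P n) \<le> d" "xy_deg Q \<le> d"
    and "\<And>a. (\<lambda>n. Poly_Mapping.lookup (P n) a) \<longlonglongrightarrow> Poly_Mapping.lookup Q a"
  shows "(\<lambda>n. F (P n)) \<longlonglongrightarrow> F Q"
proof -
  have F: "F h = (\<Sum>a\<in>exps d. Poly_Mapping.lookup h a * F (xy_monom a))" if "xy_deg h \<le> d" for h
  proof -
    have "F h = F (\<Sum>a\<in>exps d. Poly_Mapping.lookup h a *\<^sub>R xy_monom a)"
      using trunc_id[OF that] by (simp add: trunc_def)
    then show ?thesis by (simp add: linear_sum[OF assms(1)] linear_scale[OF assms(1)])
  qed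
  show ?thesis unfolding F[OF assms(2)] F[OF assms(3)] by (intro tendsto_intros assms(4))
qed

text \<open>
  A minimizing sequence is scaled to bounded size and a convergent subsequence chosen. If the
  scaling factors do not tend to 0, the rescaled limit is optimal. Otherwise the limit is a
  representation \<open>p = \<Sum> \<sigma>\<^sub>c g\<^sub>c\<close> of a polynomial with mean 0, whose terms all vanish
  on the interior of \<open>\<^bold>K\<close>, contradicting the normalization.
\<close>

lemma primal_attained:
  fixes f :: "('n::finite, 'm::finite) xy_poly"
  assumes int: "interior (setK s g) \<noteq> {}" and fib: "\<forall>x\<in>box_B. fiberK s g x \<noteq> {}"
    and fits: "fits s g k"
    and lower: "\<And>p \<sigma> \<psi>. primal_feasible s g f k p \<sigma> \<psi> \<Longrightarrow> \<rho> \<le> primal_cost p"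
    and near: "\<And>e. 0 < e \<Longrightarrow> \<exists>p \<sigma> \<psi>. primal_feasible s g f k p \<sigma> \<psi> \<and> primal_cost p < \<rho> + e"
  shows "\<exists>p \<sigma> \<psi>. primal_feasible s g f k p \<sigma> \<psi> \<and> primal_cost p = \<rho>"
proof -
  define dc where "dc c = k - half_deg (constr s g c)" for c
  define E where "E = (\<lambda>c. exps (dc c) :: ('n, 'm) xy_exp set)"
  define B where "B = Sigma (cidx s) E"
  define G where "G = (exps (2 * k) :: ('n, 'm) xy_exp set)"
  have finE: "finite (E c)" for c by (simp add: E_def finite_exps)
  have finB: "finite B" unfolding B_def by (intro finite_SigmaI finE) simp
  have finG: "finite G" by (simp add: G_def finite_exps)
  \<comment> \<open>The identity does not control a multiplier of a zero constraint, so its squares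
    are set to 0. By \<open>sos_bounded_length\<close> the index set \<open>E c\<close> is the same
    for all \<open>n\<close>.\<close>
  define rep_of where "rep_of n H q \<longleftrightarrow> xonly H \<and> xy_deg H \<le> 2 * k \<and> \<rho> \<le> mean H \<and> mean H < \<rho> + 1 / real (Suc n) \<and>
      (\<forall>c\<in>cidx s. \<forall>r\<in>E c. xy_deg (q (c, r)) \<le> dc c \<and> (constr s g c = 0 \<longrightarrow> q (c, r) = 0)) \<and>
      H - f = (\<Sum>c\<in>cidx s. (\<Sum>r\<in>E c. (q (c, r))\<^sup>2) * constr s g c)" for n H q
  have "\<exists>H q. rep_of n H q" for n
  proof -
    obtain p \<sigma>' \<psi>' where feas: "primal_feasible s g f k p \<sigma>' \<psi>'" and cost: "primal_cost p < \<rho> + 1 / real (Suc n)"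
      using near[of "1 / real (Suc n)"] by auto
    from feas have deg: "x_deg p \<le> 2 * k" and "x_to_xy p - f \<in> QM s g k" using primal_feasible_iff by blast+
    then obtain \<sigma> where \<sigma>: "x_to_xy p - f = (\<Sum>c\<in>cidx s. \<sigma> c * constr s g c)"
      "\<And>c. c \<in> cidx s \<Longrightarrow> \<sigma> c \<in> sos (dc c)" by (auto elim!: QM_E simp: dc_def)
    have "\<forall>c\<in>cidx s. \<exists>P. (\<forall>r\<in>E c. xy_deg (P r) \<le> dc c) \<and> \<sigma> c = (\<Sum>r\<in>E c. (P r)\<^sup>2)"
      using \<sigma>(2) sos_bounded_length unfolding E_def by metis
    then obtain P where P: "\<forall>c\<in>cidx s. (\<forall>r\<in>E c. xy_deg (P c r) \<le> dc c) \<and> \<sigma> c = (\<Sum>r\<in>E c. (P c r)\<^sup>2)"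
      by (auto dest!: bchoice)
    define q where "q b = (if constr s g (fst b) = 0 then 0 else P (fst b) (snd b))" for b
    have "\<sigma> c * constr s g c = (\<Sum>r\<in>E c. (q (c, r))\<^sup>2) * constr s g c" if "c \<in> cidx s" for c
      using P that by (cases "constr s g c = 0") (simp_all add: q_def)
    then have "x_to_xy p - f = (\<Sum>c\<in>cidx s. (\<Sum>r\<in>E c. (q (c, r))\<^sup>2) * constr s g c)"
      unfolding \<sigma>(1) by (intro sum.cong) auto
    moreover have "\<forall>c\<in>cidx s. \<forall>r\<in>E c. xy_deg (q (c, r)) \<le> dc c \<and> (constr s g c = 0 \<longrightarrow> q (c, r) = 0)"
      using P by (simp add: q_def)
    ultimately show ?thesis
      using deg cost lower[OF feas]
      by (intro exI[of _ "x_to_xy p"] exI[of _ q]) (simp add: rep_of_def xonly_x_to_xy xy_deg_x_to_xy primal_cost_eq[where 'm = 'm])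
  qed
  then obtain H q where "\<And>n. rep_of n (H n) (q n)" by metis
  then have H: "\<And>n. xonly (H n)" "\<And>n. xy_deg (H n) \<le> 2 * k" "\<And>n. \<rho> \<le> mean (H n)"
      "\<And>n. mean (H n) < \<rho> + 1 / real (Suc n)"
    and q: "\<And>n c r. c \<in> cidx s \<Longrightarrow> r \<in> E c \<Longrightarrow> xy_deg (q n (c, r)) \<le> dc c"
      "\<And>n c r. c \<in> cidx s \<Longrightarrow> r \<in> E c \<Longrightarrow> constr s g c = 0 \<Longrightarrow> q n (c, r) = 0"
    and Hq: "\<And>n. H n - f = (\<Sum>c\<in>cidx s. (\<Sum>r\<in>E c. (q n (c, r))\<^sup>2) * constr s g c)"
    unfolding rep_of_def by blast+
  \<comment> \<open>The identity is linear in \<open>H\<close> and quadratic in \<open>q\<close>.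
    With squared coefficients for \<open>q\<close>, scaling by \<open>1 / T\<close> and
    \<open>1 / sqrt T\<close> divides the size by \<open>T\<close>.\<close>
  define size where "size h l = (\<Sum>a\<in>G. \<bar>Poly_Mapping.lookup h a\<bar>) + (\<Sum>b\<in>B. \<Sum>a\<in>G. (Poly_Mapping.lookup (l b) a)\<^sup>2)"
    for h :: "('n, 'm) xy_poly" and l :: "(nat + 'n) \<times> ('n, 'm) xy_exp \<Rightarrow> ('n, 'm) xy_poly"
  \<comment> \<open>The summand 1 keeps \<open>T\<close> away from 0 and leads to the normalization
    \<open>t + size = 1\<close>, where \<open>t = 1 / T\<close> becomes the factor of
    \<open>f\<close>.\<close>
  define T where "T n = 1 + size (H n) (q n)" for n
  have T1: "1 \<le> T n" for n unfolding T_def size_def by (simp add: sum_nonneg)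
  then have T0: "0 < T n" for n by (rule less_le_trans[OF zero_less_one])
  define h where "h n = (1 / T n) *\<^sub>R H n" for n
  define l where "l n b = (1 / sqrt (T n)) *\<^sub>R q n b" for n b
  define t where "t n = 1 / T n" for n
  have sq: "(1 / sqrt (T n))\<^sup>2 = t n" for n using T0[of n] by (simp add: t_def power_divide)
  have norm: "t n + size (h n) (l n) = 1" for n
  proof -
    have "size (h n) (l n) = t n * size (H n) (q n)"
      using T0[of n] unfolding size_def h_def l_def
      by (simp add: power_mult_distrib sq t_def abs_mult sum_distrib_left distrib_left
          flip: power_divide) (simp add: power_divide sum_divide_distrib)
    then have "t n + size (h n) (l n) = t n * T n" by (simp add: T_def distrib_left)
    then show ?thesis using T0[of n] by (simp add: t_def)
  qed
  have t01: "0 \<le> t n" "t n \<le> 1" for n using T0[of n] T1[of n] by (auto simp: t_def)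
  have degh: "xy_deg (h n) \<le> 2 * k" for n unfolding h_def by (intro xy_deg_scaleR H(2))
  have degl: "xy_deg (l n b) \<le> dc (fst b)" if "b \<in> B" for n b
    unfolding l_def using that q(1) by (intro xy_deg_scaleR) (auto simp: B_def)
  have degl2: "xy_deg (l n b) \<le> 2 * k" if "b \<in> B" for n b
    using degl[OF that, of n] by (simp add: dc_def)
  have rep: "xy_eval (h n) x y - t n * xy_eval f x y =
      (\<Sum>c\<in>cidx s. (\<Sum>r\<in>E c. (xy_eval (l n (c, r)) x y)\<^sup>2) * xy_eval (constr s g c) x y)" for n x y
  proof -
    have "t n * xy_eval (H n - f) x y =
      t n * (\<Sum>c\<in>cidx s. (\<Sum>r\<in>E c. (xy_eval (q n (c, r)) x y)\<^sup>2) * xy_eval (constr s g c) x y)"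
      unfolding Hq by (simp add: xy_eval_sum xy_eval_mult xy_eval_power2)
    moreover have "(xy_eval (l n b) x y)\<^sup>2 = t n * (xy_eval (q n b) x y)\<^sup>2" for b
      unfolding l_def xy_eval_scaleR power_mult_distrib sq ..
    moreover have "xy_eval (h n) x y = t n * xy_eval (H n) x y"
      by (simp add: h_def t_def xy_eval_scaleR)
    ultimately show ?thesis
      by (simp add: xy_eval_diff right_diff_distrib sum_distrib_left[symmetric] mult.assoc)
  qed
  \<comment> \<open>One family for the scale and all polynomials, so that a single subsequence
    serves them all; the scale enters as a constant polynomial.\<close>
  define P where "P n i = (case i of None \<Rightarrow> t n *\<^sub>R 1 | Some None \<Rightarrow> h n | Some (Some b) \<Rightarrow> l n b)" for n i
  define I where "I = insert None (insert (Some None) ((\<lambda>b. Some (Some b)) ` B))"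
  have "finite I" using finB by (simp add: I_def)
  moreover have "xy_deg (P n i) \<le> 2 * k" if "i \<in> I" for n i
    using that degh degl2 xy_deg_scaleR[of 1 "2 * k" "t n"] by (auto simp: I_def P_def)
  moreover have "\<bar>Poly_Mapping.lookup (P n i) a\<bar> \<le> 1" if i: "i \<in> I" for n i a
  proof -
    have nn: "0 \<le> (\<Sum>a\<in>G. \<bar>Poly_Mapping.lookup (h n) a\<bar>)" "0 \<le> (\<Sum>b\<in>B. \<Sum>a\<in>G. (Poly_Mapping.lookup (l n b) a)\<^sup>2)"
      by (simp_all add: sum_nonneg)
    have outside: "Poly_Mapping.lookup p a = 0" if "a \<notin> G" "xy_deg p \<le> 2 * k" for p :: "('n, 'm) xy_poly"
      using that by (auto simp: G_def xy_deg_le_iff in_keys_iff)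
    consider "i = None" | "i = Some None" | b where "b \<in> B" "i = Some (Some b)" using i by (auto simp: I_def)
    then show ?thesis
    proof cases
      case 1
      then show ?thesis using t01[of n] by (simp add: P_def lookup_one when_def)
    next
      case 2
      have "\<bar>Poly_Mapping.lookup (h n) a\<bar> \<le> 1" if "a \<in> G"
        using member_le_sum[OF that, of "\<lambda>a. \<bar>Poly_Mapping.lookup (h n) a\<bar>"] finG norm[of n] nn t01(1)[of n]
        by (simp add: size_def)
      then show ?thesis using 2 outside[of "h n"] degh[of n] by (cases "a \<in> G") (auto simp: P_def)
    next
      case (3 b)
      have "(Poly_Mapping.lookup (l n b) a)\<^sup>2 \<le> 1" if "a \<in> G"
      proof -
        have "(Poly_Mapping.lookup (l n b) a)\<^sup>2 \<le> (\<Sum>a\<in>G. (Poly_Mapping.lookup (l n b) a)\<^sup>2)"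
          using finG by (intro member_le_sum[OF that]) auto
        also have "\<dots> \<le> (\<Sum>b\<in>B. \<Sum>a\<in>G. (Poly_Mapping.lookup (l n b) a)\<^sup>2)"
          using finB by (intro member_le_sum[OF 3(1)]) (auto intro: sum_nonneg)
        finally show ?thesis using norm[of n] nn t01(1)[of n] unfolding size_def by linarith
      qed
      then show ?thesis using 3 outside[of "l n b"] degl2[of b n]
        by (cases "a \<in> G") (auto simp: P_def abs_square_le_1)
    qed
  qed
  ultimately obtain r Q where r: "strict_mono (r :: nat \<Rightarrow> nat)" and degQ: "\<And>i. i \<in> I \<Longrightarrow> xy_deg (Q i) \<le> 2 * k"
    and conv: "\<And>i a. i \<in> I \<Longrightarrow> (\<lambda>n. Poly_Mapping.lookup (P (r n) i) a) \<longlonglongrightarrow> Poly_Mapping.lookup (Q i) a"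
    by (rule bounded_polys_subsequence[of I P "2 * k" 1]) blast+
  have lim0: "L = 0" if "X \<longlonglongrightarrow> L" "\<And>n. X n = 0" for X :: "nat \<Rightarrow> real" and L
    using LIMSEQ_unique[OF that(1), of 0] ext[of X "\<lambda>_. 0"] that(2) by simp
  define t' where "t' = Poly_Mapping.lookup (Q None) 0"
  define h' where "h' = Q (Some None)"
  define l' where "l' b = Q (Some (Some b))" for b
  have t_conv: "(\<lambda>n. t (r n)) \<longlonglongrightarrow> t'"
    using conv[of None 0] by (simp add: I_def P_def t'_def)
  have h_conv: "(\<lambda>n. Poly_Mapping.lookup (h (r n)) a) \<longlonglongrightarrow> Poly_Mapping.lookup h' a" for a
    using conv[of "Some None" a] by (simp add: I_def P_def h'_def)
  have l_conv: "(\<lambda>n. Poly_Mapping.lookup (l (r n) b) a) \<longlonglongrightarrow> Poly_Mapping.lookup (l' b) a" if "b \<in> B" for a b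
    using conv[of "Some (Some b)" a] that by (simp add: I_def P_def l'_def)
  have degh': "xy_deg h' \<le> 2 * k" using degQ by (simp add: h'_def I_def)
  have degl2': "xy_deg (l' b) \<le> 2 * k" if "b \<in> B" for b using degQ that by (simp add: l'_def I_def)
  \<comment> \<open>Compactness was applied with the uniform bound \<open>2 * k\<close>; the sharper
    degree survives because the coefficients beyond it are 0 along the sequence.\<close>
  have degl': "xy_deg (l' b) \<le> dc (fst b)" if b: "b \<in> B" for b
    unfolding xy_deg_le_iff
  proof
    fix a assume "a \<in> Poly_Mapping.keys (l' b)"
    moreover have "Poly_Mapping.lookup (l n b) a = 0" if "a \<notin> exps (dc (fst b))" for n
      using degl[OF b, of n] that by (auto simp: xy_deg_le_iff in_keys_iff)
    ultimately show "a \<in> exps (dc (fst b))"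
      using lim0[OF l_conv[OF b, of a]] by (meson in_keys_iff)
  qed
  have t'0: "0 \<le> t'" using t01 by (intro LIMSEQ_le_const[OF t_conv]) auto
  have rep': "xy_eval h' x y - t' * xy_eval f x y =
      (\<Sum>c\<in>cidx s. (\<Sum>r\<in>E c. (xy_eval (l' (c, r)) x y)\<^sup>2) * xy_eval (constr s g c) x y)" for x y
  proof (rule LIMSEQ_unique)
    show "(\<lambda>n. xy_eval (h (r n)) x y - t (r n) * xy_eval f x y) \<longlonglongrightarrow> xy_eval h' x y - t' * xy_eval f x y"
      by (intro tendsto_intros t_conv linear_tendsto[OF linear_xy_eval degh degh' h_conv])
    show "(\<lambda>n. xy_eval (h (r n)) x y - t (r n) * xy_eval f x y) \<longlonglongrightarrow>
      (\<Sum>c\<in>cidx s. (\<Sum>r\<in>E c. (xy_eval (l' (c, r)) x y)\<^sup>2) * xy_eval (constr s g c) x y)"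
      unfolding rep
      by (intro tendsto_intros linear_tendsto[OF linear_xy_eval degl2 degl2' l_conv]) (auto simp: B_def)
  qed
  have mean': "mean h' = t' * \<rho>"
  proof (rule LIMSEQ_unique)
    show "(\<lambda>n. mean (h (r n))) \<longlonglongrightarrow> mean h'" by (rule linear_tendsto[OF linear_mean degh degh' h_conv])
    have "(\<lambda>n. t (r n) * mean (H (r n))) \<longlonglongrightarrow> t' * \<rho>"
    proof (intro tendsto_mult t_conv)
      have "(\<lambda>n. mean (H n)) \<longlonglongrightarrow> \<rho>"
      proof (rule tendsto_sandwich[of "\<lambda>_. \<rho>" _ _ "\<lambda>n. \<rho> + 1 / real (Suc n)"])
        show "(\<lambda>n. \<rho> + 1 / real (Suc n)) \<longlonglongrightarrow> \<rho>"
          using tendsto_add[OF tendsto_const[of \<rho>] LIMSEQ_inverse_real_of_nat] by (simp add: inverse_eq_divide)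
      qed (use H(3,4) less_imp_le in \<open>auto intro!: always_eventually\<close>)
      from LIMSEQ_subseq_LIMSEQ[OF this r] show "(\<lambda>n. mean (H (r n))) \<longlonglongrightarrow> \<rho>" by (simp add: o_def)
    qed
    then show "(\<lambda>n. mean (h (r n))) \<longlonglongrightarrow> t' * \<rho>" by (simp add: h_def t_def linear_scale[OF linear_mean])
  qed
  \<comment> \<open>The limit keeps total size 1, which is what the case \<open>t' = 0\<close> will
    contradict.\<close>
  have norm': "t' + size h' l' = 1"
  proof (rule LIMSEQ_unique)
    show "(\<lambda>n. t (r n) + size (h (r n)) (l (r n))) \<longlonglongrightarrow> t' + size h' l'"
      unfolding size_def by (intro tendsto_intros t_conv h_conv l_conv)
    show "(\<lambda>n. t (r n) + size (h (r n)) (l (r n))) \<longlonglongrightarrow> 1" by (simp add: norm)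
  qed
  have "t' \<noteq> 0"
  proof
    assume "t' = 0"
    define U where "U = interior (setK s g)"
    have U: "open U" "U \<noteq> {}" "U \<subseteq> setK s g" using int by (auto simp: U_def interior_subset)
    have term_nn: "0 \<le> (\<Sum>r\<in>E c. (xy_eval (l' (c, r)) x y)\<^sup>2) * xy_eval (constr s g c) x y"
      if "(x, y) \<in> setK s g" "c \<in> cidx s" for x y c
      using that by (intro mult_nonneg_nonneg sum_nonneg) (auto simp: setK_iff)
    have h'_rep: "xy_eval h' x y = (\<Sum>c\<in>cidx s. (\<Sum>r\<in>E c. (xy_eval (l' (c, r)) x y)\<^sup>2) * xy_eval (constr s g c) x y)" for x y
      using rep'[of x y] \<open>t' = 0\<close> by simp
    have xonly': "xy_eval h' x y = xy_eval h' x y'" for x y y'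
    proof (rule LIMSEQ_unique)
      show "(\<lambda>n. xy_eval (h (r n)) x y) \<longlonglongrightarrow> xy_eval h' x y"
        by (rule linear_tendsto[OF linear_xy_eval degh degh' h_conv])
      have "xy_eval (h n) x y = xy_eval (h n) x y'" for n
        unfolding h_def by (intro xonly_eval xonly_scaleR H(1))
      then show "(\<lambda>n. xy_eval (h (r n)) x y) \<longlonglongrightarrow> xy_eval h' x y'"
        using linear_tendsto[OF linear_xy_eval degh degh' h_conv] by simp
    qed
    \<comment> \<open>On \<open>setK s g\<close> every term of \<open>h'\<close> is nonnegative, so
      through the fibres \<open>h'\<close> is nonnegative on the box; its mean is 0.\<close>
    have "xy_eval h' x 0 = 0" if x: "x \<in> box_B" for x
    proof (rule mean_zero[OF _ _ x])
      fix x :: "real ^ 'n" assume "x \<in> box_B"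
      then obtain y where "(x, y) \<in> setK s g" using fib by (auto simp: fiberK_def)
      then have "0 \<le> xy_eval h' x y" unfolding h'_rep by (intro sum_nonneg term_nn)
      then show "0 \<le> xy_eval h' x 0" using xonly' by metis
    qed (simp add: mean' \<open>t' = 0\<close>)
    then have h'U: "xy_eval h' x y = 0" if "(x, y) \<in> U" for x y
      using that U(3) setK_box[of x y s g] xonly'[of x y 0] by auto
    then have "h' = 0" using xy_poly_vanish_open[OF U(1,2)] by blast
    moreover have "l' b = 0" if bB: "b \<in> B" for b
    proof -
      obtain c e where b: "b = (c, e)" "c \<in> cidx s" "e \<in> E c" using bB unfolding B_def by blast
      show ?thesis
      proof (cases "constr s g c = 0")
        case True
        have "Poly_Mapping.lookup (l' b) a = 0" for a
          by (rule lim0[OF l_conv[OF bB, of a]]) (simp add: l_def b q(2)[OF b(2,3) True])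
        then show ?thesis by (intro poly_mapping_eqI) simp
      next
        case False
        \<comment> \<open>Where the constraint is nonzero, its vanishing term forces each square to
          vanish. \<open>W\<close> is nonempty because a nonzero polynomial cannot vanish on all of
          \<open>U\<close>.\<close>
        define W where "W = U \<inter> (\<lambda>w. xy_eval (constr s g c) (fst w) (snd w)) -` (- {0})"
        have "open ((\<lambda>w. xy_eval (constr s g c) (fst w) (snd w)) -` (- {0}))"
          by (rule open_vimage) (auto intro!: continuous_intros)
        then have "open W" using U(1) by (simp add: W_def open_Int)
        moreover have "W \<noteq> {}"
          using xy_poly_vanish_open[OF U(1,2), of "constr s g c"] False by (force simp: W_def)
        moreover have "xy_eval (l' b) x y = 0" if w: "(x, y) \<in> W" for x y
        proof -
          have xy: "(x, y) \<in> U" "xy_eval (constr s g c) x y \<noteq> 0" using w by (auto simp: W_def)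
          have "(\<Sum>c\<in>cidx s. (\<Sum>r\<in>E c. (xy_eval (l' (c, r)) x y)\<^sup>2) * xy_eval (constr s g c) x y) = 0"
            using h'_rep h'U[OF xy(1)] by simp
          moreover have "(x, y) \<in> setK s g" using xy(1) U(3) by blast
          ultimately have "(\<Sum>r\<in>E c. (xy_eval (l' (c, r)) x y)\<^sup>2) * xy_eval (constr s g c) x y = 0"
            using term_nn b(2)
              sum_nonneg_0[of "cidx s" "\<lambda>c. (\<Sum>r\<in>E c. (xy_eval (l' (c, r)) x y)\<^sup>2) * xy_eval (constr s g c) x y" c]
            using finite_cidx by blast
          then have "(\<Sum>r\<in>E c. (xy_eval (l' (c, r)) x y)\<^sup>2) = 0" using xy(2) by simp
          then have "\<forall>r\<in>E c. (xy_eval (l' (c, r)) x y)\<^sup>2 = 0"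
            using finE by (subst (asm) sum_nonneg_eq_0_iff) auto
          then show ?thesis using b by simp
        qed
        ultimately show ?thesis by (intro xy_poly_vanish_open)
      qed
    qed
    ultimately have "size h' l' = 0" by (simp add: size_def)
    then show False using norm' \<open>t' = 0\<close> by simp
  qed
  then have pos: "0 < t'" using t'0 by simp
  \<comment> \<open>Undoes the scaling: division by \<open>t'\<close> for the polynomial, and below
    by \<open>sqrt t'\<close> for the squares.\<close>
  define F where "F = (1 / t') *\<^sub>R h'"
  have "xonly h'"
    unfolding xonly_def
  proof
    fix a assume a: "a \<in> Poly_Mapping.keys h'"
    have "Poly_Mapping.lookup (h n) a = 0" if "snd a \<noteq> 0" for n
      using xonly_scaleR[OF H(1), of "1 / T n" n] that by (auto simp: xonly_def h_def[symmetric] in_keys_iff)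
    then show "snd a = 0"
      using lim0[OF h_conv[of a]] a by (meson in_keys_iff)
  qed
  then obtain p where p: "F = x_to_xy p" unfolding F_def using xonly_imp_x_to_xy xonly_scaleR by metis
  have "F - f = (\<Sum>c\<in>cidx s. (\<Sum>r\<in>E c. ((1 / sqrt t') *\<^sub>R l' (c, r))\<^sup>2) * constr s g c)"
  proof (rule xy_poly_eqI)
    fix x y
    have "(1 / t') * (xy_eval h' x y - t' * xy_eval f x y) = xy_eval (F - f) x y"
      using pos by (simp add: F_def xy_eval_diff xy_eval_scaleR field_simps)
    moreover have "(1 / sqrt t')\<^sup>2 = 1 / t'" using pos by (simp add: power_divide)
    ultimately show "xy_eval (F - f) x y =
        xy_eval (\<Sum>c\<in>cidx s. (\<Sum>r\<in>E c. ((1 / sqrt t') *\<^sub>R l' (c, r))\<^sup>2) * constr s g c) x y"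
      unfolding rep'
      by (simp only: xy_eval_sum xy_eval_mult xy_eval_power2 xy_eval_scaleR power_mult_distrib
          sum_distrib_left[symmetric] mult.assoc)
  qed
  moreover have "(\<Sum>r\<in>E c. ((1 / sqrt t') *\<^sub>R l' (c, r))\<^sup>2) \<in> sos (dc c)" if "c \<in> cidx s" for c
    using degl' that by (intro in_sosI finE xy_deg_scaleR) (auto simp: B_def)
  ultimately have "F - f \<in> QM s g k"
    using QM_I[of s "\<lambda>c. \<Sum>r\<in>E c. ((1 / sqrt t') *\<^sub>R l' (c, r))\<^sup>2" k g] by (simp add: dc_def)
  moreover have "x_deg p \<le> 2 * k"
    using xy_deg_scaleR[OF degh', of "1 / t'"] by (simp add: F_def[symmetric] p xy_deg_x_to_xy)
  ultimately obtain \<sigma> \<psi> where "primal_feasible s g f k p \<sigma> \<psi>" using primal_feasible_iff p by metis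
  moreover have "primal_cost p = \<rho>"
    using pos mean' by (simp add: primal_cost_eq[where 'm = 'm] p[symmetric] F_def linear_scale[OF linear_mean])
  ultimately show ?thesis by blast
qed

lemma sdp_strong_duality:
  fixes f :: "('n::finite, 'm::finite) xy_poly"
  assumes int: "interior (setK s g) \<noteq> {}" and fib: "\<forall>x\<in>box_B. fiberK s g x \<noteq> {}"
    and adm: "admissible s g f k"
  shows "primal_value s g f k = dual_value s g f k \<and>
    (\<exists>p \<sigma> \<psi>. primal_optimal s g f k p \<sigma> \<psi>) \<and> (\<exists>z. dual_optimal s g f k z)"
proof -
  obtain z where z: "dual_feasible s g k z"
    and near: "\<And>e. 0 < e \<Longrightarrow> \<exists>p \<sigma> \<psi>. primal_feasible s g f k p \<sigma> \<psi> \<and> primal_cost p < riesz z f + e"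
    using strong_duality[OF adm fib] by blast
  have "fits s g k" using adm by (simp add: admissible_iff)
  \<comment> \<open>Weak duality for this \<open>z\<close> supplies the lower bound
    \<open>riesz z f\<close> that attainment asks for.\<close>
  from primal_attained[OF int fib this _ near] weak_duality[OF z]
  obtain p \<sigma> \<psi> where p: "primal_feasible s g f k p \<sigma> \<psi>" "primal_cost p = riesz z f" by blast
  have "primal_value s g f k = ereal (riesz z f)"
    unfolding primal_value_def
  proof (intro antisym Inf_greatest)
    show "Inf {ereal (primal_cost p) |p \<sigma> \<psi>. primal_feasible s g f k p \<sigma> \<psi>} \<le> ereal (riesz z f)"
      using p by (intro Inf_lower) (auto intro!: exI[of _ p])
  qed (auto intro: weak_duality[OF z])
  moreover have "dual_value s g f k = ereal (riesz z f)"
    unfolding dual_value_def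
  proof (intro antisym Sup_least)
    show "ereal (riesz z f) \<le> Sup {ereal (riesz z f) |z. dual_feasible s g k z}"
      using z by (intro Sup_upper) auto
  qed (use weak_duality[OF _ p(1)] p(2) in auto)
  ultimately show ?thesis using p z unfolding primal_optimal_def dual_optimal_def by auto
qed


section \<open>The value function\<close>

lemma closed_setK: "closed (setK s g)"
proof -
  have "setK s g = (\<Inter>c\<in>cidx s. {w. 0 \<le> xy_eval (constr s g c) (fst w) (snd w)})"
    by (auto simp: setK_iff)
  then show ?thesis by (auto intro!: closed_INT closed_Collect_le continuous_intros)
qed

lemma setK_norm:
  assumes "(x, y) \<in> setK s g"
  shows "norm y \<le> 1"
proof -
  have "0 \<le> xy_eval (constr s g (Inl (s + 1))) x y"
    using assms cidx_ball(1)[of s] unfolding setK_iff by blast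
  then have "(norm y)\<^sup>2 \<le> 1" unfolding cidx_ball(2) xy_eval_ball_poly by simp
  then show ?thesis by (simp add: abs_square_le_1)
qed

lemma compact_setK: "compact (setK s g)"
proof -
  have "setK s g = (box_B \<times> cball 0 1) \<inter> setK s g"
    using setK_box setK_norm by (fastforce simp: dist_norm)
  then show ?thesis
    using compact_Int_closed[OF compact_Times[OF compact_box_B compact_cball] closed_setK] by metis
qed

lemma Jbar_is_max:
  assumes "fiberK s g x \<noteq> {}"
  shows "\<exists>y\<in>fiberK s g x. Jbar s g f x = xy_eval f x y"
    and "y \<in> fiberK s g x \<Longrightarrow> xy_eval f x y \<le> Jbar s g f x"
proof -
  have "fiberK s g x = Pair x -` setK s g" by (auto simp: fiberK_def)
  then have "closed (fiberK s g x)"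
    by (auto intro!: closed_vimage[OF closed_setK] continuous_intros)
  moreover have "bounded (fiberK s g x)"
    by (auto simp: bounded_iff fiberK_def intro!: exI[of _ 1] dest: setK_norm)
  ultimately have "compact (fiberK s g x)" by (simp add: compact_eq_bounded_closed)
  then have "\<exists>y\<in>fiberK s g x. \<forall>y'\<in>fiberK s g x. xy_eval f x y' \<le> xy_eval f x y"
    using assms by (intro continuous_attains_sup continuous_intros)
  then obtain y where y: "y \<in> fiberK s g x" "\<And>y'. y' \<in> fiberK s g x \<Longrightarrow> xy_eval f x y' \<le> xy_eval f x y" by blast
  then have "Jbar s g f x = xy_eval f x y"
    unfolding Jbar_def by (intro Greatest_equality) auto
  then show "\<exists>y\<in>fiberK s g x. Jbar s g f x = xy_eval f x y"
    and "y \<in> fiberK s g x \<Longrightarrow> xy_eval f x y \<le> Jbar s g f x" for y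
    using y by auto
qed

text \<open>The upper Pasch-Hausdorff envelope of the value function, with the supremum over the
  fibre merged into the one over the base.\<close>

definition Jlip :: "nat \<Rightarrow> (nat \<Rightarrow> ('n::finite, 'm::finite) xy_poly) \<Rightarrow> ('n, 'm) xy_poly \<Rightarrow> nat \<Rightarrow> real ^ 'n \<Rightarrow> real" where
  "Jlip s g f N x = (SUP w\<in>setK s g. xy_eval f (fst w) (snd w) - real N * dist x (fst w))"

lemma setK_bound:
  obtains C where "\<And>x y. (x, y) \<in> setK s g \<Longrightarrow> \<bar>xy_eval f x y\<bar> \<le> C"
proof -
  have "compact ((\<lambda>w. xy_eval f (fst w) (snd w)) ` setK s g)"
    by (intro compact_continuous_image compact_setK continuous_intros)
  then obtain C where C: "\<forall>v\<in>(\<lambda>w. xy_eval f (fst w) (snd w)) ` setK s g. norm v \<le> C"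
    using compact_imp_bounded bounded_iff by metis
  show thesis by (rule that[of C]) (use C in force)
qed

context
  fixes s :: nat and g :: "nat \<Rightarrow> ('n::finite, 'm::finite) xy_poly" and f :: "('n, 'm) xy_poly" and C :: real
  assumes ne: "setK s g \<noteq> {}" and C: "\<And>x y. (x, y) \<in> setK s g \<Longrightarrow> \<bar>xy_eval f x y\<bar> \<le> C"
begin

lemma Jlip_bdd: "bdd_above ((\<lambda>w. xy_eval f (fst w) (snd w) - real N * dist x (fst w)) ` setK s g)"
proof (rule bdd_aboveI2[of _ _ C])
  fix w assume "w \<in> setK s g"
  then have "xy_eval f (fst w) (snd w) \<le> C" using C[of "fst w" "snd w"] by auto
  then show "xy_eval f (fst w) (snd w) - real N * dist x (fst w) \<le> C"
    using zero_le_dist[of x "fst w"] by (smt (verit) mult_nonneg_nonneg of_nat_0_le_iff)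
qed

lemma Jlip_upper: "w \<in> setK s g \<Longrightarrow> xy_eval f (fst w) (snd w) - real N * dist x (fst w) \<le> Jlip s g f N x"
  unfolding Jlip_def by (rule cSUP_upper[OF _ Jlip_bdd])

lemma Jlip_least:
  "(\<And>w. w \<in> setK s g \<Longrightarrow> xy_eval f (fst w) (snd w) - real N * dist x (fst w) \<le> v) \<Longrightarrow> Jlip s g f N x \<le> v"
  unfolding Jlip_def by (rule cSUP_least[OF ne])

lemma Jlip_ge: "(x, y) \<in> setK s g \<Longrightarrow> xy_eval f x y \<le> Jlip s g f N x"
  using Jlip_upper[of "(x, y)" N x] by simp

lemma Jlip_le: "Jlip s g f N x \<le> C"
proof (rule Jlip_least)
  fix w assume "w \<in> setK s g"
  then have "xy_eval f (fst w) (snd w) \<le> C" using C[of "fst w" "snd w"] by auto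
  moreover have "0 \<le> real N * dist x (fst w)" by simp
  ultimately show "xy_eval f (fst w) (snd w) - real N * dist x (fst w) \<le> C" by linarith
qed

lemma Jlip_lipschitz: "Jlip s g f N x \<le> Jlip s g f N x' + real N * dist x x'"
proof (rule Jlip_least)
  fix w assume w: "w \<in> setK s g"
  have "real N * dist x' (fst w) \<le> real N * (dist x x' + dist x (fst w))"
    using dist_triangle[of x' "fst w" x] by (intro mult_left_mono) (auto simp: dist_commute)
  then show "xy_eval f (fst w) (snd w) - real N * dist x (fst w) \<le> Jlip s g f N x' + real N * dist x x'"
    using Jlip_upper[OF w, of N x'] by (simp add: distrib_left)
qed

lemma continuous_on_Jlip: "continuous_on S (Jlip s g f N)"
  unfolding continuous_on_iff
proof (intro ballI allI impI)
  fix x e assume "0 < (e :: real)"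
  have "dist (Jlip s g f N x') (Jlip s g f N x) < e" if d: "dist x' x < e / (real N + 1)" for x'
  proof -
    have "\<bar>Jlip s g f N x' - Jlip s g f N x\<bar> \<le> real N * dist x' x"
      using Jlip_lipschitz[of N x x'] Jlip_lipschitz[of N x' x] by (simp add: dist_commute)
    also have "\<dots> \<le> (real N + 1) * dist x' x" by (simp add: mult_right_mono)
    also have "\<dots> < e" using d by (simp add: field_simps)
    finally show ?thesis by (simp add: dist_real_def)
  qed
  moreover have "0 < e / (real N + 1)" using \<open>0 < e\<close> by simp
  ultimately show "\<exists>d>0. \<forall>x'\<in>S. dist x' x < d \<longrightarrow> dist (Jlip s g f N x') (Jlip s g f N x) < e" by blast
qed

lemma Jlip_antimono: "N \<le> M \<Longrightarrow> Jlip s g f M x \<le> Jlip s g f N x"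
proof (rule Jlip_least)
  fix w assume "N \<le> M" and w: "w \<in> setK s g"
  then have "real N * dist x (fst w) \<le> real M * dist x (fst w)" by (intro mult_right_mono) auto
  then show "xy_eval f (fst w) (snd w) - real M * dist x (fst w) \<le> Jlip s g f N x"
    using Jlip_upper[OF w, of N x] by linarith
qed

text \<open>If the majorants stayed above \<open>Jbar\<close> by a fixed amount, points nearly
  attaining them would pay a penalty of at most \<open>2 * C\<close>, so their x parts would tend to
  \<open>x\<close>. By compactness a limit point lies over \<open>x\<close>, where \<open>f\<close>
  is at most \<open>Jbar\<close>.\<close>

lemma Jlip_tendsto:
  assumes fx: "fiberK s g x \<noteq> {}"
  shows "(\<lambda>N. Jlip s g f N x) \<longlonglongrightarrow> Jbar s g f x"
proof -
  let ?J = "Jbar s g f x"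
  have lower: "?J \<le> Jlip s g f N x" for N
    using Jbar_is_max(1)[OF fx, of f] Jlip_ge by (auto simp: fiberK_def)
  have "\<exists>N. Jlip s g f N x < ?J + e" if e: "0 < e" for e
  proof (rule ccontr)
    assume "\<not> ?thesis"
    \<comment> \<open>Halving \<open>e\<close> makes the inequality strict, so that an actual point
      of the supremum exceeds the bound.\<close>
    then have far: "?J + e / 2 < Jlip s g f N x" for N using e by (smt (verit) field_sum_of_halves)
    have "\<exists>w\<in>setK s g. ?J + e / 2 < xy_eval f (fst w) (snd w) - real N * dist x (fst w)" for N
      using far[of N] less_cSUP_iff[OF ne Jlip_bdd] unfolding Jlip_def by blast
    then obtain w where w: "\<And>N. w N \<in> setK s g"
      "\<And>N. ?J + e / 2 < xy_eval f (fst (w N)) (snd (w N)) - real N * dist x (fst (w N))" by metis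
    obtain w0 r where r: "w0 \<in> setK s g" "strict_mono (r :: nat \<Rightarrow> nat)" "(w \<circ> r) \<longlonglongrightarrow> w0"
      using compact_setK[of s g] w(1) unfolding compact_def by metis
    have "real N * dist x (fst (w N)) \<le> 2 * C" for N
    proof -
      obtain y where "(x, y) \<in> setK s g" "?J = xy_eval f x y"
        using Jbar_is_max(1)[OF fx, of f] by (auto simp: fiberK_def)
      then show ?thesis using w(2)[of N] C[of x y] C[of "fst (w N)" "snd (w N)"] w(1)[of N] e by auto
    qed
    \<comment> \<open>The shift to \<open>Suc N\<close> avoids division by 0.\<close>
    then have "dist x (fst (w (Suc N))) \<le> (2 * C) * inverse (real (Suc N))" for N
      by (simp add: field_simps del: of_nat_Suc)
    moreover have "(\<lambda>N. (2 * C) * inverse (real (Suc N))) \<longlonglongrightarrow> 0"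
      using tendsto_mult_right_zero[OF LIMSEQ_inverse_real_of_nat] by blast
    ultimately have "(\<lambda>N. dist x (fst (w (Suc N)))) \<longlonglongrightarrow> 0"
      using Lim_null_comparison[of "\<lambda>N. dist x (fst (w (Suc N)))" "\<lambda>N. (2 * C) * inverse (real (Suc N))"]
      by (simp add: always_eventually del: of_nat_Suc)
    from LIMSEQ_imp_Suc[of "\<lambda>N. dist x (fst (w N))", OF this] have "(\<lambda>N. fst (w N)) \<longlonglongrightarrow> x" by (subst tendsto_dist_iff) (simp add: dist_commute)
    from LIMSEQ_subseq_LIMSEQ[OF this r(2)] have "(\<lambda>n. fst (w (r n))) \<longlonglongrightarrow> x" by (simp add: o_def)
    moreover have fw: "(\<lambda>n. fst (w (r n))) \<longlonglongrightarrow> fst w0" and sw: "(\<lambda>n. snd (w (r n))) \<longlonglongrightarrow> snd w0"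
      using r(3) by (auto simp: o_def intro: tendsto_fst tendsto_snd)
    ultimately have x: "fst w0 = x" using LIMSEQ_unique by blast
    have "(\<lambda>n. xy_eval f (fst (w (r n))) (snd (w (r n)))) \<longlonglongrightarrow> xy_eval f (fst w0) (snd w0)"
      unfolding xy_eval_def by (intro tendsto_intros fw sw)
    moreover have "?J + e / 2 \<le> xy_eval f (fst (w N)) (snd (w N))" for N
      using w(2)[of N] by (smt (verit) mult_nonneg_nonneg of_nat_0_le_iff zero_le_dist)
    ultimately have "?J + e / 2 \<le> xy_eval f (fst w0) (snd w0)"
      by (intro LIMSEQ_le_const) auto
    moreover have "xy_eval f (fst w0) (snd w0) \<le> ?J"
      using Jbar_is_max(2)[OF fx, of "snd w0" f] r(1) x by (cases w0) (auto simp: fiberK_def)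
    ultimately show False using e by simp
  qed
  then show ?thesis
  proof (intro LIMSEQ_I)
    fix e :: real assume "0 < e" and *: "\<And>e. 0 < e \<Longrightarrow> \<exists>N. Jlip s g f N x < ?J + e"
    then obtain N where "Jlip s g f N x < ?J + e" by blast
    then have "norm (Jlip s g f M x - ?J) < e" if "N \<le> M" for M
      using lower[of M] Jlip_antimono[OF that, of x] by simp
    then show "\<exists>N. \<forall>M\<ge>N. norm (Jlip s g f M x - ?J) < e" by blast
  qed
qed

text \<open>Measurability of the value function on the box comes from the majorants, whose pointwise
  limit it is; the constant \<open>C\<close> on the box dominates them.\<close>

lemma Jbar_integral:
  assumes fib: "\<forall>x\<in>box_B. fiberK s g x \<noteq> {}"
  shows "set_integrable lborel box_B (Jbar s g f)"
    "(\<lambda>N. LINT x:box_B|lborel. Jlip s g f N x) \<longlonglongrightarrow> (LINT x:box_B|lborel. Jbar s g f x)"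
proof -
  let ?u = "\<lambda>N x. indicator box_B x *\<^sub>R Jlip s g f N x" and ?v = "\<lambda>x. indicator box_B x *\<^sub>R Jbar s g f x"
  have lim: "(\<lambda>N. ?u N x) \<longlonglongrightarrow> ?v x" for x
    using Jlip_tendsto fib by (cases "x \<in> box_B") (auto simp: indicator_def)
  have meas_u: "?u N \<in> borel_measurable lborel" for N
    using set_integrable_box_B[OF continuous_on_Jlip, of N] unfolding set_integrable_def
    by (rule borel_measurable_integrable)
  have meas_v: "?v \<in> borel_measurable lborel"
    by (rule borel_measurable_LIMSEQ_real[OF lim meas_u])
  have bound: "norm (?u N x) \<le> indicator box_B x *\<^sub>R C" for N x
  proof (cases "x \<in> box_B")
    case True
    then obtain y where "(x, y) \<in> setK s g" using fib by (auto simp: fiberK_def)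
    then show ?thesis using True C[of x y] Jlip_ge[of x y N] Jlip_le[of N x] by (auto simp: abs_le_iff)
  qed simp
  have int_C: "integrable lborel (\<lambda>x :: real ^ 'n. indicator box_B x *\<^sub>R C)"
    using set_integrable_box_B[of "\<lambda>_. C"] by (simp add: set_integrable_def)
  show "set_integrable lborel box_B (Jbar s g f)"
    unfolding set_integrable_def
    by (rule integrable_dominated_convergence[where s = ?u, OF meas_v meas_u int_C]) (use lim bound in auto)
  show "(\<lambda>N. LINT x:box_B|lborel. Jlip s g f N x) \<longlonglongrightarrow> (LINT x:box_B|lborel. Jbar s g f x)"
    unfolding set_lebesgue_integral_def
    by (rule integral_dominated_convergence[where s = ?u, OF meas_v meas_u int_C]) (use lim bound in auto)
qed

end

section \<open>Polynomial approximation and convergence in mean\<close>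

lemma xonly_mult: "xonly p \<Longrightarrow> xonly q \<Longrightarrow> xonly (p * q)"
  using Poly_Mapping.keys_mult[of p q] by (fastforce simp: xonly_def)

lemma xonly_sum: "(\<And>i. i \<in> I \<Longrightarrow> xonly (p i)) \<Longrightarrow> xonly (\<Sum>i\<in>I. p i)"
  by (induction I rule: infinite_finite_induct) (simp_all add: xonly_add, simp_all add: xonly_def)

text \<open>Stone-Weierstrass yields functions, while certificates need families of coefficients.
  The induction follows the generation of these functions from linear forms and constants.\<close>

lemma real_polynomial_function_imp_xonly:
  fixes h :: "real ^ 'n \<Rightarrow> real"
  assumes "real_polynomial_function h"
  shows "\<exists>q :: ('n::finite, 'm::finite) xy_poly. xonly q \<and> (\<forall>x y. xy_eval q x y = h x)"
  using assms
proof induction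
  case (linear h)
  have h: "h x = (\<Sum>i\<in>UNIV. x $ i * h (axis i 1))" for x
  proof -
    have "h x = h (\<Sum>i\<in>UNIV. x $ i *\<^sub>R axis i 1)"
      using basis_expansion[of x] by (simp add: scalar_mult_eq_scaleR)
    also have "\<dots> = (\<Sum>i\<in>UNIV. x $ i * h (axis i 1))"
      using bounded_linear.linear[OF linear] by (simp add: linear_sum linear_scale)
    finally show ?thesis .
  qed
  have var: "xy_eval (var_x i :: ('n, 'm) xy_poly) x y = x $ i" for i x y
    by (simp add: var_x_def xy_eval_monom prod_axis_1[simplified])
  let ?q = "\<Sum>i\<in>UNIV. h (axis i 1) *\<^sub>R (var_x i :: ('n, 'm) xy_poly)"
  have "xonly (h (axis i 1) *\<^sub>R (var_x i :: ('n, 'm) xy_poly))" for i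
    by (intro xonly_scaleR) (simp add: xonly_def var_x_def xy_monom_def)
  then have "xonly ?q"
    by (intro xonly_sum)
  moreover have "xy_eval ?q x y = h x" for x y
    unfolding xy_eval_sum xy_eval_scaleR var by (subst h) (simp add: mult.commute)
  ultimately show ?case by blast
next
  case (const c)
  show ?case
    by (rule exI[of _ "c *\<^sub>R 1"])
      (auto simp: xy_eval_scaleR xy_eval_one xonly_def in_keys_iff lookup_one when_def zero_prod_def split: if_splits)
next
  case (add f g)
  then obtain p q :: "('n, 'm) xy_poly" where "xonly p" "xonly q" "\<forall>x y. xy_eval p x y = f x" "\<forall>x y. xy_eval q x y = g x"
    by blast
  then show ?case by (intro exI[of _ "p + q"]) (simp add: xonly_add xy_eval_add)
next
  case (mult f g)
  then obtain p q :: "('n, 'm) xy_poly" where "xonly p" "xonly q" "\<forall>x y. xy_eval p x y = f x" "\<forall>x y. xy_eval q x y = g x"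
    by blast
  then show ?case by (intro exI[of _ "p * q"]) (simp add: xonly_mult xy_eval_mult)
qed

lemma eventually_feasible:
  fixes f :: "('n::finite, 'm::finite) xy_poly"
  assumes pos: "\<And>x y. (x, y) \<in> setK s g \<Longrightarrow> xy_eval f x y < x_eval p x" and ne: "setK s g \<noteq> {}"
  shows "\<exists>k0. \<forall>k\<ge>k0. admissible s g f k \<and> (\<exists>\<sigma> \<psi>. primal_feasible s g f k p \<sigma> \<psi>)"
proof -
  obtain x0 y0 where "(x0, y0) \<in> setK s g" using ne by auto
  from putinar[OF this, of "x_to_xy p - f"] have "x_to_xy p - f \<in> QMU s g"
    using pos by (simp add: xy_eval_diff xy_eval_x_to_xy)
  then obtain l where l: "fits s g l" "x_to_xy p - f \<in> QM s g l" by (auto simp: QMU_def)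
  show ?thesis
  \<comment> \<open>Any order beyond this sum meets the degree conditions on \<open>p\<close> and
    \<open>f\<close>, and the module only grows with the order.\<close>
  proof (intro exI[of _ "l + x_deg p + xy_deg f"] allI impI)
    fix k assume "l + x_deg p + xy_deg f \<le> k"
    then show "admissible s g f k \<and> (\<exists>\<sigma> \<psi>. primal_feasible s g f k p \<sigma> \<psi>)"
      using l QM_mono[of l k s g] fits_mono[of s g l k] by (auto simp: primal_feasible_iff admissible_iff)
  qed
qed

theorem theorem5:
  fixes f :: "('n::finite, 'm::finite) xy_poly"
    and g :: "nat \<Rightarrow> ('n, 'm) xy_poly"
    and s :: nat
  assumes "interior (setK s g) \<noteq> {}"
    and "\<forall>x\<in>box_B. fiberK s g x \<noteq> {}"
  shows "(\<forall>k. admissible s g f k \<longrightarrow>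
            primal_value s g f k = dual_value s g f k \<and>
            (\<exists>p \<sigma> \<psi>. primal_optimal s g f k p \<sigma> \<psi>) \<and>
            (\<exists>z. dual_optimal s g f k z)) \<and>
         (\<forall>p. (\<forall>k. admissible s g f k \<longrightarrow> (\<exists>\<sigma> \<psi>. primal_optimal s g f k (p k) \<sigma> \<psi>)) \<longrightarrow>
            (\<forall>k. set_integrable lborel box_B (\<lambda>x. \<bar>x_eval (p k) x - Jbar s g f x\<bar>)) \<and>
            (\<lambda>k. LINT x:box_B|lborel. \<bar>x_eval (p k) x - Jbar s g f x\<bar>) \<longlonglongrightarrow> 0)"
proof (intro conjI allI impI)
  fix k assume "admissible s g f k"
  from sdp_strong_duality[OF assms this]
  show "primal_value s g f k = dual_value s g f k" "\<exists>p \<sigma> \<psi>. primal_optimal s g f k p \<sigma> \<psi>"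
    "\<exists>z. dual_optimal s g f k z" by auto
next
  fix p assume opt: "\<forall>k. admissible s g f k \<longrightarrow> (\<exists>\<sigma> \<psi>. primal_optimal s g f k (p k) \<sigma> \<psi>)"
  let ?J = "Jbar s g f" and ?V = "measure lborel (box_B :: (real ^ 'n) set)"
  have ne: "setK s g \<noteq> {}" using assms(1) by auto
  obtain C where C: "\<And>x y. (x, y) \<in> setK s g \<Longrightarrow> \<bar>xy_eval f x y\<bar> \<le> C" using setK_bound by blast
  note J_int = Jbar_integral[OF ne C assms(2)]
  have cont: "continuous_on S (x_eval q)" for S and q :: "'n x_poly"
    using continuous_on_xy_eval_fst[of S "x_to_xy q :: ('n, 'm) xy_poly" 0] by (simp add: xy_eval_x_to_xy cong: continuous_on_cong)
  have p_int: "set_integrable lborel box_B (x_eval q)" for q :: "'n x_poly"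
    by (rule set_integrable_box_B[OF cont])
  have cost: "(LINT x:box_B|lborel. x_eval q x) = ?V * primal_cost q" for q :: "'n x_poly"
    using vol_pos[where 'n = 'n] integral_lam[OF borel_measurable_continuous_onI[OF cont], of q]
    by (simp add: primal_cost_def)
  show "set_integrable lborel box_B (\<lambda>x. \<bar>x_eval (p k) x - ?J x\<bar>)" for k
    by (intro set_integrable_abs set_integral_diff p_int J_int)
  \<comment> \<open>A feasible polynomial lies above the value function on the box, so the absolute
    value drops and only the cost has to converge.\<close>
  have gap: "(LINT x:box_B|lborel. \<bar>x_eval q x - ?J x\<bar>) = ?V * primal_cost q - (LINT x:box_B|lborel. ?J x)"
    if feas: "primal_feasible s g f k q \<sigma> \<psi>" for k q \<sigma> \<psi>
  proof -
    have "?J x \<le> x_eval q x" if "x \<in> box_B" for x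
    proof -
      obtain y where y: "(x, y) \<in> setK s g" "?J x = xy_eval f x y"
        using Jbar_is_max(1) assms(2) \<open>x \<in> box_B\<close> by (fastforce simp: fiberK_def)
      have "x_to_xy q - f \<in> QM s g k" using primal_feasible_iff feas by blast
      from QM_eval_nonneg[OF this y(1)] show ?thesis by (simp add: y(2) xy_eval_diff xy_eval_x_to_xy)
    qed
    then have "(LINT x:box_B|lborel. \<bar>x_eval q x - ?J x\<bar>) = (LINT x:box_B|lborel. x_eval q x - ?J x)"
      by (intro set_lebesgue_integral_cong) auto
    then show ?thesis using set_integral_diff(2)[OF p_int J_int(1)] by (simp add: cost)
  qed
  show "(\<lambda>k. LINT x:box_B|lborel. \<bar>x_eval (p k) x - ?J x\<bar>) \<longlonglongrightarrow> 0"
  proof (rule LIMSEQ_I)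
    fix d :: real assume "0 < d"
    \<comment> \<open>The budget is \<open>e\<close> for the integral of the majorant and
      \<open>2 * e\<close> pointwise on a box of volume \<open>?V\<close>; this choice makes the
      total \<open>d / 2\<close>.\<close>
    define e where "e = d / (2 * (1 + 2 * ?V))"
    have e: "0 < e" and de: "e * (1 + 2 * ?V) < d"
      using \<open>0 < d\<close> vol_pos[where 'n = 'n] by (simp_all add: e_def field_simps add_pos_pos)
    obtain N where N: "(LINT x:box_B|lborel. Jlip s g f N x) < (LINT x:box_B|lborel. ?J x) + e"
      using order_tendstoD(2)[OF J_int(2), of "(LINT x:box_B|lborel. ?J x) + e"] e
      by (auto simp: eventually_sequentially)
    have contN: "continuous_on box_B (Jlip s g f N)" by (rule continuous_on_Jlip[OF ne C])
    \<comment> \<open>Approximating \<open>Jlip + e\<close> within \<open>e\<close> puts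
      \<open>h\<close> strictly above the majorant, as Putinar requires, and less than
      \<open>2 * e\<close> above it.\<close>
    obtain h where h: "real_polynomial_function h" "\<And>x. x \<in> box_B \<Longrightarrow> \<bar>(Jlip s g f N x + e) - h x\<bar> < e"
      by (rule Stone_Weierstrass_real_polynomial_function[OF compact_box_B, of "\<lambda>x. Jlip s g f N x + e" e])
        (use contN e in \<open>auto intro: continuous_on_add\<close>)
    obtain q where "xonly (q :: ('n, 'm) xy_poly)" "\<And>x y. xy_eval q x y = h x"
      using real_polynomial_function_imp_xonly[OF h(1)] by blast
    then obtain r where r: "\<And>x. x_eval r x = h x"
      using xonly_imp_x_to_xy xy_eval_x_to_xy by metis
    have "xy_eval f x y < x_eval r x" if "(x, y) \<in> setK s g" for x y
      using h(2)[OF setK_box[OF that]] Jlip_ge[OF ne C that, of N] by (simp add: r abs_less_iff)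
    from eventually_feasible[OF this ne] obtain k0 where
      k0: "\<And>k. k0 \<le> k \<Longrightarrow> admissible s g f k \<and> (\<exists>\<sigma> \<psi>. primal_feasible s g f k r \<sigma> \<psi>)" by blast
    have "?V * primal_cost r \<le> (LINT x:box_B|lborel. Jlip s g f N x + 2 * e)"
      unfolding cost[symmetric]
    proof (rule set_integral_mono[OF p_int])
      show "set_integrable lborel box_B (\<lambda>x. Jlip s g f N x + 2 * e)"
        by (intro set_integrable_box_B continuous_intros contN)
      show "x_eval r x \<le> Jlip s g f N x + 2 * e" if "x \<in> box_B" for x
        using h(2)[OF that] by (simp add: r abs_less_iff)
    qed
    also have "\<dots> = (LINT x:box_B|lborel. Jlip s g f N x) + 2 * e * ?V"
    proof -
      have "(LINT x:(box_B :: (real ^ 'n) set)|lborel. 2 * e) = 2 * e * ?V"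
        using set_integral_const[of "box_B :: (real ^ 'n) set" lborel "2 * e"] emeasure_box_B[where 'n = 'n]
        by (simp add: mult.commute)
      then show ?thesis
        using set_integral_add(2)[OF set_integrable_box_B[OF contN] set_integrable_box_B[of "\<lambda>_. 2 * e"]] by simp
    qed
    finally have r_cost: "?V * primal_cost r - (LINT x:box_B|lborel. ?J x) < d"
      using N de by (simp add: algebra_simps)
    show "\<exists>k0. \<forall>k\<ge>k0. norm ((LINT x:box_B|lborel. \<bar>x_eval (p k) x - ?J x\<bar>) - 0) < d"
    proof (intro exI[of _ k0] allI impI)
      \<comment> \<open>The approximant is feasible for every such \<open>k\<close>, so its cost
        bounds that of \<open>p k\<close>, whichever optimal solution was chosen.\<close>
      fix k assume "k0 \<le> k"
      then obtain \<sigma> \<psi> \<sigma>' \<psi>' where r_feas: "primal_feasible s g f k r \<sigma> \<psi>"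
        and p_opt: "primal_optimal s g f k (p k) \<sigma>' \<psi>'" using k0 opt by blast
      have "primal_value s g f k \<le> ereal (primal_cost r)"
        unfolding primal_value_def using r_feas by (intro Inf_lower) blast
      then have "primal_cost (p k) \<le> primal_cost r" using p_opt by (simp add: primal_optimal_def flip: ereal_less_eq(3))
      then have "?V * primal_cost (p k) \<le> ?V * primal_cost r" by (intro mult_left_mono) auto
      moreover have "(LINT x:box_B|lborel. \<bar>x_eval (p k) x - ?J x\<bar>) =
          ?V * primal_cost (p k) - (LINT x:box_B|lborel. ?J x)"
        using gap[of k "p k" \<sigma>' \<psi>'] p_opt by (simp add: primal_optimal_def)
      moreover have "0 \<le> (LINT x:box_B|lborel. \<bar>x_eval (p k) x - ?J x\<bar>)"
        unfolding set_lebesgue_integral_def by (intro Bochner_Integration.integral_nonneg) auto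
      ultimately show "norm ((LINT x:box_B|lborel. \<bar>x_eval (p k) x - ?J x\<bar>) - 0) < d"
        using r_cost by simp
    qed
  qed
qed

end
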